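(* Let $d\ge 1$ and $0\le n\le d+1$ be integers. Then for every $A\in\mathcal{T}^*(n)$ there exists an irreducible $S\in|\mathcal{O}_{\mathbb{F}}(1,d)|$ containing $A$. Moreover, the general $S\in|\mathcal{I}_A(1,d)|$ contains no twistor fiber other than the connected components of $A$.
   Context: Work over $\mathbb{C}$. For $p,\ell\in\mathbb{P}^2$ write $p\ell=p_0\ell_0+p_1\ell_1+p_2\ell_2$. The flag threefold is $\mathbb{F}=\{(p,\ell)\in\mathbb{P}^2\times\mathbb{P}^2 : p\ell=0\}$, with projections $\pi_1(p,\ell)=p$, $\pi_2(p,\ell)=\ell$, and $\mathcal{O}_{\mathbb{F}}(a,b)$ is the restriction of $\mathcal{O}_{\mathbb{P}^2\times\mathbb{P}^2}(a,b)$. $|\mathcal{I}_A(a,b)|$ is the linear system of members of $|\mathcal{O}_{\mathbb{F}}(a,b)|$ containing $A$. Curves of bidegree $(1,0)$ are the fibers of $\pi_2$. A twistor fiber is a curve $\{(p,\ell)\in\mathbb{F} : p\bar q=0,\ q\ell=0\}$ with $q\in\mathbb{P}^2$ (bar is complex conjugation of coordinates); equivalently, a fiber of $\pi:\mathbb{F}\to\mathbb{P}^2$, $\pi(p,\ell)=\bar p\times\ell$ (formal cross product). $\mathcal{T}(n)$ denotes the set of all unions $A$ of $n$ pairwise disjoint twistor fibers ($A=\emptyset$ if $n=0$), and $\mathcal{T}^*(n)$ is the set of $A\in\mathcal{T}(n)$ such that $\#(L\cap A)\le 2$ for every curve $L$ of bidegree $(1,0)$. Since the twistor fibers form a real (not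 complex) family, "general $S$" is understood in the sense of real dimension: for all $S$ outside a subset of $|\mathcal{I}_A(1,d)|$ of smaller real dimension. *)

theory Defs
  imports "HOL-Analysis.Analysis" "HOL-Library.Function_Algebras"
begin

(* A point of a projective space is the set of all its homogeneous coordinate vectors, so that
   "v \<in> p" reads "v is a vector of homogeneous coordinates of p". *)

definition proj_point :: "(complex \<Rightarrow> 'v \<Rightarrow> 'v) \<Rightarrow> 'v \<Rightarrow> 'v set" where
  "proj_point act v = {act c v | c. c \<noteq> 0}"

type_synonym vec3 = "complex^3"

definition P2 :: "vec3 set set" where
  "P2 = {proj_point (*s) v | v. v \<noteq> 0}"

type_synonym point = "vec3 set \<times> vec3 set"

(* The complex bilinear pairing; the library's inner product on complex^3 is real-valued. *)
definition pairing :: "vec3 \<Rightarrow> vec3 \<Rightarrow> complex" where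
  "pairing v w = (\<Sum>i\<in>UNIV. v $ i * w $ i)"

definition cnj_vec :: "vec3 \<Rightarrow> vec3" where
  "cnj_vec v = (\<chi> i. cnj (v $ i))"

definition flag :: "point set" where
  "flag = {(p, l). p \<in> P2 \<and> l \<in> P2 \<and> (\<forall>v\<in>p. \<forall>w\<in>l. pairing v w = 0)}"

definition exponents :: "nat \<Rightarrow> (nat^3) set" where
  "exponents a = {\<alpha>. (\<Sum>i\<in>UNIV. \<alpha> $ i) = a}"

lemma finite_exponents: "finite (exponents a)"
proof -
  have "exponents a \<subseteq> vec_lambda ` (UNIV \<rightarrow>\<^sub>E {..a})"
  proof
    fix \<alpha> assume "\<alpha> \<in> exponents a"
    then have sum: "(\<Sum>i\<in>UNIV. \<alpha> $ i) = a" by (simp add: exponents_def)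
    have "\<alpha> $ i \<le> a" for i
      using member_le_sum[of i UNIV "\<lambda>i. \<alpha> $ i"] sum by simp
    then have "(\<lambda>i. \<alpha> $ i) \<in> UNIV \<rightarrow>\<^sub>E {..a}" by auto
    then show "\<alpha> \<in> vec_lambda ` (UNIV \<rightarrow>\<^sub>E {..a})"
      by (metis image_eqI vec_nth_inverse)
  qed
  moreover have "finite (vec_lambda ` ((UNIV :: 3 set) \<rightarrow>\<^sub>E {..a}))"
    by (intro finite_imageI finite_PiE) auto
  ultimately show ?thesis by (rule finite_subset)
qed

definition monomial3 :: "nat^3 \<Rightarrow> vec3 \<Rightarrow> complex" where
  "monomial3 \<alpha> v = (\<Prod>i\<in>UNIV. v $ i ^ (\<alpha> $ i))"

(* Bihomogeneous polynomials of bidegree (a,b), as polynomial functions (the field is infinite). *)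
definition bihom :: "nat \<Rightarrow> nat \<Rightarrow> (vec3 \<times> vec3 \<Rightarrow> complex) set" where
  "bihom a b = {f. \<exists>c. f = (\<lambda>(v, w).
     \<Sum>\<alpha>\<in>exponents a. \<Sum>\<beta>\<in>exponents b. c \<alpha> \<beta> * monomial3 \<alpha> v * monomial3 \<beta> w)}"

definition vanishes_at :: "(vec3 \<times> vec3 \<Rightarrow> complex) \<Rightarrow> point \<Rightarrow> bool" where
  "vanishes_at f x \<longleftrightarrow> (\<forall>v\<in>fst x. \<forall>w\<in>snd x. f (v, w) = 0)"

(* The sets where a bihomogeneous polynomial does not vanish form a basis of the topology. *)
definition flag_zariski :: "point topology" where
  "flag_zariski = topology_generated_by
     {{x \<in> flag. \<not> vanishes_at f x} | f. \<exists>a b. f \<in> bihom a b}"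

definition irreducible_in :: "'a topology \<Rightarrow> 'a set \<Rightarrow> bool" where
  "irreducible_in X S \<longleftrightarrow> S \<subseteq> topspace X \<and> S \<noteq> {} \<and>
     (\<forall>Y Z. closedin X Y \<longrightarrow> closedin X Z \<longrightarrow> S \<subseteq> Y \<union> Z \<longrightarrow> S \<subseteq> Y \<or> S \<subseteq> Z)"

(* H^0(F, O_F(a,b)) for a, b \<ge> 0. It is the space of restrictions to F of the forms of bidegree
   (a,b), because H^1 of every line bundle on P2 x P2 vanishes. A section is a function on the
   affine cone pairing v w = 0, extended by zero. *)
definition flag_sections :: "nat \<Rightarrow> nat \<Rightarrow> (vec3 \<times> vec3 \<Rightarrow> complex) set" where
  "flag_sections a b =
     {(\<lambda>(v, w). if pairing v w = 0 then f (v, w) else 0) | f. f \<in> bihom a b}"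

definition cfun_scale :: "complex \<Rightarrow> ('a \<Rightarrow> complex) \<Rightarrow> 'a \<Rightarrow> complex" where
  "cfun_scale c f = (\<lambda>x. c * f x)"

global_interpretation cfun: vector_space "cfun_scale :: complex \<Rightarrow> ('a \<Rightarrow> complex) \<Rightarrow> _"
  by unfold_locales (auto simp: cfun_scale_def fun_eq_iff algebra_simps)

(* An effective divisor is encoded by the class, modulo nonzero scalars, of its equations. *)
type_synonym divisor = "(vec3 \<times> vec3 \<Rightarrow> complex) set"

definition linear_system :: "nat \<Rightarrow> nat \<Rightarrow> divisor set" where
  "linear_system a b = {proj_point cfun_scale s | s. s \<in> flag_sections a b \<and> s \<noteq> 0}"

definition supp :: "divisor \<Rightarrow> point set" where
  "supp S = {x \<in> flag. \<forall>s\<in>S. vanishes_at s x}"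

(* The surface underlying a divisor is irreducible. In bidegree (1,b) such a divisor is also
   reduced, since (1,b) is not a proper multiple in Pic F = Z^2. *)
definition irreducible_divisor :: "divisor \<Rightarrow> bool" where
  "irreducible_divisor S \<longleftrightarrow> irreducible_in flag_zariski (supp S)"

definition linear_system_through :: "point set \<Rightarrow> nat \<Rightarrow> nat \<Rightarrow> divisor set" where
  "linear_system_through A a b = {S \<in> linear_system a b. A \<subseteq> supp S}"

definition twistor_fiber :: "vec3 set \<Rightarrow> point set" where
  "twistor_fiber q = {(p, l) \<in> flag.
     (\<forall>u\<in>q. \<forall>v\<in>p. pairing v (cnj_vec u) = 0) \<and> (\<forall>u\<in>q. \<forall>w\<in>l. pairing u w = 0)}"

definition twistor_fibers :: "point set set" where
  "twistor_fibers = twistor_fiber ` P2"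

definition bidegree10_curves :: "point set set" where
  "bidegree10_curves = {{x \<in> flag. snd x = l} | l. l \<in> P2}"

definition twistor_unions :: "nat \<Rightarrow> point set set" where
  "twistor_unions n = {\<Union>\<C> | \<C>. \<C> \<subseteq> twistor_fibers \<and> finite \<C> \<and> card \<C> = n \<and> disjoint \<C>}"

definition twistor_unions_star :: "nat \<Rightarrow> point set set" where
  "twistor_unions_star n = {A \<in> twistor_unions n.
     \<forall>L\<in>bidegree10_curves. finite (L \<inter> A) \<and> card (L \<inter> A) \<le> 2}"

(* Hausdorff measure and dimension with respect to a distance function d. The number r i is an
   upper bound for the diameter of U i; the infimum over all r is attained at the diameters. *)

definition hausdorff_premeasure ::
    "('a \<Rightarrow> 'a \<Rightarrow> real) \<Rightarrow> real \<Rightarrow> real \<Rightarrow> 'a set \<Rightarrow> ennreal" where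
  "hausdorff_premeasure d s \<delta> B = Inf {\<Sum>i. ennreal (r i powr s) | (U :: nat \<Rightarrow> 'a set) r.
     B \<subseteq> (\<Union>i. U i) \<and>
     (\<forall>i. 0 \<le> r i \<and> r i \<le> \<delta> \<and> (\<forall>x\<in>U i. \<forall>y\<in>U i. d x y \<le> r i))}"

definition hausdorff_measure :: "('a \<Rightarrow> 'a \<Rightarrow> real) \<Rightarrow> real \<Rightarrow> 'a set \<Rightarrow> ennreal" where
  "hausdorff_measure d s B = (SUP \<delta>\<in>{0<..}. hausdorff_premeasure d s \<delta> B)"

definition hausdorff_dim :: "('a \<Rightarrow> 'a \<Rightarrow> real) \<Rightarrow> 'a set \<Rightarrow> ereal" where
  "hausdorff_dim d B = Inf {ereal s | s. 0 < s \<and> hausdorff_measure d s B = 0}"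

definition section_norm :: "(vec3 \<times> vec3 \<Rightarrow> complex) \<Rightarrow> real" where
  "section_norm s = (SUP (v, w) \<in> {(v, w). norm v = 1 \<and> norm w = 1 \<and> pairing v w = 0}.
     norm (s (v, w)))"

(* The distance between the circles of normalized equations: a metric on the projective space
   linear_system a b, Lipschitz equivalent to the Fubini-Study metric since all norms on the
   finite-dimensional space flag_sections a b are equivalent. *)
definition divisor_dist :: "divisor \<Rightarrow> divisor \<Rightarrow> real" where
  "divisor_dist S T = Inf {section_norm (s - t) | s t.
     s \<in> S \<and> t \<in> T \<and> section_norm s = 1 \<and> section_norm t = 1}"

(* Hausdorff dimension, which is the usual real dimension on semialgebraic sets. *)
definition real_dim :: "divisor set \<Rightarrow> ereal" where
  "real_dim B = hausdorff_dim divisor_dist B"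

(* For a linear system \<Lambda> (a projective subspace), \<Union>\<Lambda> is the underlying complex vector space
   without 0; the real dimension is twice the projective dimension. *)
definition linear_system_real_dim :: "divisor set \<Rightarrow> ereal" where
  "linear_system_real_dim \<Lambda> = ereal (2 * (real (cfun.dim (\<Union>\<Lambda>)) - 1))"

end

theory Submission
  imports Defs "HOL-Computational_Algebra.Fundamental_Theorem_Algebra"
begin

text \<open>Write \<open>v\<close> and \<open>w\<close> for homogeneous coordinates of the two points of a flag. A surface of
  bidegree \<open>(1, d)\<close> has an equation \<open>f\<close> that is linear in \<open>v\<close> and of degree \<open>d\<close> in \<open>w\<close>. The twistor
  fiber of \<open>q\<close> is the graph of \<open>w \<mapsto> cnj q \<times> w\<close> over the line \<open>q w = 0\<close>, which is called the line of \<open>q\<close>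
  below. Distinct fibers are disjoint, and the condition on the curves of bidegree \<open>(1, 0)\<close> says that
  no three of the lines pass through a point. So \<open>A\<close> is given by a finite set \<open>Q\<close> of points in general
  position (\<open>twistor_unions_star_cases\<close>).

  Existence of an irreducible surface. Enlarge \<open>Q\<close> to \<open>d + 1\<close> points and take the sum over \<open>a \<in> Q\<close> of
  \<open>(v cnj a)\<close> times the product of all \<open>b w\<close> with \<open>b \<noteq> a\<close>. For most \<open>w\<close> the surface has a single point
  over \<open>w\<close>, so it is irreducible unless it contains the preimage of a curve. Such a curve would meet
  the line of \<open>a\<close>. But on that line the whole preimage of a point lies on the surface only for the
  intersections with the lines of other points of \<open>Q\<close>, and these exceptional points are isolated
  (\<open>exceptional_points_isolated\<close>). In place of the intersection of two curves the proof uses division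
  by a monic polynomial (\<open>vanishes_on_monic_curve\<close>, \<open>vanishes_on_surface\<close>).

  Surfaces through \<open>A\<close> that contain a further fiber, of a point \<open>q\<close> say. There are two kinds of them.

  If \<open>q\<close> lies on a line through two points \<open>a\<close> and \<open>b\<close> of \<open>Q\<close>, the three fibers meet a common curve of
  bidegree \<open>(1, 0)\<close>, and two linear forms in the coefficients of the equation, given by derivatives at
  points of this curve, have the same absolute value. As this condition does not involve \<open>q\<close>, the real
  dimension drops by one although \<open>q\<close> has two real parameters (\<open>null_collinear\<close>).

  If \<open>q\<close> is in general position with respect to \<open>Q\<close>, then \<open>Q\<close> has at most \<open>d\<close> points, because
  a surface cannot contain \<open>d + 2\<close> fibers in general position (\<open>no_section_through_many_fibers\<close>). In
  this case the fiber of \<open>q\<close> imposes at least three complex conditions, whereas \<open>q\<close> has four real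
  parameters, so the real dimension drops by at least two (\<open>null_general\<close>).

  Both dimension counts are instances of \<open>null_family\<close>: linear conditions that depend in a Lipschitz
  way on parameters give a set that is described by as many real coordinates as expected, and this
  bounds its Hausdorff dimension (\<open>hausdorff_null_by_coordinates\<close>).\<close>


section \<open>Cross products over the complex numbers\<close>

definition cross :: "vec3 \<Rightarrow> vec3 \<Rightarrow> vec3" where
  "cross v w = vector [v$2 * w$3 - v$3 * w$2, v$3 * w$1 - v$1 * w$3, v$1 * w$2 - v$2 * w$1]"

definition det3 :: "vec3 \<Rightarrow> vec3 \<Rightarrow> vec3 \<Rightarrow> complex" where
  "det3 a b c = pairing (cross a b) c"

lemma pairing_expand: "pairing v w = v$1 * w$1 + v$2 * w$2 + v$3 * w$3"
  by (simp add: pairing_def sum_3)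

lemma cross_nth [simp]:
  "cross v w $ 1 = v$2 * w$3 - v$3 * w$2"
  "cross v w $ 2 = v$3 * w$1 - v$1 * w$3"
  "cross v w $ 3 = v$1 * w$2 - v$2 * w$1"
  by (simp_all add: cross_def)

lemma cnj_vec_nth [simp]: "cnj_vec v $ i = cnj (v $ i)"
  by (simp add: cnj_vec_def)

lemma vec3_eq_iff: "(v::vec3) = w \<longleftrightarrow> v$1 = w$1 \<and> v$2 = w$2 \<and> v$3 = w$3"
  by (simp add: vec_eq_iff forall_3)

lemma pairing_commute: "pairing v w = pairing w v"
  by (simp add: pairing_expand)

lemma pairing_simps [simp]:
  "pairing (v + v') w = pairing v w + pairing v' w"
  "pairing w (v + v') = pairing w v + pairing w v'"
  "pairing (v - v') w = pairing v w - pairing v' w"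
  "pairing w (v - v') = pairing w v - pairing w v'"
  "pairing (c *s v) w = c * pairing v w"
  "pairing w (c *s v) = c * pairing w v"
  "pairing 0 w = 0" "pairing w 0 = 0"
  by (simp_all add: pairing_expand algebra_simps)

lemma cross_simps [simp]:
  "cross (v + v') w = cross v w + cross v' w"
  "cross w (v + v') = cross w v + cross w v'"
  "cross (v - v') w = cross v w - cross v' w"
  "cross w (v - v') = cross w v - cross w v'"
  "cross (c *s v) w = c *s cross v w"
  "cross w (c *s v) = c *s cross w v"
  "cross 0 w = 0" "cross w 0 = 0" "cross v v = 0"
  by (simp_all add: vec3_eq_iff algebra_simps)

lemma pairing_cross_self [simp]:
  "pairing (cross v w) v = 0" "pairing (cross v w) w = 0"
  "pairing v (cross v w) = 0" "pairing w (cross v w) = 0"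
  by (simp_all add: pairing_expand algebra_simps)

lemma cross_anticommute: "cross v w = - cross w v"
  by (simp add: vec3_eq_iff)

lemma cross_cross: "cross a (cross b c) = pairing a c *s b - pairing a b *s c"
  by (simp add: vec3_eq_iff pairing_expand algebra_simps)

lemma pairing_cross_cycle: "pairing a (cross b c) = pairing (cross a b) c"
  by (simp add: pairing_expand algebra_simps)

lemma cnj_vec_simps [simp]:
  "cnj_vec (v + w) = cnj_vec v + cnj_vec w" "cnj_vec (c *s v) = cnj c *s cnj_vec v"
  "cnj_vec 0 = 0" "cnj_vec (cnj_vec v) = v"
  by (simp_all add: vec3_eq_iff)

lemma cnj_vec_cross: "cnj_vec (cross v w) = cross (cnj_vec v) (cnj_vec w)"
  by (simp add: vec3_eq_iff)

lemma cnj_vec_eq_0 [simp]: "cnj_vec v = 0 \<longleftrightarrow> v = 0"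
  by (simp add: vec3_eq_iff)

lemma pairing_cnj_self [simp]: "pairing v (cnj_vec v) = 0 \<longleftrightarrow> v = 0"
proof -
  have "pairing v (cnj_vec v) = of_real ((cmod (v$1))\<^sup>2 + (cmod (v$2))\<^sup>2 + (cmod (v$3))\<^sup>2)"
    unfolding of_real_add complex_norm_square by (simp add: pairing_expand)
  then have "pairing v (cnj_vec v) = 0 \<longleftrightarrow> (cmod (v$1))\<^sup>2 + (cmod (v$2))\<^sup>2 + (cmod (v$3))\<^sup>2 = 0"
    by (metis of_real_eq_0_iff)
  also have "\<dots> \<longleftrightarrow> v = 0"
    by (auto simp: vec3_eq_iff add_nonneg_eq_0_iff)
  finally show ?thesis .
qed

lemma pairing_cnj_self' [simp]: "pairing (cnj_vec v) v = 0 \<longleftrightarrow> v = 0"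
  using pairing_cnj_self[of v] by (simp add: pairing_commute)

lemma det3_expand_vector:
  "det3 a b c *s v = pairing v (cross b c) *s a + pairing v (cross c a) *s b + pairing v (cross a b) *s c"
  by (simp add: vec3_eq_iff det3_def pairing_expand algebra_simps)

lemma zero_if_pairings_zero:
  assumes "det3 a b c \<noteq> 0" "pairing v a = 0" "pairing v b = 0" "pairing v c = 0"
  shows "v = 0"
proof -
  have "det3 a b c *s v = pairing v a *s cross b c + pairing v b *s cross c a + pairing v c *s cross a b"
    by (simp add: vec3_eq_iff det3_def pairing_expand algebra_simps)
  then show ?thesis using assms by simp
qed

lemma cross_eq_0_imp_multiple:
  assumes "cross v w = 0" "w \<noteq> 0"
  obtains c where "v = c *s w"
proof -
  have "pairing w (cnj_vec w) *s v = pairing v (cnj_vec w) *s w"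
    using cross_cross[of "cnj_vec w" v w] assms(1) by (simp add: pairing_commute)
  then have "v = (pairing v (cnj_vec w) / pairing w (cnj_vec w)) *s w"
    using assms(2) by (simp add: vec3_eq_iff field_simps)
  then show ?thesis using that by blast
qed

text \<open>The common orthogonal complement of two independent vectors is spanned by their cross
  product.\<close>

lemma orthogonal_imp_multiple_cross:
  assumes "cross a b \<noteq> 0" "pairing v a = 0" "pairing v b = 0"
  obtains c where "v = c *s cross a b"
proof -
  have "cross v (cross a b) = 0"
    using assms by (simp add: cross_cross)
  then show ?thesis using cross_eq_0_imp_multiple assms(1) that by blast
qed

lemma orthogonal_to_cross_imp_combination:
  assumes "cross a b \<noteq> 0" "pairing v (cross a b) = 0"
  obtains x y where "v = x *s a + y *s b"
proof -
  define c where "c = cnj_vec (cross a b)"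
  have d: "det3 a b c \<noteq> 0" using assms(1) by (simp add: det3_def c_def)
  have "det3 a b c *s v = pairing v (cross b c) *s a + pairing v (cross c a) *s b"
    using assms(2) by (simp add: det3_expand_vector)
  then have "v = (pairing v (cross b c) / det3 a b c) *s a + (pairing v (cross c a) / det3 a b c) *s b"
    using d by (simp add: vec3_eq_iff field_simps)
  then show ?thesis using that by blast
qed

lemma exists_cross_nonzero:
  assumes "a \<noteq> 0"
  obtains x where "cross a x \<noteq> 0"
proof -
  have "a = 0" if "\<And>x. cross a x = 0"
    using that[of "axis 1 1"] that[of "axis 2 1"] by (simp add: vec3_eq_iff axis_def)
  then show ?thesis using assms that by blast
qed

text \<open>A plane meets the curve \<open>(1, t, t\<^sup>2)\<close> in at most two points.\<close>

lemma exists_off_planes: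
  assumes "finite X" "0 \<notin> X"
  obtains e :: vec3 where "\<And>x. x \<in> X \<Longrightarrow> pairing x e \<noteq> 0"
proof -
  define e :: "complex \<Rightarrow> vec3" where "e t = vector [1, t, t^2]" for t
  have "finite {t. pairing x (e t) = 0}" if "x \<in> X" for x
  proof -
    have eq: "pairing x (e t) = poly [:x$1, x$2, x$3:] t" for t
      by (simp add: pairing_expand e_def algebra_simps power2_eq_square)
    have "[:x$1, x$2, x$3:] \<noteq> 0"
      using that assms(2) by (metis pCons_eq_0_iff vec3_eq_iff zero_index)
    then show ?thesis unfolding eq by (rule poly_roots_finite)
  qed
  then have "finite (\<Union>x\<in>X. {t. pairing x (e t) = 0})" using assms(1) by blast
  then obtain t where "t \<notin> (\<Union>x\<in>X. {t. pairing x (e t) = 0})"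
    using ex_new_if_finite infinite_UNIV_char_0 by blast
  then show ?thesis using that[of "e t"] by blast
qed

section \<open>Polynomial functions\<close>

text \<open>Polynomials are treated as functions. Depending on the generators \<open>X\<close>, the elements of the
  algebra \<open>polyalg X\<close> are polynomials in one or two variables, in the coordinates of a vector, or
  in such coordinates and their conjugates.\<close>

inductive_set polyalg :: "('a \<Rightarrow> complex) set \<Rightarrow> ('a \<Rightarrow> complex) set" for X where
  gen: "x \<in> X \<Longrightarrow> x \<in> polyalg X"
| const [simp, intro]: "(\<lambda>_. c) \<in> polyalg X"
| add [intro]: "f \<in> polyalg X \<Longrightarrow> g \<in> polyalg X \<Longrightarrow> (\<lambda>x. f x + g x) \<in> polyalg X"
| mult [intro]: "f \<in> polyalg X \<Longrightarrow> g \<in> polyalg X \<Longrightarrow> (\<lambda>x. f x * g x) \<in> polyalg X"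

lemma polyalg_diff [intro]:
  "f \<in> polyalg X \<Longrightarrow> g \<in> polyalg X \<Longrightarrow> (\<lambda>x. f x - g x) \<in> polyalg X"
  using polyalg.add[OF _ polyalg.mult[OF polyalg.const[of "-1"]]] by fastforce

lemma polyalg_sum [intro]:
  "(\<And>i. i \<in> I \<Longrightarrow> f i \<in> polyalg X) \<Longrightarrow> (\<lambda>x. \<Sum>i\<in>I. f i x) \<in> polyalg X"
  by (induction I rule: infinite_finite_induct) auto

lemma polyalg_prod [intro]:
  "(\<And>i. i \<in> I \<Longrightarrow> f i \<in> polyalg X) \<Longrightarrow> (\<lambda>x. \<Prod>i\<in>I. f i x) \<in> polyalg X"
  by (induction I rule: infinite_finite_induct) auto

lemma polyalg_power [intro]: "f \<in> polyalg X \<Longrightarrow> (\<lambda>x. f x ^ n) \<in> polyalg X"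
  by (induction n) auto

definition polyvec :: "('a \<Rightarrow> complex) set \<Rightarrow> ('a \<Rightarrow> vec3) \<Rightarrow> bool" where
  "polyvec X g \<longleftrightarrow> (\<forall>i. (\<lambda>x. g x $ i) \<in> polyalg X)"

lemma polyvec_nth: "polyvec X g \<Longrightarrow> (\<lambda>x. g x $ i) \<in> polyalg X"
  by (simp add: polyvec_def)

lemma polyvec_const [intro, simp]: "polyvec X (\<lambda>_. v)"
  by (auto simp: polyvec_def)

lemma polyvec_add [intro]: "polyvec X g \<Longrightarrow> polyvec X h \<Longrightarrow> polyvec X (\<lambda>x. g x + h x)"
  by (auto simp: polyvec_def)

lemma polyvec_scale [intro]: "f \<in> polyalg X \<Longrightarrow> polyvec X h \<Longrightarrow> polyvec X (\<lambda>x. f x *s h x)"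
  by (auto simp: polyvec_def)

lemma polyvec_sum [intro]: "(\<And>i. i \<in> I \<Longrightarrow> polyvec X (f i)) \<Longrightarrow> polyvec X (\<lambda>x. \<Sum>i\<in>I. f i x)"
  by (auto simp: polyvec_def)

lemma polyvec_cross [intro]: "polyvec X g \<Longrightarrow> polyvec X h \<Longrightarrow> polyvec X (\<lambda>x. cross (g x) (h x))"
  by (auto simp: polyvec_def forall_3)

lemma polyalg_pairing [intro]:
  "polyvec X g \<Longrightarrow> polyvec X h \<Longrightarrow> (\<lambda>x. pairing (g x) (h x)) \<in> polyalg X"
  by (auto simp: polyvec_def pairing_def intro!: polyalg_sum polyalg.mult)

abbreviation coords :: "(vec3 \<Rightarrow> complex) set" where
  "coords \<equiv> range (\<lambda>i v. v $ i)"

lemma polyvec_coords [intro, simp]: "polyvec coords (\<lambda>v. v)"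
  by (auto simp: polyvec_def intro: polyalg.gen)

lemma polyalg_id [intro, simp]: "(\<lambda>t. t) \<in> polyalg {\<lambda>t. t}"
  by (auto intro: polyalg.gen)

lemma polyalg_complex:
  assumes "f \<in> polyalg {\<lambda>t. t}"
  obtains P where "\<And>t. f t = poly P t"
proof -
  have "\<exists>P. \<forall>t. f t = poly P t" using assms
  proof induction
    case (gen x) then show ?case by (intro exI[of _ "[:0,1:]"]) auto
  next
    case (const c) then show ?case by (intro exI[of _ "[:c:]"]) auto
  next
    case (add f g) then show ?case by (metis poly_add)
  next
    case (mult f g) then show ?case by (metis poly_mult)
  qed
  then show ?thesis using that by blast
qed

lemma polyalg_complex2:
  assumes "f \<in> polyalg {fst, snd}"
  obtains P :: "complex poly poly" where "\<And>x y. f (x, y) = poly (poly P [:y:]) x"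
proof -
  have "\<exists>P::complex poly poly. \<forall>x y. f (x, y) = poly (poly P [:y:]) x" using assms
  proof induction
    case (gen z)
    then consider "z = fst" | "z = snd" by auto
    then show ?case
    proof cases
      case 1 then show ?thesis by (intro exI[of _ "[:[:0,1:]:]"]) auto
    next
      case 2 then show ?thesis by (intro exI[of _ "[:0, 1:]"]) auto
    qed
  next
    case (const c) then show ?case by (intro exI[of _ "[:[:c:]:]"]) auto
  next
    case (add f g) then show ?case by (metis poly_add)
  next
    case (mult f g) then show ?case by (metis poly_mult)
  qed
  then show ?thesis using that by blast
qed

lemma polyalg_continuous:
  assumes "f \<in> polyalg X" "\<And>x. x \<in> X \<Longrightarrow> continuous_on S x"
  shows "continuous_on S f"
  using assms(1) by induction (simp_all add: assms(2) continuous_on_add continuous_on_mult)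

text \<open>Directional derivatives of a polynomial along complex lines are complex linear in the
  direction.\<close>

lemma polyalg_gradient:
  assumes "f \<in> polyalg coords"
  obtains D where "\<And>e. ((\<lambda>t. f (u + t *s e)) has_field_derivative pairing D e) (at 0)"
proof -
  have "\<exists>D. \<forall>e. ((\<lambda>t. f (u + t *s e)) has_field_derivative pairing D e) (at 0)" using assms
  proof induction
    case (gen x)
    then obtain i where x: "x = (\<lambda>v. v $ i)" by auto
    have "pairing (axis i 1) e = e $ i" for e
      by (simp add: pairing_def axis_def if_distrib if_distribR sum.delta cong: if_cong)
    then show ?case unfolding x
      by (intro exI[of _ "axis i 1"]) (auto intro!: derivative_eq_intros)
  next
    case (const c) then show ?case by (intro exI[of _ 0]) auto
  next
    case (add f g)
    then obtain D E where
      "\<And>e. ((\<lambda>t. f (u + t *s e)) has_field_derivative pairing D e) (at 0)"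
      "\<And>e. ((\<lambda>t. g (u + t *s e)) has_field_derivative pairing E e) (at 0)" by blast
    then show ?case by (intro exI[of _ "D + E"]) (auto intro!: derivative_eq_intros)
  next
    case (mult f g)
    then obtain D E where
      "\<And>e. ((\<lambda>t. f (u + t *s e)) has_field_derivative pairing D e) (at 0)"
      "\<And>e. ((\<lambda>t. g (u + t *s e)) has_field_derivative pairing E e) (at 0)" by blast
    then show ?case
      by (intro exI[of _ "g u *s D + f u *s E"]) (auto intro!: derivative_eq_intros simp: mult_ac)
  qed
  then show ?thesis using that by blast
qed

text \<open>Polynomials in bounded Lipschitz functions are bounded and Lipschitz; \<open>N\<close> plays the role
  of a distance.\<close>

lemma polyalg_lipschitz:
  fixes N :: "'a \<Rightarrow> 'a \<Rightarrow> real"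
  assumes "f \<in> polyalg X" and N: "\<And>y y'. 0 \<le> N y y'"
    and X: "\<And>x. x \<in> X \<Longrightarrow> \<exists>C. \<forall>y\<in>U. cmod (x y) \<le> C \<and> (\<forall>y'\<in>U. cmod (x y - x y') \<le> C * N y y')"
  shows "\<exists>C. \<forall>y\<in>U. cmod (f y) \<le> C \<and> (\<forall>y'\<in>U. cmod (f y - f y') \<le> C * N y y')"
  using assms(1)
proof induction
  case (gen x) then show ?case by (rule X)
next
  case (const c) then show ?case by (intro exI[of _ "cmod c"]) (auto simp: N)
next
  case (add f g)
  then obtain C D where
    C: "\<And>y. y \<in> U \<Longrightarrow> cmod (f y) \<le> C" "\<And>y y'. y \<in> U \<Longrightarrow> y' \<in> U \<Longrightarrow> cmod (f y - f y') \<le> C * N y y'"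
    and D: "\<And>y. y \<in> U \<Longrightarrow> cmod (g y) \<le> D" "\<And>y y'. y \<in> U \<Longrightarrow> y' \<in> U \<Longrightarrow> cmod (g y - g y') \<le> D * N y y'"
    by blast
  show ?case
  proof (intro exI[of _ "C + D"] ballI conjI)
    fix y assume y: "y \<in> U"
    show "cmod (f y + g y) \<le> C + D" using C(1)[OF y] D(1)[OF y] norm_triangle_ineq[of "f y" "g y"] by linarith
    fix y' assume y': "y' \<in> U"
    have "cmod (f y + g y - (f y' + g y')) \<le> cmod (f y - f y') + cmod (g y - g y')"
      using norm_triangle_ineq[of "f y - f y'" "g y - g y'"] by (simp add: algebra_simps)
    then show "cmod (f y + g y - (f y' + g y')) \<le> (C + D) * N y y'"
      using C(2)[OF y y'] D(2)[OF y y'] by (simp add: algebra_simps)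
  qed
next
  case (mult f g)
  then obtain C D where
    C: "\<And>y. y \<in> U \<Longrightarrow> cmod (f y) \<le> C" "\<And>y y'. y \<in> U \<Longrightarrow> y' \<in> U \<Longrightarrow> cmod (f y - f y') \<le> C * N y y'"
    and D: "\<And>y. y \<in> U \<Longrightarrow> cmod (g y) \<le> D" "\<And>y y'. y \<in> U \<Longrightarrow> y' \<in> U \<Longrightarrow> cmod (g y - g y') \<le> D * N y y'"
    by blast
  show ?case
  proof (intro exI[of _ "2 * \<bar>C\<bar> * \<bar>D\<bar>"] ballI conjI)
    fix y assume y: "y \<in> U"
    have "cmod (f y * g y) \<le> \<bar>C\<bar> * \<bar>D\<bar>"
      unfolding norm_mult using C(1)[OF y] D(1)[OF y] by (intro mult_mono) auto
    also have "\<dots> \<le> 2 * \<bar>C\<bar> * \<bar>D\<bar>" using mult_nonneg_nonneg[of "\<bar>C\<bar>" "\<bar>D\<bar>"] by linarith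
    finally show "cmod (f y * g y) \<le> 2 * \<bar>C\<bar> * \<bar>D\<bar>" .
    fix y' assume y': "y' \<in> U"
    have "f y * g y - f y' * g y' = f y * (g y - g y') + (f y - f y') * g y'" by (simp add: algebra_simps)
    then have "cmod (f y * g y - f y' * g y') \<le> cmod (f y) * cmod (g y - g y') + cmod (f y - f y') * cmod (g y')"
      by (metis norm_mult norm_triangle_ineq)
    also have "\<dots> \<le> \<bar>C\<bar> * (\<bar>D\<bar> * N y y') + (\<bar>C\<bar> * N y y') * \<bar>D\<bar>"
    proof (intro add_mono mult_mono)
      show "cmod (g y - g y') \<le> \<bar>D\<bar> * N y y'"
        using D(2)[OF y y'] mult_right_mono[OF abs_ge_self[of D] N[of y y']] by linarith
      show "cmod (f y - f y') \<le> \<bar>C\<bar> * N y y'"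
        using C(2)[OF y y'] mult_right_mono[OF abs_ge_self[of C] N[of y y']] by linarith
    qed (use C(1)[OF y] D(1)[OF y'] N in auto)
    finally show "cmod (f y * g y - f y' * g y') \<le> 2 * \<bar>C\<bar> * \<bar>D\<bar> * N y y'" by (simp add: algebra_simps)
  qed
qed

section \<open>Bihomogeneous forms\<close>

lemma exponents_add: "\<alpha> \<in> exponents a \<Longrightarrow> \<beta> \<in> exponents b \<Longrightarrow> \<alpha> + \<beta> \<in> exponents (a + b)"
  by (auto simp: exponents_def sum.distrib)

lemma monomial3_add: "monomial3 (\<alpha> + \<beta>) v = monomial3 \<alpha> v * monomial3 \<beta> v"
  by (simp add: monomial3_def power_add prod.distrib)

lemma monomial3_scale: "\<alpha> \<in> exponents a \<Longrightarrow> monomial3 \<alpha> (c *s v) = c ^ a * monomial3 \<alpha> v"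
  by (simp add: monomial3_def exponents_def power_mult_distrib prod.distrib power_sum[symmetric])

lemma bihomI:
  "f = (\<lambda>(v, w). \<Sum>\<alpha>\<in>exponents a. \<Sum>\<beta>\<in>exponents b. c \<alpha> \<beta> * monomial3 \<alpha> v * monomial3 \<beta> w) \<Longrightarrow>
   f \<in> bihom a b"
  unfolding bihom_def by blast

lemma bihom_monomial:
  assumes "\<alpha> \<in> exponents a" "\<beta> \<in> exponents b"
  shows "(\<lambda>(v, w). c * (monomial3 \<alpha> v * monomial3 \<beta> w)) \<in> bihom a b"
proof -
  have "(\<Sum>\<alpha>'\<in>exponents a. \<Sum>\<beta>'\<in>exponents b.
      (if \<alpha>' = \<alpha> then if \<beta>' = \<beta> then c else 0 else 0) * monomial3 \<alpha>' v * monomial3 \<beta>' w)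
    = (\<Sum>\<alpha>'\<in>exponents a. \<Sum>\<beta>'\<in>exponents b.
      (if \<beta>' = \<beta> then if \<alpha>' = \<alpha> then c * monomial3 \<alpha>' v * monomial3 \<beta>' w else 0 else 0))" for v w
    by (intro sum.cong refl) auto
  then have "(\<Sum>\<alpha>'\<in>exponents a. \<Sum>\<beta>'\<in>exponents b.
      (if \<alpha>' = \<alpha> then if \<beta>' = \<beta> then c else 0 else 0) * monomial3 \<alpha>' v * monomial3 \<beta>' w)
    = c * (monomial3 \<alpha> v * monomial3 \<beta> w)" for v w
    using assms by (simp add: finite_exponents sum.delta)
  then show ?thesis
    by (intro bihomI[where c = "\<lambda>\<alpha>' \<beta>'. if \<alpha>' = \<alpha> then if \<beta>' = \<beta> then c else 0 else 0"]) (auto simp: fun_eq_iff)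
qed

lemma bihom_zero: "(\<lambda>_. 0) \<in> bihom a b"
  by (intro bihomI[where c = "\<lambda>_ _. 0"]) auto

lemma bihom_add: "f \<in> bihom a b \<Longrightarrow> g \<in> bihom a b \<Longrightarrow> (\<lambda>x. f x + g x) \<in> bihom a b"
  unfolding bihom_def
proof clarsimp
  fix c c'
  show "\<exists>c''. (\<lambda>x. (case x of (v, w) \<Rightarrow> \<Sum>\<alpha>\<in>exponents a. \<Sum>\<beta>\<in>exponents b. c \<alpha> \<beta> * monomial3 \<alpha> v * monomial3 \<beta> w) +
      (case x of (v, w) \<Rightarrow> \<Sum>\<alpha>\<in>exponents a. \<Sum>\<beta>\<in>exponents b. c' \<alpha> \<beta> * monomial3 \<alpha> v * monomial3 \<beta> w)) =
    (\<lambda>(v, w). \<Sum>\<alpha>\<in>exponents a. \<Sum>\<beta>\<in>exponents b. c'' \<alpha> \<beta> * monomial3 \<alpha> v * monomial3 \<beta> w)"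
    by (intro exI[of _ "\<lambda>\<alpha> \<beta>. c \<alpha> \<beta> + c' \<alpha> \<beta>"]) (auto simp: fun_eq_iff algebra_simps sum.distrib)
qed

lemma bihom_sum: "(\<And>i. i \<in> I \<Longrightarrow> f i \<in> bihom a b) \<Longrightarrow> (\<lambda>x. \<Sum>i\<in>I. f i x) \<in> bihom a b"
  by (induction I rule: infinite_finite_induct) (auto intro: bihom_zero bihom_add)

lemma bihom_mult:
  assumes "f \<in> bihom a b" "g \<in> bihom a' b'"
  shows "(\<lambda>x. f x * g x) \<in> bihom (a + a') (b + b')"
proof -
  obtain c c' where
    f: "f = (\<lambda>(v, w). \<Sum>\<alpha>\<in>exponents a. \<Sum>\<beta>\<in>exponents b. c \<alpha> \<beta> * monomial3 \<alpha> v * monomial3 \<beta> w)"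
    and g: "g = (\<lambda>(v, w). \<Sum>\<alpha>\<in>exponents a'. \<Sum>\<beta>\<in>exponents b'. c' \<alpha> \<beta> * monomial3 \<alpha> v * monomial3 \<beta> w)"
    using assms unfolding bihom_def by blast
  have "(\<lambda>x. f x * g x) = (\<lambda>x. \<Sum>\<alpha>\<in>exponents a. \<Sum>\<beta>\<in>exponents b.
      (\<lambda>(v, w). c \<alpha> \<beta> * monomial3 \<alpha> v * monomial3 \<beta> w * g (v, w)) x)"
    unfolding f by (auto simp: fun_eq_iff sum_distrib_right)
  moreover have "(\<lambda>(v, w). c \<alpha> \<beta> * monomial3 \<alpha> v * monomial3 \<beta> w * g (v, w)) =
      (\<lambda>x. \<Sum>\<alpha>'\<in>exponents a'. \<Sum>\<beta>'\<in>exponents b'.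
        (\<lambda>(v, w). (c \<alpha> \<beta> * c' \<alpha>' \<beta>') * (monomial3 (\<alpha> + \<alpha>') v * monomial3 (\<beta> + \<beta>') w)) x)" for \<alpha> \<beta>
    unfolding g by (simp add: fun_eq_iff sum_distrib_left monomial3_add mult_ac)
  ultimately show ?thesis
    by (auto intro!: bihom_sum bihom_monomial exponents_add)
qed

lemma zero_in_exponents: "0 \<in> exponents 0"
  by (simp add: exponents_def)

lemma axis_in_exponents: "axis i 1 \<in> exponents 1"
  by (simp add: exponents_def axis_def sum.delta)

lemma monomial3_zero [simp]: "monomial3 0 v = 1"
  by (simp add: monomial3_def)

lemma monomial3_axis [simp]: "monomial3 (axis i (Suc 0)) v = v $ i"
  by (simp add: monomial3_def axis_def if_distrib prod.delta cong: if_cong)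

lemma bihom_const: "(\<lambda>_. c) \<in> bihom 0 0"
  using bihom_monomial[OF zero_in_exponents zero_in_exponents, of c] by (simp add: case_prod_unfold)

lemma bihom_cmult: "f \<in> bihom a b \<Longrightarrow> (\<lambda>x. c * f x) \<in> bihom a b"
  using bihom_mult[OF bihom_const[of c]] by fastforce

lemma bihom_pairing_fst: "(\<lambda>(v, w). pairing v c) \<in> bihom 1 0"
proof -
  have eq: "(\<lambda>(v, w). pairing v c) = (\<lambda>x. \<Sum>i\<in>UNIV. (\<lambda>(v, w). c $ i * (monomial3 (axis i 1) v * monomial3 0 w)) x)"
    by (auto simp: fun_eq_iff pairing_def mult_ac)
  show ?thesis unfolding eq by (intro bihom_sum bihom_monomial zero_in_exponents axis_in_exponents)
qed

lemma bihom_pairing_snd: "(\<lambda>(v, w). pairing c w) \<in> bihom 0 1"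
proof -
  have eq: "(\<lambda>(v, w). pairing c w) = (\<lambda>x. \<Sum>i\<in>UNIV. (\<lambda>(v, w). c $ i * (monomial3 0 v * monomial3 (axis i 1) w)) x)"
    by (auto simp: fun_eq_iff pairing_def mult_ac)
  show ?thesis unfolding eq by (intro bihom_sum bihom_monomial zero_in_exponents axis_in_exponents)
qed

lemma bihom_prod_pairing_snd:
  "finite Q \<Longrightarrow> (\<lambda>(v, w). \<Prod>q\<in>Q. pairing q w) \<in> bihom 0 (card Q)"
proof (induction Q rule: finite_induct)
  case empty then show ?case using bihom_const[of 1] by (simp add: case_prod_unfold)
next
  case (insert q Q)
  then show ?case
    using bihom_mult[OF bihom_pairing_snd[of q] insert.IH] by (simp add: case_prod_unfold)
qed

lemma bihom_power_pairing_snd: "(\<lambda>(v, w). pairing q w ^ k) \<in> bihom 0 k"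
proof (induction k)
  case 0 then show ?case using bihom_const[of 1] by (simp add: case_prod_unfold)
next
  case (Suc k)
  then show ?case
    using bihom_mult[OF bihom_pairing_snd[of q] Suc.IH] by (simp add: case_prod_unfold)
qed

lemma bihom_scale:
  assumes "f \<in> bihom a b"
  shows "f (c *s v, c' *s w) = c ^ a * c' ^ b * f (v, w)"
  using assms by (auto simp: bihom_def monomial3_scale sum_distrib_left mult_ac intro!: sum.cong)

lemma bihom_polyalg [intro]:
  assumes "f \<in> bihom a b" "polyvec X g" "polyvec X h"
  shows "(\<lambda>x. f (g x, h x)) \<in> polyalg X"
proof -
  obtain c where "f = (\<lambda>(v, w). \<Sum>\<alpha>\<in>exponents a. \<Sum>\<beta>\<in>exponents b. c \<alpha> \<beta> * monomial3 \<alpha> v * monomial3 \<beta> w)"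
    using assms(1) by (auto simp: bihom_def)
  then show ?thesis using assms(2,3)
    by (auto simp: monomial3_def intro!: polyalg_sum polyalg.mult polyalg_prod polyalg_power dest: polyvec_nth)
qed

lemma monomial3_line:
  assumes "\<alpha> \<in> exponents a"
  shows "\<exists>P. degree P \<le> a \<and> (\<forall>t. monomial3 \<alpha> (u + t *s e) = poly P t)"
proof (intro exI conjI allI)
  have "degree (\<Prod>i\<in>UNIV. [:u$i, e$i:] ^ (\<alpha> $ i)) \<le> (\<Sum>i\<in>UNIV. degree ([:u$i, e$i:] ^ (\<alpha> $ i)))"
    by (rule order_trans[OF degree_prod_sum_le]) auto
  also have "\<dots> \<le> (\<Sum>i\<in>UNIV. \<alpha> $ i)"
  proof (rule sum_mono)
    fix i :: 3
    have "degree ([:u$i, e$i:] ^ (\<alpha> $ i)) \<le> degree [:u$i, e$i:] * \<alpha> $ i" by (rule degree_power_le)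
    also have "\<dots> \<le> 1 * \<alpha> $ i" by (intro mult_right_mono) auto
    finally show "degree ([:u$i, e$i:] ^ (\<alpha> $ i)) \<le> \<alpha> $ i" by simp
  qed
  finally show "degree (\<Prod>i\<in>UNIV. [:u$i, e$i:] ^ (\<alpha> $ i)) \<le> a" using assms by (simp add: exponents_def)
  show "monomial3 \<alpha> (u + t *s e) = poly (\<Prod>i\<in>UNIV. [:u$i, e$i:] ^ (\<alpha> $ i)) t" for t
    by (simp add: monomial3_def poly_prod)
qed

lemma bihom_along_polynomials:
  assumes "f \<in> bihom a b"
    and "\<And>\<alpha>. \<alpha> \<in> exponents a \<Longrightarrow> \<exists>P. degree P \<le> m \<and> (\<forall>t. monomial3 \<alpha> (g t) = poly P t)"
    and "\<And>\<beta>. \<beta> \<in> exponents b \<Longrightarrow> \<exists>P. degree P \<le> n \<and> (\<forall>t. monomial3 \<beta> (h t) = poly P t)"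
  shows "\<exists>P. degree P \<le> m + n \<and> (\<forall>t. f (g t, h t) = poly P t)"
proof -
  obtain c where f: "f = (\<lambda>(v, w). \<Sum>\<alpha>\<in>exponents a. \<Sum>\<beta>\<in>exponents b. c \<alpha> \<beta> * monomial3 \<alpha> v * monomial3 \<beta> w)"
    using assms(1) by (auto simp: bihom_def)
  obtain P where P: "\<And>\<alpha>. \<alpha> \<in> exponents a \<Longrightarrow> degree (P \<alpha>) \<le> m"
    "\<And>\<alpha> t. \<alpha> \<in> exponents a \<Longrightarrow> monomial3 \<alpha> (g t) = poly (P \<alpha>) t" using assms(2) by metis
  obtain R where R: "\<And>\<beta>. \<beta> \<in> exponents b \<Longrightarrow> degree (R \<beta>) \<le> n"
    "\<And>\<beta> t. \<beta> \<in> exponents b \<Longrightarrow> monomial3 \<beta> (h t) = poly (R \<beta>) t" using assms(3) by metis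
  show ?thesis
  proof (intro exI conjI allI)
    show "degree (\<Sum>\<alpha>\<in>exponents a. \<Sum>\<beta>\<in>exponents b. smult (c \<alpha> \<beta>) (P \<alpha> * R \<beta>)) \<le> m + n"
    proof (intro degree_sum_le finite_exponents)
      fix \<alpha> \<beta> assume "\<alpha> \<in> exponents a" "\<beta> \<in> exponents b"
      then have "degree (P \<alpha>) + degree (R \<beta>) \<le> m + n" using P R by (simp add: add_mono)
      then show "degree (smult (c \<alpha> \<beta>) (P \<alpha> * R \<beta>)) \<le> m + n"
        using degree_mult_le[of "P \<alpha>" "R \<beta>"] degree_smult_le[of "c \<alpha> \<beta>" "P \<alpha> * R \<beta>"] by linarith
    qed
    show "f (g t, h t) = poly (\<Sum>\<alpha>\<in>exponents a. \<Sum>\<beta>\<in>exponents b. smult (c \<alpha> \<beta>) (P \<alpha> * R \<beta>)) t" for t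
      unfolding f by (auto simp: poly_sum P R mult_ac intro!: sum.cong)
  qed
qed

lemma bihom_line:
  assumes "f \<in> bihom a b"
  obtains P where "degree P \<le> a + b" "\<And>t. f (u + t *s e, u' + t *s e') = poly P t"
  using bihom_along_polynomials[OF assms monomial3_line[of _ _ u e] monomial3_line[of _ _ u' e']] that by blast

lemma bihom_line_snd:
  assumes "f \<in> bihom a b"
  obtains P where "degree P \<le> b" "\<And>t. f (v, u + t *s e) = poly P t"
proof -
  have const: "\<exists>P. degree P \<le> 0 \<and> (\<forall>t. monomial3 \<alpha> v = poly P t)" for \<alpha>
    by (intro exI[of _ "[:monomial3 \<alpha> v:]"]) auto
  have "\<exists>P. degree P \<le> 0 + b \<and> (\<forall>t. f (v, u + t *s e) = poly P t)"
    by (rule bihom_along_polynomials[OF assms const monomial3_line])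
  then show ?thesis using that by auto
qed

lemma prod_UNIV_3: "prod f (UNIV :: 3 set) = f 1 * f 2 * f 3"
  unfolding UNIV_3 by (simp add: mult_ac)

lemma bihom_1_linear:
  assumes "f \<in> bihom 1 b"
  shows "f (x *s v + y *s v', w) = x * f (v, w) + y * f (v', w)"
proof -
  obtain c where f: "f = (\<lambda>(v, w). \<Sum>\<alpha>\<in>exponents 1. \<Sum>\<beta>\<in>exponents b. c \<alpha> \<beta> * monomial3 \<alpha> v * monomial3 \<beta> w)"
    using assms(1) by (auto simp: bihom_def)
  have "monomial3 \<alpha> (x *s v + y *s v') = x * monomial3 \<alpha> v + y * monomial3 \<alpha> v'" if "\<alpha> \<in> exponents 1" for \<alpha>
  proof -
    have "\<alpha>$1 + \<alpha>$2 + \<alpha>$3 = 1" using that by (simp add: exponents_def sum_3)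
    then consider "\<alpha>$1 = 1 \<and> \<alpha>$2 = 0 \<and> \<alpha>$3 = 0" | "\<alpha>$1 = 0 \<and> \<alpha>$2 = 1 \<and> \<alpha>$3 = 0" | "\<alpha>$1 = 0 \<and> \<alpha>$2 = 0 \<and> \<alpha>$3 = 1"
      by linarith
    then show ?thesis by cases (auto simp: monomial3_def prod_UNIV_3)
  qed
  then show ?thesis unfolding f
    by (simp add: algebra_simps sum_distrib_left sum.distrib)
qed

section \<open>Points, sections and twistor fibers in coordinates\<close>

definition pt :: "vec3 \<Rightarrow> vec3 \<Rightarrow> point" where
  "pt v w = (proj_point (*s) v, proj_point (*s) w)"

text \<open>Sections are polynomials on the affine cone over the flag threefold, extended by zero.\<close>

definition sec :: "(vec3 \<times> vec3 \<Rightarrow> complex) \<Rightarrow> vec3 \<times> vec3 \<Rightarrow> complex" where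
  "sec f = (\<lambda>(v, w). if pairing v w = 0 then f (v, w) else 0)"

abbreviation tw :: "vec3 \<Rightarrow> point set" where
  "tw q \<equiv> twistor_fiber (proj_point (*s) q)"

abbreviation divisor_of :: "(vec3 \<times> vec3 \<Rightarrow> complex) \<Rightarrow> divisor" where
  "divisor_of s \<equiv> proj_point cfun_scale s"

lemma flag_sections_eq: "flag_sections a b = sec ` bihom a b"
  by (auto simp: flag_sections_def sec_def)

lemma mem_proj_point: "u \<in> proj_point (*s) (v::vec3) \<longleftrightarrow> (\<exists>c. c \<noteq> 0 \<and> u = c *s v)"
  by (auto simp: proj_point_def)

lemma self_mem_proj_point: "v \<in> proj_point (*s) (v::vec3)"
  by (auto simp: mem_proj_point intro: exI[of _ 1])

lemma proj_point_scale: "c \<noteq> 0 \<Longrightarrow> proj_point (*s) (c *s v) = proj_point (*s) (v::vec3)"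
proof -
  assume c: "c \<noteq> 0"
  have "\<exists>c'. c' \<noteq> 0 \<and> u = c' *s v" if "c'' \<noteq> 0" "u = c'' *s (c *s v)" for c'' u
    using that c by (intro exI[of _ "c'' * c"]) auto
  moreover have "\<exists>c'. c' \<noteq> 0 \<and> u = c' *s (c *s v)" if "c'' \<noteq> 0" "u = c'' *s v" for c'' u
    using that c by (intro exI[of _ "c'' / c"]) auto
  ultimately show ?thesis by (auto simp: set_eq_iff mem_proj_point)
qed

lemma P2_iff: "p \<in> P2 \<longleftrightarrow> (\<exists>v. v \<noteq> 0 \<and> p = proj_point (*s) v)"
  by (auto simp: P2_def)

lemma flag_iff: "x \<in> flag \<longleftrightarrow> (\<exists>v w. v \<noteq> 0 \<and> w \<noteq> 0 \<and> pairing v w = 0 \<and> x = pt v w)"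
proof
  assume "x \<in> flag"
  then show "\<exists>v w. v \<noteq> 0 \<and> w \<noteq> 0 \<and> pairing v w = 0 \<and> x = pt v w"
    by (auto simp: flag_def P2_iff pt_def) (metis self_mem_proj_point)
next
  assume "\<exists>v w. v \<noteq> 0 \<and> w \<noteq> 0 \<and> pairing v w = 0 \<and> x = pt v w"
  then show "x \<in> flag" by (auto simp: flag_def P2_iff pt_def mem_proj_point)
qed

lemma pt_in_flag: "v \<noteq> 0 \<Longrightarrow> w \<noteq> 0 \<Longrightarrow> pairing v w = 0 \<Longrightarrow> pt v w \<in> flag"
  by (auto simp: flag_iff)

lemma bihom_scale_eq_0:
  "f \<in> bihom a b \<Longrightarrow> c \<noteq> 0 \<Longrightarrow> c' \<noteq> 0 \<Longrightarrow> f (c *s v, c' *s w) = 0 \<longleftrightarrow> f (v, w) = 0"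
  by (simp add: bihom_scale)

lemma vanishes_at_pt: "f \<in> bihom a b \<Longrightarrow> vanishes_at f (pt v w) \<longleftrightarrow> f (v, w) = 0"
  using self_mem_proj_point by (auto simp: vanishes_at_def pt_def mem_proj_point bihom_scale_eq_0)

lemma sec_vanishes_at_pt:
  "f \<in> bihom a b \<Longrightarrow> pairing v w = 0 \<Longrightarrow> vanishes_at (sec f) (pt v w) \<longleftrightarrow> f (v, w) = 0"
  using self_mem_proj_point by (auto simp: vanishes_at_def pt_def mem_proj_point bihom_scale_eq_0 sec_def)

lemma self_mem_divisor_of: "s \<in> divisor_of s"
  by (auto simp: proj_point_def cfun_scale_def intro: exI[of _ 1])

lemma supp_divisor_of: "supp (divisor_of s) = {x \<in> flag. vanishes_at s x}"
proof -
  have "(\<forall>s'\<in>divisor_of s. vanishes_at s' x) \<longleftrightarrow> vanishes_at s x" for x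
    using self_mem_divisor_of by (auto simp: vanishes_at_def proj_point_def cfun_scale_def)
  then show ?thesis by (auto simp: supp_def)
qed

lemma pt_in_supp:
  assumes "f \<in> bihom a b" "v \<noteq> 0" "w \<noteq> 0" "pairing v w = 0"
  shows "pt v w \<in> supp (divisor_of (sec f)) \<longleftrightarrow> f (v, w) = 0"
  using assms by (auto simp: supp_divisor_of pt_in_flag sec_vanishes_at_pt)

lemma cross_cnj_nonzero:
  assumes "q \<noteq> 0" "w \<noteq> 0" "pairing q w = 0"
  shows "cross (cnj_vec q) w \<noteq> 0"
proof
  assume "cross (cnj_vec q) w = 0"
  then obtain c where "cnj_vec q = c *s w" using cross_eq_0_imp_multiple assms(2) by blast
  then have "pairing q (cnj_vec q) = 0" using assms(3) by simp
  then show False using assms(1) by simp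
qed

lemma pt_in_tw_iff:
  assumes "v \<noteq> 0" "w \<noteq> 0" "pairing v w = 0"
  shows "pt v w \<in> tw q \<longleftrightarrow> pairing v (cnj_vec q) = 0 \<and> pairing q w = 0"
proof -
  have "pt v w \<in> tw q \<longleftrightarrow> (\<forall>u\<in>proj_point (*s) q. \<forall>v\<in>proj_point (*s) v. pairing v (cnj_vec u) = 0) \<and>
      (\<forall>u\<in>proj_point (*s) q. \<forall>w\<in>proj_point (*s) w. pairing u w = 0)"
    using pt_in_flag[OF assms] by (auto simp: twistor_fiber_def pt_def)
  also have "\<dots> \<longleftrightarrow> pairing v (cnj_vec q) = 0 \<and> pairing q w = 0"
    using self_mem_proj_point[of v] self_mem_proj_point[of w] self_mem_proj_point[of q]
    by (intro iffI conjI) (fastforce simp: mem_proj_point)+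
  finally show ?thesis .
qed

lemma tw_eq:
  assumes "q \<noteq> 0"
  shows "tw q = {pt (cross (cnj_vec q) w) w | w. w \<noteq> 0 \<and> pairing q w = 0}"
proof (intro equalityI subsetI)
  fix x assume x: "x \<in> tw q"
  then have "x \<in> flag" by (auto simp: twistor_fiber_def)
  then obtain v w where vw: "v \<noteq> 0" "w \<noteq> 0" "pairing v w = 0" "x = pt v w" by (auto simp: flag_iff)
  then have *: "pairing v (cnj_vec q) = 0" "pairing q w = 0" using x pt_in_tw_iff by auto
  then obtain c where c: "v = c *s cross (cnj_vec q) w"
    using orthogonal_imp_multiple_cross cross_cnj_nonzero assms vw by metis
  then have "c \<noteq> 0" using vw by auto
  then have "x = pt (cross (cnj_vec q) w) w" using c vw by (simp add: pt_def proj_point_scale)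
  then show "x \<in> {pt (cross (cnj_vec q) w) w | w. w \<noteq> 0 \<and> pairing q w = 0}" using vw * by blast
next
  fix x assume "x \<in> {pt (cross (cnj_vec q) w) w | w. w \<noteq> 0 \<and> pairing q w = 0}"
  then obtain w where "x = pt (cross (cnj_vec q) w) w" "w \<noteq> 0" "pairing q w = 0" by blast
  then show "x \<in> tw q" using pt_in_tw_iff cross_cnj_nonzero assms by simp
qed

lemma bihom_at_zero: "f \<in> bihom a b \<Longrightarrow> b > 0 \<Longrightarrow> f (v, 0) = 0"
  using bihom_scale[of f a b 1 v 0 0] by (simp add: zero_power)

lemma tw_subset_supp:
  assumes "f \<in> bihom a b" "q \<noteq> 0" "b > 0"
  shows "tw q \<subseteq> supp (divisor_of (sec f)) \<longleftrightarrow> (\<forall>w. pairing q w = 0 \<longrightarrow> f (cross (cnj_vec q) w, w) = 0)"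
proof -
  have "tw q \<subseteq> supp (divisor_of (sec f)) \<longleftrightarrow> (\<forall>w. w \<noteq> 0 \<longrightarrow> pairing q w = 0 \<longrightarrow> pt (cross (cnj_vec q) w) w \<in> supp (divisor_of (sec f)))"
    using tw_eq[OF assms(2)] by auto
  also have "\<dots> \<longleftrightarrow> (\<forall>w. w \<noteq> 0 \<longrightarrow> pairing q w = 0 \<longrightarrow> f (cross (cnj_vec q) w, w) = 0)"
    using assms pt_in_supp cross_cnj_nonzero by (metis pairing_cross_self(2))
  also have "\<dots> \<longleftrightarrow> (\<forall>w. pairing q w = 0 \<longrightarrow> f (cross (cnj_vec q) w, w) = 0)"
    using bihom_at_zero[OF assms(1,3)] by metis
  finally show ?thesis .
qed

lemma tw_scale: "c \<noteq> 0 \<Longrightarrow> tw (c *s q) = tw q"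
  by (simp add: proj_point_scale)

lemma tw_nonempty:
  assumes "q \<noteq> 0" shows "tw q \<noteq> {}"
proof -
  obtain x where "cross q x \<noteq> 0" using exists_cross_nonzero[OF assms] .
  then show ?thesis using tw_eq[OF assms] by fastforce
qed

text \<open>A common point of two fibers would be \<open>(v, w)\<close> with \<open>w\<close> proportional to the cross product
  of \<open>a\<close> and \<open>b\<close>, and \<open>v\<close> to its conjugate; these two are not incident.\<close>

lemma tw_disjoint:
  assumes "cross a b \<noteq> 0"
  shows "tw a \<inter> tw b = {}"
proof (rule ccontr)
  assume "tw a \<inter> tw b \<noteq> {}"
  then obtain x where x: "x \<in> tw a" "x \<in> tw b" by blast
  then have "x \<in> flag" by (auto simp: twistor_fiber_def)
  then obtain v w where vw: "v \<noteq> 0" "w \<noteq> 0" "pairing v w = 0" "x = pt v w" by (auto simp: flag_iff)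
  have *: "pairing v (cnj_vec a) = 0" "pairing a w = 0" "pairing v (cnj_vec b) = 0" "pairing b w = 0"
    using x vw pt_in_tw_iff by auto
  obtain c where c: "w = c *s cross a b"
    using orthogonal_imp_multiple_cross[OF assms, of w] * by (metis pairing_commute)
  have "cross (cnj_vec a) (cnj_vec b) \<noteq> 0" using assms by (metis cnj_vec_cross cnj_vec_eq_0)
  then obtain c' where c': "v = c' *s cnj_vec (cross a b)"
    using orthogonal_imp_multiple_cross[of "cnj_vec a" "cnj_vec b" v] * by (metis cnj_vec_cross)
  show False using vw c c' assms by auto
qed

text \<open>The vectors represent distinct points of the projective plane, no three of them on a line.\<close>

definition general_position :: "vec3 set \<Rightarrow> bool" where
  "general_position Q \<longleftrightarrow> finite Q \<and> 0 \<notin> Q \<and> (\<forall>a\<in>Q. \<forall>b\<in>Q. a \<noteq> b \<longrightarrow> cross a b \<noteq> 0) \<and>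
    (\<forall>a\<in>Q. \<forall>b\<in>Q. \<forall>c\<in>Q. a \<noteq> b \<longrightarrow> b \<noteq> c \<longrightarrow> a \<noteq> c \<longrightarrow> det3 a b c \<noteq> 0)"

lemma general_positionD:
  assumes "general_position Q"
  shows "finite Q" "a \<in> Q \<Longrightarrow> a \<noteq> 0" "a \<in> Q \<Longrightarrow> b \<in> Q \<Longrightarrow> a \<noteq> b \<Longrightarrow> cross a b \<noteq> 0"
    "a \<in> Q \<Longrightarrow> b \<in> Q \<Longrightarrow> c \<in> Q \<Longrightarrow> a \<noteq> b \<Longrightarrow> b \<noteq> c \<Longrightarrow> a \<noteq> c \<Longrightarrow> det3 a b c \<noteq> 0"
  using assms by (auto simp: general_position_def)

lemma det3_perm: "det3 a b c = det3 b c a" "det3 a b c = - det3 b a c"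
  by (simp_all add: det3_def pairing_expand algebra_simps)

lemma det3_nonzero_perm:
  "det3 a b c \<noteq> 0 \<Longrightarrow> det3 b c a \<noteq> 0 \<and> det3 c a b \<noteq> 0 \<and> det3 b a c \<noteq> 0 \<and> det3 a c b \<noteq> 0 \<and> det3 c b a \<noteq> 0"
  by (metis det3_perm neg_equal_0_iff_equal)

lemma general_position_insert:
  assumes "general_position Q" "q \<noteq> 0" "\<And>a. a \<in> Q \<Longrightarrow> cross a q \<noteq> 0"
    "\<And>a b. a \<in> Q \<Longrightarrow> b \<in> Q \<Longrightarrow> a \<noteq> b \<Longrightarrow> det3 a b q \<noteq> 0"
  shows "general_position (insert q Q)"
proof -
  have "cross q a \<noteq> 0" if "a \<in> Q" for a
    using assms(3)[OF that] cross_anticommute[of a q] by auto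
  moreover have "det3 a q b \<noteq> 0" "det3 q a b \<noteq> 0" if "a \<in> Q" "b \<in> Q" "a \<noteq> b" for a b
    using assms(4)[OF that] det3_nonzero_perm by blast+
  ultimately show ?thesis using assms unfolding general_position_def by auto
qed

text \<open>The new point has to avoid finitely many points and lines.\<close>

lemma general_position_extend_one:
  assumes "general_position Q"
  obtains q where "q \<notin> Q" "general_position (insert q Q)"
proof -
  have "\<exists>u. u \<noteq> 0 \<and> pairing u a = 0" if a: "a \<noteq> 0" for a
    using exists_cross_nonzero[OF a] pairing_cross_self(1) by metis
  then obtain u where u: "\<And>a. a \<noteq> 0 \<Longrightarrow> u a \<noteq> 0 \<and> pairing (u a) a = 0" by metis
  define X where "X = insert (axis 1 1) (u ` Q \<union> (\<lambda>(a, b). cross a b) ` (Q \<times> Q - Id))"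
  have "finite X" using general_positionD(1)[OF assms] by (auto simp: X_def)
  moreover have "axis 1 1 \<noteq> (0::vec3)" by (simp add: vec3_eq_iff axis_def)
  then have "0 \<notin> X" using general_positionD(2,3)[OF assms] u
    by (auto simp: X_def) metis
  ultimately obtain q where q: "\<And>x. x \<in> X \<Longrightarrow> pairing x q \<noteq> 0" using exists_off_planes by blast
  have q0: "q \<noteq> 0" using q[of "axis 1 1"] by (auto simp: X_def)
  have c: "cross a q \<noteq> 0" if "a \<in> Q" for a
  proof
    assume "cross a q = 0"
    then obtain c where "a = c *s q" using cross_eq_0_imp_multiple q0 by blast
    moreover have "pairing (u a) a = 0" "a \<noteq> 0" using u general_positionD(2)[OF assms] that by auto
    moreover have "pairing (u a) q \<noteq> 0" using q[of "u a"] that by (auto simp: X_def)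
    ultimately show False by auto
  qed
  have "det3 a b q \<noteq> 0" if "a \<in> Q" "b \<in> Q" "a \<noteq> b" for a b
  proof -
    have "cross a b \<in> X" unfolding X_def using that by force
    then show ?thesis using q[of "cross a b"] by (simp add: det3_def pairing_commute)
  qed
  then have "general_position (insert q Q)" using general_position_insert assms q0 c by blast
  moreover have "q \<notin> Q" using c[of q] by auto
  ultimately show ?thesis using that by blast
qed

lemma general_position_extend:
  assumes "general_position Q" "card Q \<le> m"
  obtains Q' where "general_position Q'" "Q \<subseteq> Q'" "card Q' = m"
proof -
  have "\<exists>Q'. general_position Q' \<and> Q \<subseteq> Q' \<and> card Q' = card Q + k" for k
  proof (induction k)
    case 0 then show ?case using assms by auto
  next
    case (Suc k)
    then obtain Q' where Q': "general_position Q'" "Q \<subseteq> Q'" "card Q' = card Q + k" by blast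
    then obtain q where "q \<notin> Q'" "general_position (insert q Q')" using general_position_extend_one by blast
    then show ?case using Q' general_positionD(1)[OF Q'(1)] by (intro exI[of _ "insert q Q'"]) auto
  qed
  from this[of "m - card Q"] show ?thesis using assms that by auto
qed

text \<open>Over a common zero \<open>w\<close> of three linear forms \<open>a\<close>, \<open>b\<close>, \<open>c\<close> the bidegree (1,0) curve of \<open>w\<close>
  would meet three of the fibers.\<close>

lemma twistor_unions_star_cases:
  assumes "A \<in> twistor_unions_star n"
  obtains Q where "general_position Q" "card Q = n" "A = (\<Union>q\<in>Q. tw q)"
proof -
  obtain \<C> where \<C>: "\<C> \<subseteq> twistor_fibers" "finite \<C>" "card \<C> = n" "A = \<Union>\<C>"
    using assms by (auto simp: twistor_unions_star_def twistor_unions_def)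
  define r where "r C = (SOME q. q \<noteq> 0 \<and> C = tw q)" for C
  have "r C \<noteq> 0 \<and> C = tw (r C)" if "C \<in> \<C>" for C
  proof -
    have "C \<in> twistor_fiber ` P2" using \<C>(1) that by (auto simp: twistor_fibers_def)
    then have "\<exists>q. q \<noteq> 0 \<and> C = tw q" by (auto simp: P2_def)
    then show ?thesis unfolding r_def by (rule someI_ex)
  qed
  then have r: "\<And>C. C \<in> \<C> \<Longrightarrow> r C \<noteq> 0" and tw_r: "\<And>C. C \<in> \<C> \<Longrightarrow> tw (r C) = C" by blast+
  define Q where "Q = r ` \<C>"
  have inj: "inj_on r \<C>" using tw_r by (metis inj_onI)
  have A: "A = (\<Union>q\<in>Q. tw q)" using \<C>(4) tw_r by (auto simp: Q_def)
  have tw_inj: "a = b" if "a \<in> Q" "b \<in> Q" "tw a = tw b" for a b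
    using that tw_r unfolding Q_def by (metis imageE)
  have cr: "cross a b \<noteq> 0" if "a \<in> Q" "b \<in> Q" "a \<noteq> b" for a b
  proof
    assume "cross a b = 0"
    moreover have "b \<noteq> 0" "a \<noteq> 0" using that r by (auto simp: Q_def)
    ultimately obtain c where "a = c *s b" using cross_eq_0_imp_multiple by blast
    moreover have "c \<noteq> 0" using \<open>a \<noteq> 0\<close> calculation by auto
    ultimately have "tw a = tw b" using tw_scale by blast
    then show False using tw_inj that by blast
  qed
  have "det3 a b c \<noteq> 0" if abc: "a \<in> Q" "b \<in> Q" "c \<in> Q" "a \<noteq> b" "b \<noteq> c" "a \<noteq> c" for a b c
  proof
    assume d: "det3 a b c = 0"
    define w where "w = cross a b"
    define x where "x q = pt (cross (cnj_vec q) w) w" for q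
    have w: "w \<noteq> 0" "pairing a w = 0" "pairing b w = 0" "pairing c w = 0"
      using cr abc d by (auto simp: w_def det3_def pairing_commute)
    define L where "L = {x \<in> flag. snd x = proj_point (*s) w}"
    have nz: "a \<noteq> 0" "b \<noteq> 0" "c \<noteq> 0" using abc r by (auto simp: Q_def)
    have x_tw: "x a \<in> tw a" "x b \<in> tw b" "x c \<in> tw c" using w nz tw_eq x_def by blast+
    have "x a \<noteq> x b" "x b \<noteq> x c" "x a \<noteq> x c"
      using x_tw tw_disjoint cr abc by (metis IntI empty_iff)+
    then have "card {x a, x b, x c} = 3" by simp
    moreover have "{x a, x b, x c} \<subseteq> L \<inter> A"
    proof -
      have "x q \<in> flag" "snd (x q) = proj_point (*s) w" if "x q \<in> tw q" for q
        using that by (auto simp: twistor_fiber_def) (auto simp: x_def pt_def)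
      then show ?thesis using x_tw abc by (auto simp: L_def A)
    qed
    moreover have "L \<in> bidegree10_curves" using w by (auto simp: L_def bidegree10_curves_def P2_iff)
    then have "finite (L \<inter> A)" "card (L \<inter> A) \<le> 2"
      using assms by (auto simp: twistor_unions_star_def)
    ultimately show False using card_mono[of "L \<inter> A" "{x a, x b, x c}"] by linarith
  qed
  moreover have "finite Q" "0 \<notin> Q" using \<C>(2) r by (auto simp: Q_def)
  ultimately have "general_position Q" using cr by (auto simp: general_position_def)
  moreover have "card Q = n" using card_image[OF inj] \<C>(3) by (simp add: Q_def)
  ultimately show ?thesis using that A by blast
qed

section \<open>The Zariski topology\<close>

lemma openin_nonvanishing: "f \<in> bihom a b \<Longrightarrow> openin flag_zariski {x \<in> flag. \<not> vanishes_at f x}"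
  unfolding flag_zariski_def by (rule topology_generated_by_Basis) blast

lemma topspace_flag_zariski: "topspace flag_zariski = flag"
proof
  show "topspace flag_zariski \<subseteq> flag" unfolding flag_zariski_def topology_generated_by_topspace by blast
  have "\<not> vanishes_at (\<lambda>_. 1) x" if "x \<in> flag" for x
    using that by (auto simp: flag_iff vanishes_at_pt[OF bihom_const])
  then have "{x \<in> flag. \<not> vanishes_at (\<lambda>_. 1) x} = flag" by blast
  then show "flag \<subseteq> topspace flag_zariski"
    using openin_subset[OF openin_nonvanishing[OF bihom_const[of 1]]] by simp
qed

lemma zariski_basic_neighbourhood:
  assumes "openin flag_zariski U" "x \<in> U"
  obtains a b f where "f \<in> bihom a b" "\<not> vanishes_at f x"
    "\<And>y. y \<in> flag \<Longrightarrow> \<not> vanishes_at f y \<Longrightarrow> y \<in> U"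
proof -
  have "generate_topology_on {{x \<in> flag. \<not> vanishes_at f x} |f. \<exists>a b. f \<in> bihom a b} U"
    using assms(1) by (simp add: flag_zariski_def openin_topology_generated_by_iff)
  then have "\<forall>x\<in>U. \<exists>a b. \<exists>f\<in>bihom a b. \<not> vanishes_at f x \<and> (\<forall>y\<in>flag. \<not> vanishes_at f y \<longrightarrow> y \<in> U)"
  proof induction
    case Empty then show ?case by blast
  next
    case (Int U V)
    show ?case
    proof
      fix x assume x: "x \<in> U \<inter> V"
      then obtain a b f where f: "f \<in> bihom a b" "\<not> vanishes_at f x" "\<forall>y\<in>flag. \<not> vanishes_at f y \<longrightarrow> y \<in> U"
        using Int.IH by blast
      obtain a' b' g where g: "g \<in> bihom a' b'" "\<not> vanishes_at g x" "\<forall>y\<in>flag. \<not> vanishes_at g y \<longrightarrow> y \<in> V"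
        using Int.IH x by blast
      have "openin flag_zariski U"
        using Int.hyps(1) by (simp add: flag_zariski_def openin_topology_generated_by_iff)
      then have "x \<in> flag" using x openin_subset topspace_flag_zariski by blast
      then obtain v w where vw: "x = pt v w" by (auto simp: flag_iff)
      note fg = bihom_mult[OF f(1) g(1)]
      have "vanishes_at (\<lambda>x. f x * g x) y \<longleftrightarrow> vanishes_at f y \<or> vanishes_at g y" if y: "y \<in> flag" for y
      proof -
        obtain v w where "y = pt v w" using y by (auto simp: flag_iff)
        then show ?thesis by (simp add: vanishes_at_pt[OF f(1)] vanishes_at_pt[OF g(1)] vanishes_at_pt[OF fg])
      qed
      then show "\<exists>a b. \<exists>f\<in>bihom a b. \<not> vanishes_at f x \<and> (\<forall>y\<in>flag. \<not> vanishes_at f y \<longrightarrow> y \<in> U \<inter> V)"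
        using fg f g \<open>x \<in> flag\<close> by blast
    qed
  next
    case (UN K) then show ?case by blast
  next
    case (Basis s) then show ?case by auto
  qed
  then show ?thesis using assms(2) that by blast
qed

text \<open>A set that is parametrized by polynomials along lines is irreducible: two nonvanishing
  conditions that hold somewhere on the parameter line hold at a common parameter, because the
  product of the corresponding univariate polynomials is not zero.\<close>

lemma polynomial_parametrization_common_point:
  assumes f: "f \<in> bihom a b" and g: "g \<in> bihom a' b'"
    and \<gamma>: "polyvec coords \<gamma>"
    and x: "f (\<gamma> x, x) \<noteq> 0" "\<gamma> x \<noteq> 0" "x \<noteq> 0" and y: "g (\<gamma> y, y) \<noteq> 0"
  obtains t where "f (\<gamma> (x + t *s (y - x)), x + t *s (y - x)) \<noteq> 0"
    "g (\<gamma> (x + t *s (y - x)), x + t *s (y - x)) \<noteq> 0"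
    "\<gamma> (x + t *s (y - x)) \<noteq> 0" "x + t *s (y - x) \<noteq> 0"
proof -
  define l where "l t = x + t *s (y - x)" for t
  have l: "polyvec {\<lambda>t. t} l" unfolding l_def by (intro polyvec_add polyvec_scale polyvec_const polyalg_id)
  have comp: "(\<lambda>t. h (l t)) \<in> polyalg {\<lambda>t. t}" if "h \<in> polyalg coords" for h
    using that by induction (use polyvec_nth[OF l] in auto)
  have \<gamma>l: "polyvec {\<lambda>t. t} (\<lambda>t. \<gamma> (l t))"
    using comp \<gamma> by (auto simp: polyvec_def)
  obtain i j where i: "\<gamma> x $ i \<noteq> 0" and j: "x $ j \<noteq> 0" using x by (auto simp: vec_eq_iff)
  obtain F where F: "\<And>t. f (\<gamma> (l t), l t) = poly F t"
    using polyalg_complex[OF bihom_polyalg[OF f \<gamma>l l]] by blast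
  obtain G where G: "\<And>t. g (\<gamma> (l t), l t) = poly G t"
    using polyalg_complex[OF bihom_polyalg[OF g \<gamma>l l]] by blast
  obtain H where H: "\<And>t. \<gamma> (l t) $ i = poly H t"
    using polyalg_complex[OF polyvec_nth[OF \<gamma>l]] by blast
  obtain K where K: "\<And>t. l t $ j = poly K t"
    using polyalg_complex[OF polyvec_nth[OF l]] by blast
  have l01: "l 0 = x" "l 1 = y" by (auto simp: l_def)
  have "F \<noteq> 0" "G \<noteq> 0" "H \<noteq> 0" "K \<noteq> 0"
    using F[of 0] G[of 1] H[of 0] K[of 0] x y i j by (auto simp: l01)
  then have "F * G * H * K \<noteq> 0" by simp
  then obtain t where "poly (F * G * H * K) t \<noteq> 0" using poly_all_0_iff_0 by blast
  then have "poly F t \<noteq> 0" "poly G t \<noteq> 0" "poly H t \<noteq> 0" "poly K t \<noteq> 0" by auto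
  then have "f (\<gamma> (l t), l t) \<noteq> 0" "g (\<gamma> (l t), l t) \<noteq> 0" "\<gamma> (l t) \<noteq> 0" "l t \<noteq> 0"
    by (auto simp: F G H[symmetric] K[symmetric])
  then show ?thesis using that by (simp add: l_def)
qed

lemma closedin_tw: "closedin flag_zariski (tw q)"
proof -
  define X where "X = {x \<in> flag. \<not> vanishes_at (\<lambda>(v, w). pairing v (cnj_vec q)) x} \<union>
    {x \<in> flag. \<not> vanishes_at (\<lambda>(v, w). pairing q w) x}"
  have "x \<in> tw q \<longleftrightarrow> x \<notin> X" if "x \<in> flag" for x
  proof -
    obtain v w where "v \<noteq> 0" "w \<noteq> 0" "pairing v w = 0" "x = pt v w" using \<open>x \<in> flag\<close> by (auto simp: flag_iff)
    then show ?thesis using that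
      by (auto simp: X_def pt_in_tw_iff vanishes_at_pt[OF bihom_pairing_fst] vanishes_at_pt[OF bihom_pairing_snd])
  qed
  moreover have "tw q \<subseteq> flag" by (auto simp: twistor_fiber_def)
  ultimately have "flag - tw q = X" by (auto simp: X_def)
  moreover have "openin flag_zariski X"
    unfolding X_def using openin_nonvanishing[OF bihom_pairing_fst] openin_nonvanishing[OF bihom_pairing_snd] by blast
  ultimately show ?thesis using \<open>tw q \<subseteq> flag\<close> by (simp add: closedin_def topspace_flag_zariski)
qed

lemma connectedin_tw:
  assumes "q \<noteq> 0"
  shows "connectedin flag_zariski (tw q)"
  unfolding connectedin
proof (intro conjI notI)
  show "tw q \<subseteq> topspace flag_zariski" by (auto simp: twistor_fiber_def topspace_flag_zariski)
  assume "\<exists>U V. openin flag_zariski U \<and> openin flag_zariski V \<and> tw q \<subseteq> U \<union> V \<and> U \<inter> V \<inter> tw q = {} \<and>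
    U \<inter> tw q \<noteq> {} \<and> V \<inter> tw q \<noteq> {}"
  then obtain U V x y where UV: "openin flag_zariski U" "openin flag_zariski V" "U \<inter> V \<inter> tw q = {}"
    "x \<in> U" "x \<in> tw q" "y \<in> V" "y \<in> tw q" by blast
  obtain a b f where f: "f \<in> bihom a b" "\<not> vanishes_at f x" "\<And>y. y \<in> flag \<Longrightarrow> \<not> vanishes_at f y \<Longrightarrow> y \<in> U"
    using zariski_basic_neighbourhood UV by metis
  obtain a' b' g where g: "g \<in> bihom a' b'" "\<not> vanishes_at g y" "\<And>y. y \<in> flag \<Longrightarrow> \<not> vanishes_at g y \<Longrightarrow> y \<in> V"
    using zariski_basic_neighbourhood UV by metis
  define \<gamma> where "\<gamma> w = cross (cnj_vec q) w" for w
  have \<gamma>: "polyvec coords \<gamma>" unfolding \<gamma>_def by (intro polyvec_cross polyvec_const polyvec_coords)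
  obtain u where u: "x = pt (\<gamma> u) u" "u \<noteq> 0" "pairing q u = 0" using UV tw_eq[OF assms] by (auto simp: \<gamma>_def)
  obtain v where v: "y = pt (\<gamma> v) v" "v \<noteq> 0" "pairing q v = 0" using UV tw_eq[OF assms] by (auto simp: \<gamma>_def)
  have 1: "f (\<gamma> u, u) \<noteq> 0" using f u vanishes_at_pt by metis
  have 2: "g (\<gamma> v, v) \<noteq> 0" using g v vanishes_at_pt by metis
  have 3: "\<gamma> u \<noteq> 0" using u assms cross_cnj_nonzero by (simp add: \<gamma>_def)
  obtain t where t: "f (\<gamma> (u + t *s (v - u)), u + t *s (v - u)) \<noteq> 0"
    "g (\<gamma> (u + t *s (v - u)), u + t *s (v - u)) \<noteq> 0"
    "\<gamma> (u + t *s (v - u)) \<noteq> 0" "u + t *s (v - u) \<noteq> 0"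
    using polynomial_parametrization_common_point[OF f(1) g(1) \<gamma> 1 3 u(2) 2] by blast
  define w where "w = u + t *s (v - u)"
  have w: "w \<noteq> 0" "pairing q w = 0" using t u v by (auto simp: w_def)
  have z: "pt (\<gamma> w) w \<in> tw q" using w tw_eq[OF assms] by (auto simp: \<gamma>_def)
  then have "pt (\<gamma> w) w \<in> flag" by (auto simp: twistor_fiber_def)
  then have "pt (\<gamma> w) w \<in> U \<inter> V" using f g t by (auto simp: w_def vanishes_at_pt)
  then show False using z UV by blast
qed

text \<open>The fibers are connected and closed, and there are finitely many of them.\<close>

lemma tw_is_component:
  assumes Q: "general_position Q" and q: "q \<in> Q"
  shows "tw q \<in> connected_components_of (subtopology flag_zariski (\<Union>q\<in>Q. tw q))"
proof -
  define A where "A = (\<Union>q\<in>Q. tw q)"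
  define X where "X = subtopology flag_zariski A"
  have A_flag: "A \<subseteq> flag" by (auto simp: A_def twistor_fiber_def)
  then have X: "topspace X = A" by (auto simp: X_def topspace_flag_zariski)
  have conn: "connectedin X (tw q)"
    using connectedin_tw general_positionD(2)[OF Q q] q by (auto simp: X_def connectedin_subtopology A_def)
  have cl: "closedin X (tw a)" if "a \<in> Q" for a
    unfolding X_def using closedin_tw that by (auto simp: A_def intro!: closedin_subset_topspace)
  have "A - tw q = (\<Union>a\<in>Q - {q}. tw a)"
    using tw_disjoint general_positionD(3)[OF Q] q unfolding A_def by fast
  moreover have "closedin X (\<Union>a\<in>Q - {q}. tw a)"
    using cl general_positionD(1)[OF Q] by (intro closedin_Union) auto
  ultimately have op: "openin X (tw q)"
    using q X by (metis A_def UN_upper closedin_def double_diff order_refl)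
  obtain x where x: "x \<in> tw q" using tw_nonempty general_positionD(2)[OF Q q] by blast
  have "connected_component_of_set X x = tw q"
  proof
    show "tw q \<subseteq> connected_component_of_set X x"
      using conn x by (rule connected_component_of_maximal)
    have "connectedin X (connected_component_of_set X x)" by (rule connectedin_connected_component_of)
    moreover have "openin X (A - tw q)" using cl[OF q] X by (simp add: closedin_def)
    moreover have "connected_component_of_set X x \<subseteq> A"
      using connected_component_of_subset_topspace X by metis
    moreover have "x \<in> connected_component_of_set X x" using x q X by (auto simp: connected_component_of_refl A_def)
    ultimately show "connected_component_of_set X x \<subseteq> tw q"
      using op x unfolding connectedin by blast
  qed
  then show ?thesis
    using x q X unfolding connected_components_of_def X_def[symmetric] A_def[symmetric] by (metis A_def UN_I imageI)
qed

section \<open>An irreducible surface through the fibers\<close>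

text \<open>\<open>fiber_form a R\<close> vanishes on the fiber of \<open>a\<close> because of its first factor, and on the fibers
  of the elements of \<open>R\<close> because of the other ones.\<close>

definition fiber_form :: "vec3 \<Rightarrow> vec3 set \<Rightarrow> vec3 \<times> vec3 \<Rightarrow> complex" where
  "fiber_form a R = (\<lambda>(v, w). pairing v (cnj_vec a) * (\<Prod>b\<in>R. pairing b w))"

text \<open>The surface of \<open>fiber_sum Q\<close> contains the whole curve of bidegree (1,0) over \<open>w\<close> if and only if
  \<open>fiber_vec Q w\<close> is proportional to \<open>w\<close>. Over every other \<open>w\<close> it has exactly one point, with first
  coordinate \<open>cross (fiber_vec Q w) w\<close>.\<close>

definition fiber_vec :: "vec3 set \<Rightarrow> vec3 \<Rightarrow> vec3" where
  "fiber_vec Q w = (\<Sum>a\<in>Q. (\<Prod>b\<in>Q - {a}. pairing b w) *s cnj_vec a)"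

definition fiber_sum :: "vec3 set \<Rightarrow> vec3 \<times> vec3 \<Rightarrow> complex" where
  "fiber_sum Q = (\<lambda>(v, w). pairing v (fiber_vec Q w))"

lemma pairing_sum_right: "pairing v (\<Sum>i\<in>I. f i) = (\<Sum>i\<in>I. pairing v (f i))"
  by (induction I rule: infinite_finite_induct) auto

lemma fiber_sum_eq: "fiber_sum Q x = (\<Sum>a\<in>Q. fiber_form a (Q - {a}) x)"
  by (cases x) (auto simp: fiber_sum_def fiber_form_def fiber_vec_def pairing_sum_right mult_ac)

lemma fiber_form_bihom: "finite R \<Longrightarrow> fiber_form a R \<in> bihom 1 (card R)"
  using bihom_mult[OF bihom_pairing_fst[of "cnj_vec a"] bihom_prod_pairing_snd[of R]]
  by (simp add: fiber_form_def case_prod_unfold)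

lemma fiber_sum_bihom:
  assumes "finite Q" "card Q = d + 1"
  shows "fiber_sum Q \<in> bihom 1 d"
proof -
  have "fiber_form a (Q - {a}) \<in> bihom 1 d" if "a \<in> Q" for a
    using fiber_form_bihom[of "Q - {a}" a] assms that by simp
  then have "(\<lambda>x. \<Sum>a\<in>Q. fiber_form a (Q - {a}) x) \<in> bihom 1 d" by (rule bihom_sum)
  then show ?thesis by (simp add: fiber_sum_eq[abs_def])
qed

lemma fiber_form_vanishes:
  assumes "finite R" "q = a \<or> q \<in> R" "pairing q w = 0"
  shows "fiber_form a R (cross (cnj_vec q) w, w) = 0"
  using assms by (auto simp: fiber_form_def)

lemma polyvec_fiber_vec [intro]: "polyvec X g \<Longrightarrow> polyvec X (\<lambda>x. fiber_vec Q (g x))"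
  unfolding fiber_vec_def
  by (intro polyvec_sum polyvec_scale polyvec_const polyalg_prod polyalg_pairing) auto

lemma fiber_vec_on_line:
  assumes "finite Q" "a \<in> Q" "pairing a w = 0"
  shows "fiber_vec Q w = (\<Prod>b\<in>Q - {a}. pairing b w) *s cnj_vec a"
proof -
  have "(\<Prod>b\<in>Q - {c}. pairing b w) *s cnj_vec c = 0" if "c \<in> Q - {a}" for c
    using assms that by auto
  then have "(\<Sum>c\<in>Q - {a}. (\<Prod>b\<in>Q - {c}. pairing b w) *s cnj_vec c) = 0" by (rule sum.neutral[OF ballI])
  then show ?thesis
    using assms(1,2) by (simp add: fiber_vec_def sum.remove[of Q a])
qed

lemma fiber_vec_scale:
  assumes "finite Q"
  shows "fiber_vec Q (c *s w) = c ^ (card Q - 1) *s fiber_vec Q w"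
proof -
  have "(\<Prod>b\<in>Q - {a}. pairing b (c *s w)) = c ^ (card Q - 1) * (\<Prod>b\<in>Q - {a}. pairing b w)" if "a \<in> Q" for a
    using assms that by (simp add: prod.distrib card_Diff_singleton)
  then show ?thesis unfolding fiber_vec_def
    by (simp add: vec_eq_iff sum_distrib_left mult_ac)
qed

lemma exists_generic_on_line:
  assumes "general_position Q" "a \<in> Q"
  obtains w where "w \<noteq> 0" "pairing a w = 0" "\<And>b. b \<in> Q - {a} \<Longrightarrow> pairing b w \<noteq> 0"
proof -
  obtain z where z: "cross a z \<noteq> 0"
    using exists_cross_nonzero general_positionD(2)[OF assms] by blast
  define X where "X = insert (cross z a) ((\<lambda>b. cross b a) ` (Q - {a}))"
  have "cross b a \<noteq> 0" if "b \<in> Q - {a}" for b using general_positionD(3)[OF assms(1)] assms(2) that by blast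
  moreover have "cross z a \<noteq> 0" using z cross_anticommute[of z a] by auto
  ultimately have "0 \<notin> X" unfolding X_def by (metis image_iff insert_iff)
  moreover have "finite X" using general_positionD(1)[OF assms(1)] by (simp add: X_def)
  ultimately obtain c where c: "\<And>x. x \<in> X \<Longrightarrow> pairing x c \<noteq> 0" using exists_off_planes by blast
  have "pairing b (cross a c) \<noteq> 0" if "b \<in> Q - {a}" for b
    using c[of "cross b a"] that by (auto simp: X_def pairing_cross_cycle)
  moreover have "cross a c \<noteq> 0" using c[of "cross z a"] by (metis X_def insertI1 pairing_cross_cycle pairing_simps(8))
  ultimately show ?thesis using that[of "cross a c"] by auto
qed

lemma polyalg_tendsto:
  assumes "f \<in> polyalg coords" "X \<longlonglongrightarrow> x"
  shows "(\<lambda>n. f (X n)) \<longlonglongrightarrow> f x"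
  using assms(1) by induction (auto intro!: tendsto_intros assms(2))

text \<open>Call \<open>u\<close> exceptional if \<open>fiber_vec Q u\<close> is proportional to \<open>u\<close>. On the line of \<open>a\<close> this happens
  only at the intersections with the lines of the other \<open>b\<close>. There the line of \<open>a\<close> can be split off
  from one of the equations of the exceptional points, and what remains does not vanish at the
  intersection (this is \<open>H\<close> in the proof). So nearby exceptional points lie on the line as well,
  and compactness of the unit sphere gives a uniform bound.\<close>

lemma exceptional_points_isolated:
  assumes Q: "general_position Q" and a: "a \<in> Q"
  obtains \<epsilon> where "\<epsilon> > 0"
    "\<And>u. norm u = 1 \<Longrightarrow> cross (fiber_vec Q u) u = 0 \<Longrightarrow> pairing a u \<noteq> 0 \<Longrightarrow> \<epsilon> \<le> cmod (pairing a u)"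
proof (rule ccontr)
  assume contra: "\<not> thesis"
  note fin = general_positionD(1)[OF Q]
  have "\<exists>u. norm u = 1 \<and> cross (fiber_vec Q u) u = 0 \<and> pairing a u \<noteq> 0 \<and> cmod (pairing a u) < inverse (real (Suc n))" for n
    using contra that[of "inverse (real (Suc n))"] by (meson inverse_positive_iff_positive not_le of_nat_0_less_iff zero_less_Suc)
  then obtain u where u: "\<And>n. norm (u n) = 1" "\<And>n. cross (fiber_vec Q (u n)) (u n) = 0"
    "\<And>n. pairing a (u n) \<noteq> 0" "\<And>n. cmod (pairing a (u n)) < inverse (real (Suc n))" by metis
  have "seq_compact (sphere (0::vec3) 1)" "\<forall>n. u n \<in> sphere (0::vec3) 1"
    using u(1) by (simp_all add: compact_imp_seq_compact)
  then obtain z r where z: "z \<in> sphere (0::vec3) 1" "strict_mono r" "(u \<circ> r) \<longlonglongrightarrow> z"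
    by (rule seq_compactE)
  note lim = polyalg_tendsto[OF _ z(3), unfolded o_def]
  have z0: "z \<noteq> 0" using z(1) by auto
  have "\<forall>n. cmod (pairing a (u n)) \<le> inverse (real (Suc n))" using u(4) less_imp_le by blast
  then have "(\<lambda>n. pairing a (u n)) \<longlonglongrightarrow> 0"
    by (rule Lim_null_comparison[OF always_eventually LIMSEQ_inverse_real_of_nat])
  then have "(\<lambda>n. pairing a (u (r n))) \<longlonglongrightarrow> 0"
    using LIMSEQ_subseq_LIMSEQ[OF _ z(2)] by (fastforce simp: o_def)
  moreover have "(\<lambda>n. pairing a (u (r n))) \<longlonglongrightarrow> pairing a z"
    by (rule lim[of "pairing a"]) (intro polyalg_pairing polyvec_const polyvec_coords)
  ultimately have az: "pairing a z = 0" using LIMSEQ_unique by blast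
  have "cross (fiber_vec Q z) z $ i = 0" for i
  proof -
    have "(\<lambda>n. cross (fiber_vec Q (u (r n))) (u (r n)) $ i) \<longlonglongrightarrow> cross (fiber_vec Q z) z $ i"
      by (rule lim[of "\<lambda>w. cross (fiber_vec Q w) w $ i"])
        (intro polyvec_nth polyvec_cross polyvec_fiber_vec polyvec_coords)
    then show ?thesis using u(2) by (simp add: LIMSEQ_const_iff)
  qed
  then have "cross (fiber_vec Q z) z = 0" by (simp add: vec_eq_iff)
  then have "(\<Prod>b\<in>Q - {a}. pairing b z) = 0"
    using fiber_vec_on_line[OF fin a az] cross_cnj_nonzero[OF general_positionD(2)[OF Q a] z0 az] by simp
  then obtain b where b: "b \<in> Q" "b \<noteq> a" "pairing b z = 0" using fin by auto
  define R where "R = Q - {a} - {b}"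
  define E where "E w = (\<Sum>c\<in>R. (\<Prod>b\<in>R - {c}. pairing b w) *s cnj_vec c)" for w
  define H where "H w = (\<Prod>c\<in>R. pairing c w) * pairing (cross (cnj_vec b) w) (cnj_vec a)
    + pairing b w * pairing (cross (E w) w) (cnj_vec a)" for w
  have finR: "finite R" using fin by (simp add: R_def)
  have expand: "pairing (cross (fiber_vec Q w) w) (cnj_vec a) = pairing a w * H w" for w
  proof -
    have 1: "(\<Prod>c\<in>Q - {a}. pairing c w) = pairing b w * (\<Prod>c\<in>R. pairing c w)"
      using fin b by (simp add: R_def prod.remove[of "Q - {a}" b])
    have "Q - {b} - {a} = R" by (auto simp: R_def)
    then have 2: "(\<Prod>c\<in>Q - {b}. pairing c w) = pairing a w * (\<Prod>c\<in>R. pairing c w)"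
      using fin a b by (simp add: prod.remove[of "Q - {b}" a])
    have 3: "(\<Prod>b\<in>Q - {c}. pairing b w) = pairing a w * pairing b w * (\<Prod>b\<in>R - {c}. pairing b w)" if "c \<in> R" for c
    proof -
      have "(\<Prod>b\<in>Q - {c}. pairing b w) = pairing a w * (\<Prod>b\<in>Q - {c} - {a}. pairing b w)"
        using fin a that by (intro prod.remove) (auto simp: R_def)
      also have "(\<Prod>b\<in>Q - {c} - {a}. pairing b w) = pairing b w * (\<Prod>b\<in>Q - {c} - {a} - {b}. pairing b w)"
        using fin b that by (intro prod.remove) (auto simp: R_def)
      also have "Q - {c} - {a} - {b} = R - {c}" by (auto simp: R_def)
      finally show ?thesis by (simp add: mult_ac)
    qed
    have "fiber_vec Q w = (\<Prod>c\<in>Q - {a}. pairing c w) *s cnj_vec a + ((\<Prod>c\<in>Q - {b}. pairing c w) *s cnj_vec b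
        + (\<Sum>c\<in>R. (\<Prod>b\<in>Q - {c}. pairing b w) *s cnj_vec c))"
      using fin a b by (simp add: fiber_vec_def R_def sum.remove[of Q a] sum.remove[of "Q - {a}" b])
    also have "(\<Sum>c\<in>R. (\<Prod>b\<in>Q - {c}. pairing b w) *s cnj_vec c) = (pairing a w * pairing b w) *s E w"
      using 3 by (simp add: E_def vec_eq_iff sum_distrib_left mult_ac)
    finally show ?thesis unfolding 1 2 H_def by (simp add: algebra_simps)
  qed
  have "H (u n) = 0" for n using expand[of "u n"] u(2,3)[of n] by simp
  moreover have "(\<lambda>n. H (u (r n))) \<longlonglongrightarrow> H z"
    by (rule lim[of H], unfold H_def E_def) (intro polyalg.add polyalg.mult polyalg_prod polyalg_pairing polyvec_cross polyvec_sum
        polyvec_scale polyvec_const polyvec_coords)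
  ultimately have "H z = 0" by (simp add: LIMSEQ_const_iff)
  then have "(\<Prod>c\<in>R. pairing c z) * pairing (cross (cnj_vec b) z) (cnj_vec a) = 0" using b by (simp add: H_def)
  moreover have "pairing c z \<noteq> 0" if "c \<in> R" for c
  proof
    assume "pairing c z = 0"
    then have "z = 0" using zero_if_pairings_zero[of a b c z] az b general_positionD(4)[OF Q a b(1)] that
      by (auto simp: R_def pairing_commute)
    then show False using z0 by simp
  qed
  then have "(\<Prod>c\<in>R. pairing c z) \<noteq> 0" using finR by simp
  moreover have "pairing (cross (cnj_vec b) z) (cnj_vec a) \<noteq> 0"
  proof -
    have ab: "cross a b \<noteq> 0" using general_positionD(3)[OF Q a b(1)] b by auto
    then obtain c where c: "z = c *s cross a b"
      using orthogonal_imp_multiple_cross az b by (metis pairing_commute)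
    then have "c \<noteq> 0" using z0 by auto
    have "pairing (cross (cnj_vec b) z) (cnj_vec a) = pairing z (cross (cnj_vec a) (cnj_vec b))"
      by (simp add: pairing_expand algebra_simps)
    also have "\<dots> = c * pairing (cross a b) (cnj_vec (cross a b))"
      by (simp add: c cnj_vec_cross)
    finally show ?thesis using ab \<open>c \<noteq> 0\<close> by simp
  qed
  ultimately show False by simp
qed

lemma coeff_mult_top:
  assumes "degree p \<le> m" "degree q \<le> n"
  shows "coeff (p * q) (m + n) = coeff p m * coeff q n"
proof (cases "degree p = m \<and> degree q = n")
  case True then show ?thesis using coeff_mult_degree_sum[of p q] by simp
next
  case False
  then have "coeff p m * coeff q n = 0" using assms coeff_eq_0 by (metis le_neq_implies_less mult_eq_0_iff mult_zero_left mult_zero_right)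
  moreover have "degree p + degree q < m + n" using False assms by linarith
  then have "coeff (p * q) (m + n) = 0" using degree_mult_le[of p q] by (intro coeff_eq_0) linarith
  ultimately show ?thesis by simp
qed

lemma prod_linear_polys:
  fixes L :: "'b \<Rightarrow> 'a::comm_ring_1 poly"
  assumes "finite R" "\<And>b. b \<in> R \<Longrightarrow> degree (L b) \<le> 1"
  shows "degree (\<Prod>b\<in>R. L b) \<le> card R \<and> coeff (\<Prod>b\<in>R. L b) (card R) = (\<Prod>b\<in>R. coeff (L b) 1)"
  using assms
proof (induction R rule: finite_induct)
  case empty then show ?case by simp
next
  case (insert b R)
  then have "degree (L b) \<le> 1" "degree (\<Prod>b\<in>R. L b) \<le> card R" by auto
  then have "coeff (L b * (\<Prod>b\<in>R. L b)) (1 + card R) = coeff (L b) 1 * coeff (\<Prod>b\<in>R. L b) (card R)"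
    "degree (L b * (\<Prod>b\<in>R. L b)) \<le> 1 + card R"
    using coeff_mult_top degree_mult_le[of "L b" "\<Prod>b\<in>R. L b"] by (blast, linarith)
  then show ?case using insert by simp
qed

definition at_fst :: "complex \<Rightarrow> complex poly poly \<Rightarrow> complex poly" where
  "at_fst x P = map_poly (\<lambda>c. poly c x) P"

lemma poly_at_fst: "poly (at_fst x P) y = poly (poly P [:y:]) x"
  by (induction P) (auto simp: at_fst_def map_poly_pCons)

text \<open>If \<open>F\<close> vanishes on the curve of \<open>h\<close> over infinitely many values of the first variable, then it
  does so over all values, provided that \<open>h\<close> is monic in the second variable: division of a power
  of \<open>F\<close> by \<open>h\<close> leaves no remainder over those values, hence none at all.\<close>

lemma vanishes_on_monic_curve:
  fixes F h :: "complex poly poly"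
  assumes deg: "degree h = D" "D > 0" and lc: "coeff h D = [:\<kappa>:]" "\<kappa> \<noteq> 0"
    and inf: "infinite X" and van: "\<And>x y. x \<in> X \<Longrightarrow> poly (poly h [:y:]) x = 0 \<Longrightarrow> poly (poly F [:y:]) x = 0"
    and zero: "poly (poly h [:y:]) x = 0"
  shows "poly (poly F [:y:]) x = 0"
proof -
  have h0: "h \<noteq> 0" using deg by auto
  obtain q r where qr: "pseudo_divmod (F ^ D) h = (q, r)" by (metis surj_pair)
  define k where "k = Suc (degree (F ^ D)) - degree h"
  have div: "smult ([:\<kappa>:] ^ k) (F ^ D) = h * q + r" and deg_r: "r = 0 \<or> degree r < D"
    using pseudo_divmod[OF h0 qr] deg lc by (auto simp: k_def)
  have "at_fst x r = 0" if x: "x \<in> X" for x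
  proof -
    have "coeff (at_fst x h) D = \<kappa>" by (simp add: at_fst_def coeff_map_poly lc)
    moreover have "degree (at_fst x h) \<le> D" using map_poly_degree_leq[of "\<lambda>c. poly c x" h] deg by (simp add: at_fst_def)
    ultimately have deg_h: "degree (at_fst x h) = D" using lc(2) le_degree by (metis order_antisym)
    have "\<forall>y. poly (at_fst x h) y = 0 \<longrightarrow> poly (at_fst x F) y = 0" using van[OF x] by (simp add: poly_at_fst)
    then have "at_fst x h dvd (at_fst x F) ^ D"
      using nullstellensatz_univariate[of "at_fst x h" "at_fst x F"] deg_h deg(2) by auto
    moreover have "smult (\<kappa> ^ k) (at_fst x F ^ D) = at_fst x h * at_fst x q + at_fst x r"
    proof -
      have "poly (poly (smult ([:\<kappa>:] ^ k) (F ^ D)) [:y:]) x = poly (poly (h * q + r) [:y:]) x" for y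
        by (simp add: div)
      then have "poly (smult (\<kappa> ^ k) (at_fst x F ^ D)) y = poly (at_fst x h * at_fst x q + at_fst x r) y" for y
        by (simp add: poly_at_fst)
      then show ?thesis by (metis poly_eq_poly_eq_iff ext)
    qed
    ultimately have "at_fst x h dvd at_fst x r"
      by (metis dvd_add_right_iff dvd_smult dvd_triv_left)
    moreover have "at_fst x r = 0 \<or> degree (at_fst x r) < D"
      using deg_r map_poly_degree_leq[of "\<lambda>c. poly c x" r] by (auto simp: at_fst_def)
    ultimately show ?thesis using deg_h dvd_imp_degree_le by (metis not_less)
  qed
  then have "poly (coeff r n) x = 0" if "x \<in> X" for x n
    using that by (metis at_fst_def coeff_0 coeff_map_poly poly_0)
  then have "coeff r n = 0" for n
    using inf poly_roots_finite[of "coeff r n"] by (metis (mono_tags, lifting) finite_subset mem_Collect_eq subsetI)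
  then have "r = 0" by (simp add: poly_eq_iff)
  then have "poly (poly (smult ([:\<kappa>:] ^ k) (F ^ D)) [:y:]) x = 0" using zero by (simp add: div)
  then show ?thesis using lc(2) by simp
qed

lemma exists_two_elements: "finite Q \<Longrightarrow> 2 \<le> card Q \<Longrightarrow> \<exists>a\<in>Q. \<exists>b\<in>Q. a \<noteq> b"
  by (metis One_nat_def Suc_1 card_le_Suc0_iff_eq not_less_eq_eq)

lemma norm_scale_vec: "norm (c *s (v::vec3)) = cmod c * norm v"
  by (simp add: norm_vec_def L2_set_right_distrib norm_mult)

lemma cmod_pairing_le: "cmod (pairing m l) \<le> (\<Sum>i\<in>UNIV. cmod (m $ i)) * norm l"
proof -
  have "cmod (pairing m l) \<le> (\<Sum>i\<in>UNIV. cmod (m $ i) * cmod (l $ i))"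
    unfolding pairing_def by (rule order_trans[OF norm_sum]) (simp add: norm_mult)
  also have "\<dots> \<le> (\<Sum>i\<in>UNIV. cmod (m $ i) * norm l)"
    by (intro sum_mono mult_left_mono Finite_Cartesian_Product.norm_nth_le) auto
  finally show ?thesis by (simp add: sum_distrib_right)
qed

text \<open>Forms that vanish on the points of the surface over non-exceptional \<open>w\<close> vanish on the whole
  surface, which is to say that no exceptional fiber is a component. Around a given point
  \<open>(p0, l0)\<close> the second factor is parametrized by \<open>l0 + x e + y r\<close> with \<open>r\<close> on the line of some
  \<open>a\<close>, and \<open>p0\<close> moves with it so as to stay incident. The line of \<open>a\<close> is a line of constant \<open>x\<close>,
  and for all slightly different \<open>x\<close> there is no exceptional point. As the equation of the surface
  is monic in \<open>y\<close>, this suffices.\<close>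

lemma vanishes_on_surface:
  assumes Q: "general_position Q" and card: "card Q = d + 1" and d: "d \<ge> 1"
    and f: "f \<in> bihom a b"
    and van: "\<And>w. cross (fiber_vec Q w) w \<noteq> 0 \<Longrightarrow> f (cross (fiber_vec Q w) w, w) = 0"
    and p0: "p0 \<noteq> 0" and l0: "l0 \<noteq> 0" and inc: "pairing p0 l0 = 0" and on: "fiber_sum Q (p0, l0) = 0"
  shows "f (p0, l0) = 0"
proof -
  note fin = general_positionD(1)[OF Q]
  have "\<exists>\<alpha>\<in>Q. cross p0 \<alpha> \<noteq> 0"
  proof (rule ccontr)
    assume none: "\<not> ?thesis"
    obtain \<alpha> \<beta> where ab: "\<alpha> \<in> Q" "\<beta> \<in> Q" "\<alpha> \<noteq> \<beta>"
      using exists_two_elements[OF fin] card d by auto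
    have "cross \<alpha> p0 = 0" "cross \<beta> p0 = 0" using none ab cross_anticommute[of p0] by auto
    then obtain c c' where "\<alpha> = c *s p0" "\<beta> = c' *s p0" using cross_eq_0_imp_multiple p0 by metis
    then show False using general_positionD(3)[OF Q ab] by simp
  qed
  then obtain \<alpha> where \<alpha>: "\<alpha> \<in> Q" "cross p0 \<alpha> \<noteq> 0" by blast
  have \<alpha>0: "\<alpha> \<noteq> 0" using general_positionD(2)[OF Q] \<alpha> by blast
  \<comment> \<open>A point \<open>r\<close> of the line of \<open>\<alpha>\<close> off the lines of the other points. It can be chosen such that \<open>p0 r \<noteq> 0\<close>,
    since \<open>p0\<close> is not proportional to \<open>\<alpha>\<close>.\<close>
  define X where "X = insert (cross p0 \<alpha>) ((\<lambda>b. cross b \<alpha>) ` (Q - {\<alpha>}))"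
  have "cross b \<alpha> \<noteq> 0" if "b \<in> Q - {\<alpha>}" for b using general_positionD(3)[OF Q] \<alpha> that by blast
  then have "0 \<notin> X" unfolding X_def using \<alpha> by (metis image_iff insert_iff)
  moreover have "finite X" using fin by (simp add: X_def)
  ultimately obtain c where c: "\<And>x. x \<in> X \<Longrightarrow> pairing x c \<noteq> 0" using exists_off_planes by blast
  define r where "r = cross \<alpha> c"
  have br: "pairing b r \<noteq> 0" if "b \<in> Q - {\<alpha>}" for b
    using c[of "cross b \<alpha>"] that by (auto simp: X_def r_def pairing_cross_cycle)
  have \<alpha>r: "pairing \<alpha> r = 0" by (simp add: r_def)
  have p0r: "pairing p0 r \<noteq> 0" using c[of "cross p0 \<alpha>"] by (simp add: X_def r_def pairing_cross_cycle)
  then have r0: "r \<noteq> 0" by auto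
  have l0r: "cross l0 r \<noteq> 0"
  proof
    assume "cross l0 r = 0"
    then have "cross r l0 = 0" using cross_anticommute[of r l0] by simp
    then obtain c where "r = c *s l0" using cross_eq_0_imp_multiple l0 by blast
    then show False using p0r inc by simp
  qed
  have "finite {\<alpha>, cross (cnj_vec \<alpha>) r, cross l0 r}" "0 \<notin> {\<alpha>, cross (cnj_vec \<alpha>) r, cross l0 r}"
    using \<alpha>0 cross_cnj_nonzero[OF \<alpha>0 r0 \<alpha>r] l0r by auto
  then obtain e where e: "\<And>x. x \<in> {\<alpha>, cross (cnj_vec \<alpha>) r, cross l0 r} \<Longrightarrow> pairing x e \<noteq> 0"
    using exists_off_planes by blast
  \<comment> \<open>Now \<open>l0\<close>, \<open>e\<close> and \<open>r\<close> are independent, and so are \<open>r\<close> and \<open>e\<close> modulo \<open>cnj_vec \<alpha>\<close>. The direction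
    \<open>m\<close> is the only one in which \<open>p0\<close> can move without changing its products with \<open>e\<close> and \<open>r\<close>.\<close>
  define m where "m = cross e r"
  define \<delta> where "\<delta> = pairing (cross l0 r) e"
  have \<delta>: "\<delta> \<noteq> 0" using e by (simp add: \<delta>_def)
  have ml0: "pairing m l0 = - \<delta>" by (simp add: m_def \<delta>_def pairing_expand algebra_simps)
  have \<alpha>e: "pairing \<alpha> e \<noteq> 0" using e by simp
  have m\<alpha>: "pairing m (cnj_vec \<alpha>) \<noteq> 0"
  proof -
    have "pairing m (cnj_vec \<alpha>) = - pairing (cross (cnj_vec \<alpha>) r) e"
      by (simp add: m_def pairing_expand algebra_simps)
    then show ?thesis using e by simp
  qed
  define l where "l x y = l0 + x *s e + y *s r" for x y
  define k where "k x y = (x * pairing p0 e + y * pairing p0 r) / \<delta>" for x y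
  define p where "p x y = p0 + k x y *s m" for x y
  have pl: "pairing (p x y) (l x y) = 0" for x y
  proof -
    have "pairing m e = 0" "pairing m r = 0" by (simp_all add: m_def)
    then show ?thesis using \<delta> inc by (simp add: p_def l_def ml0 k_def field_simps)
  qed
  \<comment> \<open>The equation of the surface in the parameters \<open>x\<close> and \<open>y\<close>. At \<open>y = \<infinity>\<close>, that is at \<open>r\<close>, all its
    terms vanish except that of \<open>\<alpha>\<close>; this is the leading coefficient \<open>\<kappa>\<close>.\<close>
  define L :: "vec3 \<Rightarrow> complex poly poly" where
    "L b = [:[:pairing b l0, pairing b e:], [:pairing b r:]:]" for b
  define P :: "vec3 \<Rightarrow> complex poly poly" where
    "P b = [:[:pairing p0 (cnj_vec b), pairing m (cnj_vec b) * pairing p0 e / \<delta>:],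
      [:pairing m (cnj_vec b) * pairing p0 r / \<delta>:]:]" for b
  define h where "h = (\<Sum>b\<in>Q. P b * (\<Prod>c\<in>Q - {b}. L c))"
  have L: "poly (poly (L b) [:y:]) x = pairing b (l x y)" for b x y
    by (simp add: L_def l_def algebra_simps)
  have P: "poly (poly (P b) [:y:]) x = pairing (p x y) (cnj_vec b)" for b x y
    using \<delta> by (simp add: P_def p_def k_def field_simps)
  have h: "poly (poly h [:y:]) x = fiber_sum Q (p x y, l x y)" for x y
    by (simp add: h_def fiber_sum_eq fiber_form_def poly_sum poly_prod L P)
  define \<kappa> where "\<kappa> = pairing m (cnj_vec \<alpha>) * pairing p0 r / \<delta> * (\<Prod>c\<in>Q - {\<alpha>}. pairing c r)"
  have \<kappa>: "\<kappa> \<noteq> 0" using m\<alpha> p0r \<delta> br fin by (simp add: \<kappa>_def)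
  have top: "degree (P b * (\<Prod>c\<in>Q - {b}. L c)) \<le> d + 1 \<and>
      coeff (P b * (\<Prod>c\<in>Q - {b}. L c)) (d + 1) = (if b = \<alpha> then [:\<kappa>:] else 0)" if b: "b \<in> Q" for b
  proof -
    have cb: "card (Q - {b}) = d" using card b fin by simp
    have dL: "degree (\<Prod>c\<in>Q - {b}. L c) \<le> d" "coeff (\<Prod>c\<in>Q - {b}. L c) d = (\<Prod>c\<in>Q - {b}. [:pairing c r:])"
      using prod_linear_polys[of "Q - {b}" L] fin by (auto simp: cb L_def)
    have dP: "degree (P b) \<le> 1" by (simp add: P_def)
    have 1: "degree (P b * (\<Prod>c\<in>Q - {b}. L c)) \<le> d + 1"
      using degree_mult_le[of "P b" "\<Prod>c\<in>Q - {b}. L c"] dL dP by linarith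
    have const: "(\<Prod>c\<in>R. [:g c:]) = [:\<Prod>c\<in>R. g c:]" for R and g :: "vec3 \<Rightarrow> complex"
      by (induction R rule: infinite_finite_induct) (auto simp: one_pCons)
    have "coeff (P b * (\<Prod>c\<in>Q - {b}. L c)) (1 + d) = coeff (P b) 1 * coeff (\<Prod>c\<in>Q - {b}. L c) d"
      by (rule coeff_mult_top[OF dP dL(1)])
    also have "\<dots> = [:pairing m (cnj_vec b) * pairing p0 r / \<delta> * (\<Prod>c\<in>Q - {b}. pairing c r):]"
      by (simp add: dL(2) P_def const)
    also have "\<dots> = (if b = \<alpha> then [:\<kappa>:] else 0)"
    proof (cases "b = \<alpha>")
      case True then show ?thesis by (simp add: \<kappa>_def)
    next
      case False
      then have "(\<Prod>c\<in>Q - {b}. pairing c r) = 0" using fin \<alpha> \<alpha>r by auto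
      then show ?thesis using False by simp
    qed
    finally show ?thesis using 1 by simp
  qed
  have deg_le: "degree h \<le> d + 1" unfolding h_def using top fin by (intro degree_sum_le) auto
  have "coeff h (d + 1) = (\<Sum>b\<in>Q. if b = \<alpha> then [:\<kappa>:] else 0)"
    unfolding h_def coeff_sum using top by (intro sum.cong) auto
  then have lc: "coeff h (d + 1) = [:\<kappa>:]" using \<alpha> fin by simp
  then have deg: "degree h = d + 1" using deg_le le_degree[of h "d + 1"] \<kappa> by (simp add: le_antisym)
  define pz where "pz z = p (fst z) (snd z)" for z
  define lz where "lz z = l (fst z) (snd z)" for z
  have gens: "fst \<in> polyalg {fst, snd}" "snd \<in> polyalg {fst, snd}"
    by (auto intro: polyalg.gen)
  have kz: "(\<lambda>z. k (fst z) (snd z)) \<in> polyalg {fst, snd}"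
    unfolding k_def divide_inverse by (intro polyalg.mult polyalg.add gens polyalg.const)
  have "polyvec {fst, snd} pz" "polyvec {fst, snd} lz"
    unfolding pz_def p_def lz_def l_def by (intro polyvec_add polyvec_const polyvec_scale kz gens)+
  then obtain F :: "complex poly poly" where "\<And>x y. f (pz (x, y), lz (x, y)) = poly (poly F [:y:]) x"
    using polyalg_complex2[OF bihom_polyalg[OF f]] by metis
  then have F: "poly (poly F [:y:]) x = f (p x y, l x y)" for x y by (simp add: pz_def lz_def)
  \<comment> \<open>\<open>x = x1\<close> is the line of \<open>\<alpha>\<close>. In the punctured disc of radius \<open>\<rho>\<close> around \<open>x1\<close> there is no exceptional
    point: after normalization it would be too close to that line.\<close>
  define x1 where "x1 = - pairing \<alpha> l0 / pairing \<alpha> e"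
  have \<alpha>l: "pairing \<alpha> (l x y) = (x - x1) * pairing \<alpha> e" for x y
    using \<alpha>e by (simp add: l_def \<alpha>r x1_def field_simps)
  obtain \<epsilon> where \<epsilon>: "\<epsilon> > 0"
    "\<And>u. norm u = 1 \<Longrightarrow> cross (fiber_vec Q u) u = 0 \<Longrightarrow> pairing \<alpha> u \<noteq> 0 \<Longrightarrow> \<epsilon> \<le> cmod (pairing \<alpha> u)"
    using exceptional_points_isolated[OF Q \<alpha>(1)] by blast
  define K where "K = (\<Sum>i\<in>UNIV. cmod (m $ i)) + 1"
  have K: "K > 0" unfolding K_def by (intro add_nonneg_pos sum_nonneg) auto
  have norm_l: "cmod \<delta> / K \<le> norm (l x y)" for x y
  proof -
    have "pairing m (l x y) = - \<delta>" by (simp add: l_def ml0) (simp add: m_def)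
    then have "cmod \<delta> \<le> (\<Sum>i\<in>UNIV. cmod (m $ i)) * norm (l x y)" using cmod_pairing_le[of m "l x y"] by simp
    also have "\<dots> \<le> K * norm (l x y)" by (intro mult_right_mono) (auto simp: K_def)
    finally show ?thesis using K by (simp add: field_simps)
  qed
  define \<rho> where "\<rho> = \<epsilon> * (cmod \<delta> / K) / cmod (pairing \<alpha> e)"
  have \<rho>: "\<rho> > 0" using \<epsilon>(1) \<delta> K \<alpha>e by (simp add: \<rho>_def)
  have good: "cross (fiber_vec Q (l x y)) (l x y) \<noteq> 0" if x: "x \<in> ball x1 \<rho> - {x1}" for x y
  proof
    assume exc: "cross (fiber_vec Q (l x y)) (l x y) = 0"
    have n: "norm (l x y) > 0" using norm_l[of x y] \<delta> K
      by (meson divide_pos_pos less_le_trans zero_less_norm_iff)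
    define u where "u = of_real (1 / norm (l x y)) *s l x y"
    have "norm u = 1" using n by (simp add: u_def norm_scale_vec norm_divide)
    moreover have "cross (fiber_vec Q u) u = 0"
      by (simp add: u_def fiber_vec_scale[OF fin] exc)
    moreover have au: "pairing \<alpha> u = of_real (1 / norm (l x y)) * ((x - x1) * pairing \<alpha> e)"
      by (simp add: u_def \<alpha>l)
    moreover have "pairing \<alpha> u \<noteq> 0" using x n \<alpha>e by (auto simp: au)
    ultimately have "\<epsilon> \<le> cmod (x - x1) * cmod (pairing \<alpha> e) / norm (l x y)"
      using \<epsilon>(2)[of u] n by (simp add: norm_mult norm_divide)
    then have "\<epsilon> * norm (l x y) \<le> cmod (x - x1) * cmod (pairing \<alpha> e)" using n by (simp add: field_simps)
    moreover have "\<epsilon> * (cmod \<delta> / K) \<le> \<epsilon> * norm (l x y)" using norm_l \<epsilon>(1) by (intro mult_left_mono) auto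
    ultimately have "\<epsilon> * (cmod \<delta> / K) \<le> cmod (x - x1) * cmod (pairing \<alpha> e)" by linarith
    then have "\<rho> \<le> cmod (x - x1)" unfolding \<rho>_def using \<alpha>e by (subst pos_divide_le_eq) auto
    then show False using x by (simp add: dist_norm norm_minus_commute)
  qed
  have inf: "infinite (ball x1 \<rho> - {x1})"
  proof -
    have "x1 islimpt UNIV" by (rule islimpt_UNIV)
    then have "infinite (ball x1 \<rho>)" using \<rho> unfolding islimpt_eq_infinite_ball by simp
    then show ?thesis by simp
  qed
  have "poly (poly F [:0:]) 0 = 0"
  proof (rule vanishes_on_monic_curve[OF deg _ lc \<kappa> inf])
    show "poly (poly h [:0:]) 0 = 0" unfolding h by (simp add: p_def k_def l_def on)
    fix x y assume x: "x \<in> ball x1 \<rho> - {x1}" and "poly (poly h [:y:]) x = 0"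
    then have "pairing (p x y) (fiber_vec Q (l x y)) = 0" by (simp add: h fiber_sum_def)
    then obtain t where t: "p x y = t *s cross (fiber_vec Q (l x y)) (l x y)"
      using orthogonal_imp_multiple_cross[OF good[OF x]] pl by metis
    have "f (t *s cross (fiber_vec Q (l x y)) (l x y), 1 *s l x y) = 0"
      unfolding bihom_scale[OF f] using van[OF good[OF x]] by simp
    then show "poly (poly F [:y:]) x = 0" by (simp add: F t)
  qed simp
  then show ?thesis using F[of 0 0] by (simp add: p_def k_def l_def)
qed

lemma sec_nonzero: "pairing v w = 0 \<Longrightarrow> f (v, w) \<noteq> 0 \<Longrightarrow> sec f \<noteq> 0"
proof
  assume "pairing v w = 0" "f (v, w) \<noteq> 0" "sec f = 0"
  moreover from this have "sec f (v, w) = 0" by simp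
  moreover have "pairing v w = 0 \<Longrightarrow> sec f (v, w) = f (v, w)" by (simp add: sec_def)
  ultimately show False by simp
qed

text \<open>The points over non-exceptional \<open>w\<close> are parametrized by polynomials, and by the preceding
  lemma every nonempty open subset of the surface contains one of them.\<close>

lemma irreducible_fiber_sum:
  assumes Q: "general_position Q" and card: "card Q = d + 1" and d: "d \<ge> 1"
  shows "divisor_of (sec (fiber_sum Q)) \<in> linear_system 1 d"
    and "irreducible_divisor (divisor_of (sec (fiber_sum Q)))"
    and "a \<in> Q \<Longrightarrow> tw a \<subseteq> supp (divisor_of (sec (fiber_sum Q)))"
proof -
  note fin = general_positionD(1)[OF Q]
  note form = fiber_sum_bihom[OF fin card]
  let ?S = "supp (divisor_of (sec (fiber_sum Q)))"
  define \<gamma> where "\<gamma> w = cross (fiber_vec Q w) w" for w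
  obtain a where a: "a \<in> Q" using card by fastforce
  have a0: "a \<noteq> 0" using general_positionD(2)[OF Q a] .
  obtain w0 where w0: "w0 \<noteq> 0" "pairing a w0 = 0" "\<And>b. b \<in> Q - {a} \<Longrightarrow> pairing b w0 \<noteq> 0"
    using exists_generic_on_line[OF Q a] by blast
  have prod0: "(\<Prod>b\<in>Q - {a}. pairing b w0) \<noteq> 0" using w0 fin by simp
  have vec0: "fiber_vec Q w0 = (\<Prod>b\<in>Q - {a}. pairing b w0) *s cnj_vec a"
    by (rule fiber_vec_on_line[OF fin a w0(2)])
  have "fiber_sum Q (a, w0) \<noteq> 0" using prod0 a0 by (simp add: fiber_sum_def vec0)
  then have "sec (fiber_sum Q) \<noteq> 0" using sec_nonzero w0(2) by blast
  then show "divisor_of (sec (fiber_sum Q)) \<in> linear_system 1 d"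
    using form by (auto simp: linear_system_def flag_sections_eq)
  show "tw a \<subseteq> ?S" if "a \<in> Q" for a
  proof -
    have "fiber_sum Q (cross (cnj_vec a) w, w) = 0" if "pairing a w = 0" for w
      using \<open>a \<in> Q\<close> fin that by (simp add: fiber_sum_eq) (auto intro!: sum.neutral fiber_form_vanishes)
    then show ?thesis using tw_subset_supp[OF form] general_positionD(2)[OF Q that] d by simp
  qed
  have on: "pt (\<gamma> w) w \<in> ?S" if "\<gamma> w \<noteq> 0" "w \<noteq> 0" for w
    using that pt_in_supp[OF form] by (simp add: \<gamma>_def fiber_sum_def)
  have \<gamma>: "polyvec coords \<gamma>"
    unfolding \<gamma>_def by (intro polyvec_cross polyvec_fiber_vec polyvec_coords)
  have dense: "\<exists>w. w \<noteq> 0 \<and> \<gamma> w \<noteq> 0 \<and> f (\<gamma> w, w) \<noteq> 0"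
    if f: "f \<in> bihom b b'" and x: "x \<in> ?S" "\<not> vanishes_at f x" for f b b' x
  proof (rule ccontr)
    assume none: "\<not> ?thesis"
    have "x \<in> flag" using x by (simp add: supp_divisor_of)
    then obtain v w where vw: "v \<noteq> 0" "w \<noteq> 0" "pairing v w = 0" "x = pt v w" by (auto simp: flag_iff)
    have "fiber_sum Q (v, w) = 0" using x vw pt_in_supp[OF form] by simp
    moreover have "f (cross (fiber_vec Q w) w, w) = 0" if "cross (fiber_vec Q w) w \<noteq> 0" for w
      using none that unfolding \<gamma>_def by (metis cross_simps(8))
    ultimately have "f (v, w) = 0" using vanishes_on_surface[OF Q card d f _ vw(1-3)] by blast
    then show False using x vw vanishes_at_pt[OF f] by simp
  qed
  show "irreducible_divisor (divisor_of (sec (fiber_sum Q)))"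
    unfolding irreducible_divisor_def irreducible_in_def
  proof (intro conjI allI impI)
    show "?S \<subseteq> topspace flag_zariski" by (auto simp: supp_divisor_of topspace_flag_zariski)
    have "\<gamma> w0 \<noteq> 0" using prod0 cross_cnj_nonzero[OF a0 w0(1,2)] by (simp add: \<gamma>_def vec0)
    then show "?S \<noteq> {}" using on w0 by blast
    fix Y Z assume Y: "closedin flag_zariski Y" and Z: "closedin flag_zariski Z" and YZ: "?S \<subseteq> Y \<union> Z"
    show "?S \<subseteq> Y \<or> ?S \<subseteq> Z"
    proof (rule ccontr)
      assume "\<not> (?S \<subseteq> Y \<or> ?S \<subseteq> Z)"
      then obtain y z where y: "y \<in> ?S" "y \<notin> Y" and z: "z \<in> ?S" "z \<notin> Z" by blast
      have op: "openin flag_zariski (flag - Y)" "openin flag_zariski (flag - Z)"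
        using Y Z by (auto simp: closedin_def topspace_flag_zariski)
      have yz: "y \<in> flag - Y" "z \<in> flag - Z" using y z by (auto simp: supp_divisor_of)
      obtain b b' f where f: "f \<in> bihom b b'" "\<not> vanishes_at f y"
        "\<And>u. u \<in> flag \<Longrightarrow> \<not> vanishes_at f u \<Longrightarrow> u \<in> flag - Y"
        using zariski_basic_neighbourhood[OF op(1) yz(1)] by metis
      obtain c c' g where g: "g \<in> bihom c c'" "\<not> vanishes_at g z"
        "\<And>u. u \<in> flag \<Longrightarrow> \<not> vanishes_at g u \<Longrightarrow> u \<in> flag - Z"
        using zariski_basic_neighbourhood[OF op(2) yz(2)] by metis
      obtain w where w: "w \<noteq> 0" "\<gamma> w \<noteq> 0" "f (\<gamma> w, w) \<noteq> 0"
        using dense[OF f(1) y(1) f(2)] by metis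
      obtain w' where w': "g (\<gamma> w', w') \<noteq> 0"
        using dense[OF g(1) z(1) g(2)] by metis
      obtain t where t: "f (\<gamma> (w + t *s (w' - w)), w + t *s (w' - w)) \<noteq> 0"
        "g (\<gamma> (w + t *s (w' - w)), w + t *s (w' - w)) \<noteq> 0"
        "\<gamma> (w + t *s (w' - w)) \<noteq> 0" "w + t *s (w' - w) \<noteq> 0"
        using polynomial_parametrization_common_point[OF f(1) g(1) \<gamma> w(3,2,1) w'] by blast
      define u where "u = w + t *s (w' - w)"
      have u: "pt (\<gamma> u) u \<in> ?S" using on t by (simp add: u_def)
      then have "pt (\<gamma> u) u \<in> flag" by (simp add: supp_divisor_of)
      then have "pt (\<gamma> u) u \<notin> Y \<union> Z"
        using f(3)[of "pt (\<gamma> u) u"] g(3)[of "pt (\<gamma> u) u"] t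
        unfolding vanishes_at_pt[OF f(1)] vanishes_at_pt[OF g(1)] u_def by blast
      then show False using u YZ by blast
    qed
  qed
qed

section \<open>Sets of Hausdorff measure zero\<close>

definition small_cover ::
    "('a \<Rightarrow> 'a \<Rightarrow> real) \<Rightarrow> real \<Rightarrow> real \<Rightarrow> real \<Rightarrow> 'a set \<Rightarrow> (nat \<Rightarrow> 'a set) \<Rightarrow> (nat \<Rightarrow> real) \<Rightarrow> bool" where
  "small_cover d s \<delta> \<epsilon> B U r \<longleftrightarrow> B \<subseteq> (\<Union>i. U i) \<and>
     (\<forall>i. 0 \<le> r i \<and> r i \<le> \<delta> \<and> (\<forall>x\<in>U i. \<forall>y\<in>U i. d x y \<le> r i)) \<and>
     (\<Sum>i. ennreal (r i powr s)) \<le> ennreal \<epsilon>"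

lemma small_coverD:
  assumes "small_cover d s \<delta> \<epsilon> B U r"
  shows "B \<subseteq> (\<Union>i. U i)" "0 \<le> r i \<and> r i \<le> \<delta> \<and> (\<forall>x\<in>U i. \<forall>y\<in>U i. d x y \<le> r i)"
    "(\<Sum>i. ennreal (r i powr s)) \<le> ennreal \<epsilon>"
  using assms by (simp_all add: small_cover_def)

lemma hausdorff_null_iff:
  "hausdorff_measure d s B = 0 \<longleftrightarrow> (\<forall>\<delta>>0. \<forall>\<epsilon>>0. \<exists>U r. small_cover d s \<delta> \<epsilon> B U r)"
proof (intro iffI allI impI)
  fix \<delta> \<epsilon> :: real
  assume null: "hausdorff_measure d s B = 0" and pos: "\<delta> > 0" "\<epsilon> > 0"
  define M where "M = {\<Sum>i. ennreal (r i powr s) | (U :: nat \<Rightarrow> 'a set) r. B \<subseteq> (\<Union>i. U i) \<and>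
     (\<forall>i. 0 \<le> r i \<and> r i \<le> \<delta> \<and> (\<forall>x\<in>U i. \<forall>y\<in>U i. d x y \<le> r i))}"
  have "Inf M \<le> hausdorff_measure d s B"
    unfolding hausdorff_measure_def M_def hausdorff_premeasure_def[symmetric] using pos by (intro SUP_upper) auto
  then have "Inf M < ennreal \<epsilon>" using null pos by simp
  then obtain z where "z \<in> M" "z < ennreal \<epsilon>" unfolding Inf_less_iff by auto
  moreover from this obtain U r where "z = (\<Sum>i. ennreal (r i powr s))" "B \<subseteq> (\<Union>i. U i)"
    "\<forall>i. 0 \<le> r i \<and> r i \<le> \<delta> \<and> (\<forall>x\<in>U i. \<forall>y\<in>U i. d x y \<le> r i)" unfolding M_def by auto
  ultimately have "small_cover d s \<delta> \<epsilon> B U r" unfolding small_cover_def by (simp add: less_imp_le)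
  then show "\<exists>U r. small_cover d s \<delta> \<epsilon> B U r" by blast
next
  assume cov: "\<forall>\<delta>>0. \<forall>\<epsilon>>0. \<exists>U r. small_cover d s \<delta> \<epsilon> B U r"
  have "hausdorff_premeasure d s \<delta> B \<le> 0" if "\<delta> > 0" for \<delta>
  proof (rule ennreal_le_epsilon)
    fix \<epsilon> :: real assume "\<epsilon> > 0"
    then obtain U r where U: "small_cover d s \<delta> \<epsilon> B U r" using cov \<open>\<delta> > 0\<close> by blast
    have "hausdorff_premeasure d s \<delta> B \<le> (\<Sum>i. ennreal (r i powr s))"
      unfolding hausdorff_premeasure_def using U by (intro Inf_lower) (auto simp: small_cover_def)
    then show "hausdorff_premeasure d s \<delta> B \<le> 0 + ennreal \<epsilon>"
      using U unfolding small_cover_def by (metis add_0 order_trans)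
  qed
  then have "hausdorff_measure d s B \<le> 0"
    unfolding hausdorff_measure_def by (intro SUP_least) auto
  then show "hausdorff_measure d s B = 0" by simp
qed

lemma hausdorff_null_subset:
  assumes "hausdorff_measure d s B' = 0" "B \<subseteq> B'"
  shows "hausdorff_measure d s B = 0"
proof -
  have "small_cover d s \<delta> \<epsilon> B U r" if "small_cover d s \<delta> \<epsilon> B' U r" for \<delta> \<epsilon> U r
    using that assms(2) unfolding small_cover_def by (metis order_trans)
  then show ?thesis using assms(1) unfolding hausdorff_null_iff by metis
qed

lemma hausdorff_null_empty: "hausdorff_measure d s {} = 0"
  unfolding hausdorff_null_iff
  by (intro allI impI exI[of _ "\<lambda>_. {}"] exI[of _ "\<lambda>_. 0"]) (auto simp: small_cover_def)

lemma hausdorff_null_UN_nat: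
  fixes B :: "nat \<Rightarrow> 'a set"
  assumes "\<And>k. hausdorff_measure d s (B k) = 0"
  shows "hausdorff_measure d s (\<Union>k. B k) = 0"
  unfolding hausdorff_null_iff
proof (intro allI impI)
  fix \<delta> \<epsilon> :: real assume pos: "\<delta> > 0" "\<epsilon> > 0"
  have ex: "\<exists>U r. small_cover d s \<delta> (\<epsilon> * (1/2) ^ Suc k) (B k) U r" for k
    using assms[of k, unfolded hausdorff_null_iff, rule_format, of \<delta> "\<epsilon> * (1/2) ^ Suc k"] pos by auto
  have "\<forall>k. \<exists>z. small_cover d s \<delta> (\<epsilon> * (1/2) ^ Suc k) (B k) (fst z) (snd z)"
    using ex by (metis fst_conv snd_conv)
  from choice[OF this] obtain z
    where z: "\<forall>k. small_cover d s \<delta> (\<epsilon> * (1/2) ^ Suc k) (B k) (fst (z k)) (snd (z k))" by (rule exE)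
  define U where "U k = fst (z k)" for k
  define r where "r k = snd (z k)" for k
  have zz: "small_cover d s \<delta> (\<epsilon> * (1/2) ^ Suc k) (B k) (U k) (r k)" for k
    unfolding U_def r_def by (rule spec[OF z])
  note U = small_coverD[OF zz]
  define f where "f z = ennreal (r (fst z) (snd z) powr s)" for z
  have "(\<Sum>i. f (prod_decode i)) = (\<Sum>k. \<Sum>i. ennreal (r k i powr s))"
    by (rule suminf_ennreal_2dimen) (simp add: f_def)
  also have "\<dots> \<le> (\<Sum>k. ennreal (\<epsilon> * (1/2) ^ Suc k))"
    by (intro suminf_le U(3) summableI)
  also have "\<dots> = ennreal \<epsilon>"
    using pos sums_mult[OF power_half_series, of \<epsilon>] by (intro suminf_ennreal_eq) auto
  finally have sum: "(\<Sum>i. f (prod_decode i)) \<le> ennreal \<epsilon>" .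
  show "\<exists>U r. small_cover d s \<delta> \<epsilon> (\<Union>k. B k) U r"
    unfolding small_cover_def
  proof (intro exI conjI)
    show "(\<Union>k. B k) \<subseteq> (\<Union>n. U (fst (prod_decode n)) (snd (prod_decode n)))"
    proof
      fix x assume "x \<in> (\<Union>k. B k)"
      then obtain k i where "x \<in> U k i" using U(1) by blast
      then have "x \<in> U (fst (prod_decode (prod_encode (k, i)))) (snd (prod_decode (prod_encode (k, i))))" by simp
      then show "x \<in> (\<Union>n. U (fst (prod_decode n)) (snd (prod_decode n)))" by blast
    qed
    show "\<forall>n. 0 \<le> r (fst (prod_decode n)) (snd (prod_decode n)) \<and> r (fst (prod_decode n)) (snd (prod_decode n)) \<le> \<delta> \<and>
      (\<forall>x\<in>U (fst (prod_decode n)) (snd (prod_decode n)). \<forall>y\<in>U (fst (prod_decode n)) (snd (prod_decode n)).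
        d x y \<le> r (fst (prod_decode n)) (snd (prod_decode n)))" using U(2) by blast
    show "(\<Sum>n. ennreal (r (fst (prod_decode n)) (snd (prod_decode n)) powr s)) \<le> ennreal \<epsilon>"
      using sum by (simp add: f_def)
  qed
qed

lemma hausdorff_null_UN:
  assumes "countable I" "\<And>i. i \<in> I \<Longrightarrow> hausdorff_measure d s (B i) = 0"
  shows "hausdorff_measure d s (\<Union>i\<in>I. B i) = 0"
proof (cases "I = {}")
  case True then show ?thesis by (simp add: hausdorff_null_empty)
next
  case False
  have "hausdorff_measure d s (\<Union>k. B (from_nat_into I k)) = 0"
    by (rule hausdorff_null_UN_nat) (simp add: assms(2) from_nat_into[OF False])
  moreover have "(\<Union>i\<in>I. B i) = (\<Union>k. B (from_nat_into I k))"
    using range_from_nat_into[OF False assms(1)] by (metis image_image)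
  ultimately show ?thesis by simp
qed

text \<open>If the distance of two points is at most a constant times that of their bounded real coordinates,
  then the number of these coordinates bounds the dimension: cubes of side \<open>1/M\<close> give a cover by
  at most a constant times \<open>M ^ card J\<close> sets of diameter at most a constant over \<open>M\<close>.\<close>

lemma hausdorff_null_by_coordinates:
  fixes \<Phi> :: "'a \<Rightarrow> 'c \<Rightarrow> real"
  assumes J: "finite J" "real (card J) < s"
    and bound: "\<And>x c. x \<in> B \<Longrightarrow> c \<in> J \<Longrightarrow> \<bar>\<Phi> x c\<bar> \<le> R" and R: "R \<ge> 0"
    and lip: "\<And>x y. x \<in> B \<Longrightarrow> y \<in> B \<Longrightarrow> d x y \<le> C * (\<Sum>c\<in>J. \<bar>\<Phi> x c - \<Phi> y c\<bar>)" and C: "C \<ge> 0"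
  shows "hausdorff_measure d s B = 0"
  unfolding hausdorff_null_iff
proof (intro allI impI)
  fix \<delta> \<epsilon> :: real assume pos: "\<delta> > 0" "\<epsilon> > 0"
  define k where "k = card J"
  \<comment> \<open>\<open>A * M powr (k - s)\<close> will bound the sum for the cover by cubes of side \<open>1 / M\<close>.\<close>
  define A where "A = (2 * R + 5) ^ k * (C * k) powr s"
  have "(\<lambda>M. A * real M powr (real k - s)) \<longlonglongrightarrow> A * 0"
    using J(2) by (intro tendsto_mult tendsto_const tendsto_neg_powr filterlim_real_sequentially) (simp add: k_def)
  then have ev1: "\<forall>\<^sub>F M in sequentially. A * real M powr (real k - s) < \<epsilon>"
    using pos by (intro order_tendstoD(2)[where y = "A * 0"]) auto
  have "(\<lambda>M. C * k / real M) \<longlonglongrightarrow> 0" by (rule lim_const_over_n)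
  then have ev2: "\<forall>\<^sub>F M in sequentially. C * k / real M < \<delta>" using pos by (intro order_tendstoD(2)) auto
  obtain M where M: "A * real M powr (real k - s) < \<epsilon>" "C * k / real M < \<delta>" "M \<ge> 1"
    using eventually_happens[OF eventually_conj[OF ev1 eventually_conj[OF ev2 eventually_ge_at_top[of 1]]]] by auto
  define \<rho> where "\<rho> = C * k / real M"
  have \<rho>: "\<rho> \<ge> 0" "\<rho> \<le> \<delta>" using C M by (auto simp: \<rho>_def)
  define K where "K = nat \<lceil>M * R\<rceil> + 1"
  have K: "real K \<le> M * R + 2" using R by (simp add: K_def) linarith
  define cell where "cell x = (\<lambda>c\<in>J. \<lfloor>M * \<Phi> x c\<rfloor>)" for x
  define T where "T = J \<rightarrow>\<^sub>E {- int K..int K}"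
  have finT: "finite T" using J(1) by (auto simp: T_def intro: finite_PiE)
  have cell: "cell x \<in> T" if x: "x \<in> B" for x
  proof -
    have "\<lfloor>M * \<Phi> x c\<rfloor> \<in> {- int K..int K}" if c: "c \<in> J" for c
    proof -
      have "\<bar>M * \<Phi> x c\<bar> \<le> M * R" using bound[OF x c] by (simp add: abs_mult mult_left_mono)
      moreover have "M * R \<le> real K - 1" using R by (simp add: K_def)
      ultimately have "- real K \<le> M * \<Phi> x c" "M * \<Phi> x c \<le> real K" by linarith+
      then show ?thesis by (auto simp: le_floor_iff floor_le_iff)
    qed
    then show ?thesis by (auto simp: cell_def T_def)
  qed
  have cardT: "real (card T) \<le> (M * (2 * R + 5)) ^ k"
  proof -
    have "card T = (2 * K + 1) ^ k" using J(1) by (simp add: T_def card_PiE k_def nat_add_distrib nat_mult_distrib)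
    then have "real (card T) = (2 * real K + 1) ^ k" by (simp add: add.commute)
    also have "\<dots> \<le> (M * (2 * R + 5)) ^ k"
    proof (intro power_mono)
      have "5 \<le> real M * 5" using M(3) by simp
      then show "2 * real K + 1 \<le> M * (2 * R + 5)" using K by (simp add: algebra_simps)
    qed auto
    finally show ?thesis .
  qed
  obtain h where h: "bij_betw h {0..<card T} T" using ex_bij_betw_nat_finite[OF finT] by blast
  define U where "U i = (if i < card T then {x \<in> B. cell x = h i} else {})" for i
  define r where "r i = (if i < card T then \<rho> else 0)" for i
  have 1: "B \<subseteq> (\<Union>i. U i)"
  proof
    fix x assume x: "x \<in> B"
    then have "cell x \<in> h ` {0..<card T}" using cell h by (simp add: bij_betw_def)
    then obtain i where "i < card T" "cell x = h i" by auto
    then have "x \<in> U i" using x by (simp add: U_def)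
    then show "x \<in> (\<Union>i. U i)" by blast
  qed
  have 2: "0 \<le> r i \<and> r i \<le> \<delta> \<and> (\<forall>x\<in>U i. \<forall>y\<in>U i. d x y \<le> r i)" for i
  proof (intro conjI ballI)
    show "0 \<le> r i" "r i \<le> \<delta>" using \<rho> pos by (auto simp: r_def)
    fix x y assume xy: "x \<in> U i" "y \<in> U i"
    then have i: "i < card T" "x \<in> B" "y \<in> B" "cell x = cell y" by (auto simp: U_def split: if_splits)
    have "\<bar>\<Phi> x c - \<Phi> y c\<bar> \<le> 1 / M" if c: "c \<in> J" for c
    proof -
      have "\<lfloor>M * \<Phi> x c\<rfloor> = \<lfloor>M * \<Phi> y c\<rfloor>" using i(4) c by (metis cell_def restrict_apply')
      then have "\<bar>M * \<Phi> x c - M * \<Phi> y c\<bar> \<le> 1" by linarith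
      then have "M * \<bar>\<Phi> x c - \<Phi> y c\<bar> \<le> 1"
        by (metis abs_mult abs_of_nat right_diff_distrib)
      then show ?thesis using M(3) by (simp add: field_simps)
    qed
    then have "(\<Sum>c\<in>J. \<bar>\<Phi> x c - \<Phi> y c\<bar>) \<le> (\<Sum>c\<in>J. 1 / M)" by (intro sum_mono)
    then have "C * (\<Sum>c\<in>J. \<bar>\<Phi> x c - \<Phi> y c\<bar>) \<le> C * (k * (1 / M))" using C by (intro mult_left_mono) (auto simp: k_def)
    then show "d x y \<le> r i" using lip[OF i(2,3)] i(1) by (simp add: r_def \<rho>_def)
  qed
  have 3: "(\<Sum>i. ennreal (r i powr s)) \<le> ennreal \<epsilon>"
  proof -
    have "(\<Sum>i. ennreal (r i powr s)) = (\<Sum>i\<in>{..<card T}. ennreal (r i powr s))"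
      by (rule suminf_finite) (auto simp: r_def)
    also have "\<dots> = ennreal (\<Sum>i\<in>{..<card T}. r i powr s)" by simp
    also have "(\<Sum>i\<in>{..<card T}. r i powr s) = card T * \<rho> powr s" by (simp add: r_def)
    finally have sum: "(\<Sum>i. ennreal (r i powr s)) = ennreal (card T * \<rho> powr s)" .
    have "card T * \<rho> powr s \<le> (M * (2 * R + 5)) ^ k * \<rho> powr s" using cardT by (intro mult_right_mono) auto
    also have "\<dots> = A * real M powr (real k - s)"
    proof -
      have "\<rho> powr s = (C * k) powr s / real M powr s" using C M(3) by (simp add: \<rho>_def powr_divide)
      moreover have "(M * (2 * R + 5)) ^ k = real M powr k * (2 * R + 5) ^ k"
        using M(3) by (simp add: power_mult_distrib powr_realpow)
      ultimately show ?thesis by (simp add: A_def powr_diff)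
    qed
    finally have "card T * \<rho> powr s \<le> \<epsilon>" using M(1) by linarith
    then show ?thesis unfolding sum by (rule ennreal_leI)
  qed
  have "small_cover d s \<delta> \<epsilon> B U r"
    unfolding small_cover_def by (rule conjI[OF 1 conjI[OF allI[OF 2] 3]])
  then show "\<exists>U r. small_cover d s \<delta> \<epsilon> B U r" by blast
qed

section \<open>The metric on a linear system\<close>

definition unit_cone :: "(vec3 \<times> vec3) set" where
  "unit_cone = {(v, w). norm v = 1 \<and> norm w = 1 \<and> pairing v w = 0}"

definition bounded_section :: "(vec3 \<times> vec3 \<Rightarrow> complex) \<Rightarrow> bool" where
  "bounded_section s \<longleftrightarrow> (\<exists>K. \<forall>x\<in>unit_cone. cmod (s x) \<le> K)"

lemma section_norm_eq: "section_norm s = (SUP x\<in>unit_cone. cmod (s x))"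
  by (simp add: section_norm_def unit_cone_def case_prod_unfold)

lemma unit_cone_nonempty: "unit_cone \<noteq> {}"
proof -
  have "(axis 1 1, axis 2 1) \<in> unit_cone" by (simp add: unit_cone_def pairing_expand norm_vec_def L2_set_def sum_3 axis_def)
  then show ?thesis by blast
qed

lemma section_norm_upper: "bounded_section s \<Longrightarrow> x \<in> unit_cone \<Longrightarrow> cmod (s x) \<le> section_norm s"
  unfolding section_norm_eq bounded_section_def by (rule cSUP_upper) (auto simp: bdd_above_def)

lemma section_norm_least: "(\<And>x. x \<in> unit_cone \<Longrightarrow> cmod (s x) \<le> K) \<Longrightarrow> section_norm s \<le> K"
  unfolding section_norm_eq by (rule cSUP_least[OF unit_cone_nonempty])

lemma section_norm_nonneg: "bounded_section s \<Longrightarrow> 0 \<le> section_norm s"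
  using section_norm_upper unit_cone_nonempty by (metis ex_in_conv norm_ge_zero order_trans)

lemma bounded_section_add: "bounded_section s \<Longrightarrow> bounded_section t \<Longrightarrow> bounded_section (s + t)"
  unfolding bounded_section_def by (metis add_mono norm_triangle_le plus_fun_apply)

lemma bounded_section_scale: "bounded_section s \<Longrightarrow> bounded_section (cfun_scale c s)"
  unfolding bounded_section_def cfun_scale_def by (metis mult_left_mono norm_ge_zero norm_mult)

lemma bounded_section_diff: "bounded_section s \<Longrightarrow> bounded_section t \<Longrightarrow> bounded_section (s - t)"
  using bounded_section_add[OF _ bounded_section_scale[of t "-1"], of s] by (simp add: cfun_scale_def fun_diff_def plus_fun_def)

lemma section_norm_add:
  "bounded_section s \<Longrightarrow> bounded_section t \<Longrightarrow> section_norm (s + t) \<le> section_norm s + section_norm t"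
  by (intro section_norm_least)
    (auto intro!: order_trans[OF norm_triangle_ineq] add_mono section_norm_upper)

lemma section_norm_scale_le: "bounded_section s \<Longrightarrow> section_norm (cfun_scale c s) \<le> cmod c * section_norm s"
  by (intro section_norm_least) (auto simp: cfun_scale_def norm_mult intro!: mult_left_mono section_norm_upper)

lemma section_norm_scale:
  assumes "bounded_section s"
  shows "section_norm (cfun_scale c s) = cmod c * section_norm s"
proof (cases "c = 0")
  case True
  have "section_norm (cfun_scale c s) = (SUP x\<in>unit_cone. 0::real)" by (simp add: section_norm_eq True cfun_scale_def)
  then show ?thesis using unit_cone_nonempty True by simp
next
  case False
  have "section_norm s = section_norm (cfun_scale (1/c) (cfun_scale c s))" using False by (simp add: cfun_scale_def)
  also have "\<dots> \<le> cmod (1/c) * section_norm (cfun_scale c s)"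
    by (rule section_norm_scale_le[OF bounded_section_scale[OF assms]])
  finally have "cmod c * section_norm s \<le> section_norm (cfun_scale c s)" using False by (simp add: norm_divide field_simps)
  then show ?thesis using section_norm_scale_le[OF assms, of c] by simp
qed

lemma section_norm_sum:
  assumes "finite B" "\<And>b. b \<in> B \<Longrightarrow> bounded_section b"
  shows "bounded_section (\<Sum>b\<in>B. cfun_scale (c b) b) \<and>
    section_norm (\<Sum>b\<in>B. cfun_scale (c b) b) \<le> (\<Sum>b\<in>B. cmod (c b) * section_norm b)"
  using assms
proof (induction B rule: finite_induct)
  case empty
  have "section_norm (0 :: vec3 \<times> vec3 \<Rightarrow> complex) \<le> 0" by (rule section_norm_least) simp
  moreover have "bounded_section 0" by (auto simp: bounded_section_def)
  ultimately show ?case unfolding sum.empty by blast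
next
  case (insert b B)
  then have b: "bounded_section (cfun_scale (c b) b)" "section_norm (cfun_scale (c b) b) \<le> cmod (c b) * section_norm b"
    using bounded_section_scale section_norm_scale_le by auto
  have IH: "bounded_section (\<Sum>b\<in>B. cfun_scale (c b) b)"
    "section_norm (\<Sum>b\<in>B. cfun_scale (c b) b) \<le> (\<Sum>b\<in>B. cmod (c b) * section_norm b)"
    using insert by auto
  show ?case
    unfolding sum.insert[OF insert.hyps(1,2)]
    using bounded_section_add[OF b(1) IH(1)] section_norm_add[OF b(1) IH(1)] b(2) IH(2) by linarith
qed

lemma scale_mem_divisor_of: "c \<noteq> 0 \<Longrightarrow> cfun_scale c s \<in> divisor_of s"
  unfolding proj_point_def by blast

lemma divisor_of_scale: "c \<noteq> 0 \<Longrightarrow> divisor_of (cfun_scale c s) = divisor_of s"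
proof -
  assume c: "c \<noteq> 0"
  have "\<exists>c'. u = cfun_scale c' s \<and> c' \<noteq> 0" if "u = cfun_scale c'' (cfun_scale c s)" "c'' \<noteq> 0" for u c''
    using that c by (intro exI[of _ "c'' * c"]) (auto simp: cfun_scale_def)
  moreover have "\<exists>c'. u = cfun_scale c' (cfun_scale c s) \<and> c' \<noteq> 0" if "u = cfun_scale c'' s" "c'' \<noteq> 0" for u c''
    using that c by (intro exI[of _ "c'' / c"]) (auto simp: cfun_scale_def)
  ultimately show ?thesis unfolding proj_point_def by blast
qed

text \<open>The distance is at most that of the normalized equations, which is controlled by the
  difference of the equations as long as these are bounded away from zero.\<close>

lemma divisor_dist_le:
  assumes s: "bounded_section s" "section_norm s > 0" and t: "bounded_section t" "section_norm t > 0"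
  shows "divisor_dist (divisor_of s) (divisor_of t) \<le> 2 * section_norm (s - t) / section_norm s"
proof -
  define D where "D = {section_norm (s' - t') | s' t'. s' \<in> divisor_of s \<and> t' \<in> divisor_of t \<and> section_norm s' = 1 \<and> section_norm t' = 1}"
  define a where "a = section_norm s"
  define b where "b = section_norm t"
  define s1 where "s1 = cfun_scale (of_real (1/a)) s"
  define t1 where "t1 = cfun_scale (of_real (1/b)) t"
  have ab: "a > 0" "b > 0" using s t by (auto simp: a_def b_def)
  have n1: "section_norm s1 = 1"
    unfolding s1_def section_norm_scale[OF s(1)] norm_of_real a_def[symmetric] using ab by simp
  have n2: "section_norm t1 = 1"
    unfolding t1_def section_norm_scale[OF t(1)] norm_of_real b_def[symmetric] using ab by simp
  have m: "s1 \<in> divisor_of s" "t1 \<in> divisor_of t"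
    unfolding s1_def t1_def using ab by (simp_all add: scale_mem_divisor_of del: of_real_divide)
  have "section_norm (s1 - t1) \<in> D"
    unfolding D_def mem_Collect_eq by (intro exI[of _ s1] exI[of _ t1] conjI refl m n1 n2)
  moreover have "bdd_below D"
  proof (rule bdd_belowI)
    fix x assume "x \<in> D"
    then obtain s' t' where x: "x = section_norm (s' - t')" "s' \<in> divisor_of s" "t' \<in> divisor_of t"
      unfolding D_def by blast
    then obtain c c' where "s' = cfun_scale c s" "t' = cfun_scale c' t" unfolding proj_point_def by blast
    then show "0 \<le> x" unfolding x(1) using s t
      by (intro section_norm_nonneg bounded_section_diff) (simp_all add: bounded_section_scale)
  qed
  ultimately have "Inf D \<le> section_norm (s1 - t1)" by (rule cInf_lower)
  then have 1: "divisor_dist (divisor_of s) (divisor_of t) \<le> section_norm (s1 - t1)"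
    by (simp add: divisor_dist_def D_def)
  have bst: "bounded_section (s - t)" using s t by (intro bounded_section_diff)
  have eq: "s1 - t1 = cfun_scale (of_real (1/a)) (s - t) + cfun_scale (of_real (1/a - 1/b)) t"
    by (auto simp: s1_def t1_def cfun_scale_def fun_eq_iff algebra_simps)
  have "section_norm (s1 - t1) \<le> section_norm (cfun_scale (of_real (1/a)) (s - t)) + section_norm (cfun_scale (of_real (1/a - 1/b)) t)"
    unfolding eq by (rule section_norm_add[OF bounded_section_scale[OF bst] bounded_section_scale[OF t(1)]])
  moreover have "section_norm (cfun_scale (of_real (1/a)) (s - t)) = section_norm (s - t) / a"
    unfolding section_norm_scale[OF bst] norm_of_real using ab by simp
  moreover have "section_norm (cfun_scale (of_real (1/a - 1/b)) t) = \<bar>b - a\<bar> / a"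
  proof -
    have "1/a - 1/b = (b - a) / (a * b)" using ab by (simp add: field_simps)
    then show ?thesis unfolding section_norm_scale[OF t(1)] norm_of_real using ab by (simp add: b_def[symmetric] abs_mult)
  qed
  moreover have "\<bar>b - a\<bar> \<le> section_norm (s - t)"
  proof -
    have "s = (s - t) + t" "t = cfun_scale (-1) (s - t) + s" by (auto simp: cfun_scale_def)
    then have "a \<le> section_norm (s - t) + b" "b \<le> section_norm (cfun_scale (-1) (s - t)) + a"
      unfolding a_def b_def using section_norm_add s t bst bounded_section_scale by metis+
    moreover have "section_norm (cfun_scale (-1) (s - t)) = section_norm (s - t)" using section_norm_scale[OF bst, of "-1"] by simp
    ultimately show ?thesis by linarith
  qed
  then have "\<bar>b - a\<bar> / a \<le> section_norm (s - t) / a" using ab by (simp add: divide_right_mono)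
  ultimately have "section_norm (s1 - t1) \<le> 2 * section_norm (s - t) / a" by linarith
  then show ?thesis using 1 unfolding a_def by linarith
qed

lemma bounded_section_sec:
  assumes "f \<in> bihom a b"
  shows "bounded_section (sec f)"
proof -
  define X :: "(vec3 \<times> vec3 \<Rightarrow> complex) set" where
    "X = range (\<lambda>i x. fst x $ i) \<union> range (\<lambda>i x. snd x $ i)"
  have "polyvec X fst" "polyvec X snd" by (auto simp: polyvec_def X_def intro: polyalg.gen)
  then have "(\<lambda>x. f (fst x, snd x)) \<in> polyalg X" using bihom_polyalg[OF assms] by blast
  moreover have "continuous_on (sphere 0 1 \<times> sphere 0 1) x" if "x \<in> X" for x
    using that by (auto simp: X_def intro!: continuous_intros)
  ultimately have "continuous_on (sphere 0 1 \<times> sphere 0 1) f" using polyalg_continuous by fastforce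
  then have "compact (f ` (sphere 0 1 \<times> sphere 0 1))"
    by (intro compact_continuous_image compact_Times) auto
  then have "bounded (f ` (sphere 0 1 \<times> sphere 0 1))" by (rule compact_imp_bounded)
  then obtain K where "\<forall>y\<in>f ` (sphere 0 1 \<times> sphere 0 1). cmod y \<le> K" unfolding bounded_iff by blast
  then have K: "cmod (f x) \<le> K" if "x \<in> sphere 0 1 \<times> sphere 0 1" for x using that by blast
  have "cmod (sec f x) \<le> K" if "x \<in> unit_cone" for x
    using that K[of x] by (auto simp: unit_cone_def sec_def)
  then show ?thesis unfolding bounded_section_def by blast
qed

section \<open>Families of linear conditions on divisors\<close>

text \<open>A matrix whose entries differ from those of the identity by at most \<open>1 / (2 n)\<close> is
  invertible, with the explicit bound 2 for the inverse.\<close>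

lemma near_identity_bound:
  fixes x :: "'k \<Rightarrow> complex"
  assumes "finite P"
    and near: "\<And>i j. i \<in> P \<Longrightarrow> j \<in> P \<Longrightarrow> cmod (m i j - (if i = j then 1 else 0)) \<le> 1 / (2 * real (card P))"
  shows "(\<Sum>i\<in>P. cmod (x i)) \<le> 2 * (\<Sum>i\<in>P. cmod (\<Sum>j\<in>P. m i j * x j))"
proof (cases "P = {}")
  case False
  then have n: "real (card P) > 0" using assms(1) by (simp add: card_gt_0_iff)
  define T where "T = (\<Sum>i\<in>P. cmod (x i))"
  have "cmod (x i) \<le> cmod (\<Sum>j\<in>P. m i j * x j) + T / (2 * real (card P))" if i: "i \<in> P" for i
  proof -
    have "(\<Sum>j\<in>P. m i j * x j) = x i + (\<Sum>j\<in>P. (m i j - (if i = j then 1 else 0)) * x j)"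
    proof -
      have "(\<Sum>j\<in>P. m i j * x j) = (\<Sum>j\<in>P. (if i = j then x j else 0) + (m i j - (if i = j then 1 else 0)) * x j)"
        by (intro sum.cong) (auto simp: algebra_simps)
      then show ?thesis using i assms(1) by (simp add: sum.distrib)
    qed
    then have "x i = (\<Sum>j\<in>P. m i j * x j) - (\<Sum>j\<in>P. (m i j - (if i = j then 1 else 0)) * x j)"
      by (rule eq_diff_eq[THEN iffD2, OF sym])
    from arg_cong[where f = cmod, OF this]
    have "cmod (x i) \<le> cmod (\<Sum>j\<in>P. m i j * x j) + cmod (\<Sum>j\<in>P. (m i j - (if i = j then 1 else 0)) * x j)"
      by (rule ord_eq_le_trans[OF _ norm_triangle_ineq4])
    moreover have "cmod (\<Sum>j\<in>P. (m i j - (if i = j then 1 else 0)) * x j) \<le> (\<Sum>j\<in>P. 1 / (2 * real (card P)) * cmod (x j))"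
    proof (intro order_trans[OF norm_sum] sum_mono)
      fix j assume "j \<in> P"
      then show "cmod ((m i j - (if i = j then 1 else 0)) * x j) \<le> 1 / (2 * real (card P)) * cmod (x j)"
        unfolding norm_mult by (intro mult_right_mono near i) auto
    qed
    ultimately show ?thesis by (simp add: T_def sum_divide_distrib)
  qed
  then have "T \<le> (\<Sum>i\<in>P. cmod (\<Sum>j\<in>P. m i j * x j) + T / (2 * real (card P)))"
    unfolding T_def[of] by (intro sum_mono)
  also have "\<dots> = (\<Sum>i\<in>P. cmod (\<Sum>j\<in>P. m i j * x j)) + T / 2" using n by (simp add: sum.distrib)
  finally show ?thesis by (simp add: T_def)
qed simp

lemma functional_sum:
  fixes V :: "('a \<Rightarrow> complex) set" and \<phi> :: "('a \<Rightarrow> complex) \<Rightarrow> complex"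
  assumes V: "cfun.subspace V"
    and add: "\<And>s t. s \<in> V \<Longrightarrow> t \<in> V \<Longrightarrow> \<phi> (s + t) = \<phi> s + \<phi> t"
    and scale: "\<And>s c. s \<in> V \<Longrightarrow> \<phi> (cfun_scale c s) = c * \<phi> s"
    and B: "finite B" "\<And>b. b \<in> B \<Longrightarrow> h b \<in> V"
  shows "\<phi> (\<Sum>b\<in>B. cfun_scale (g b) (h b)) = (\<Sum>b\<in>B. g b * \<phi> (h b))"
proof -
  have V0: "0 \<in> V" using V by (rule cfun.subspace_0)
  have "(\<Sum>b\<in>B. cfun_scale (g b) (h b)) \<in> V \<and> \<phi> (\<Sum>b\<in>B. cfun_scale (g b) (h b)) = (\<Sum>b\<in>B. g b * \<phi> (h b))"
    using B
  proof (induction B rule: finite_induct)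
    case empty
    have "\<phi> (cfun_scale 0 0) = 0" using scale[OF V0, of 0] by simp
    then have "\<phi> 0 = 0" unfolding cfun.scale_zero_left .
    then show ?case unfolding sum.empty by (rule conjI[OF V0])
  next
    case (insert b B)
    have IH: "(\<Sum>b\<in>B. cfun_scale (g b) (h b)) \<in> V"
      "\<phi> (\<Sum>b\<in>B. cfun_scale (g b) (h b)) = (\<Sum>b\<in>B. g b * \<phi> (h b))" using insert by auto
    have b: "cfun_scale (g b) (h b) \<in> V" using insert V by (simp add: cfun.subspace_scale)
    have eq: "\<phi> (cfun_scale (g b) (h b) + (\<Sum>b\<in>B. cfun_scale (g b) (h b))) = g b * \<phi> (h b) + (\<Sum>b\<in>B. g b * \<phi> (h b))"
      unfolding add[OF b IH(1)] IH(2) using scale insert.prems by simp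
    show ?case
      unfolding sum.insert[OF insert.hyps(1,2)] by (rule conjI[OF cfun.subspace_add[OF V b IH(1)] eq])
  qed
  then show ?thesis by blast
qed

text \<open>The family of linear conditions \<open>\<psi> y i\<close> depends on \<open>card J\<close> real parameters, the \<open>\<eta> c y\<close>.
  For each \<open>y\<close> the conditions are independent, so they cut out a subspace of complex codimension
  \<open>card P\<close>. The union of the corresponding linear systems then has the expected dimension at most:
  the coordinates with respect to \<open>v\<close> are functions of \<open>y\<close> and of the other coordinates, one of
  which can be normalized to 1.\<close>

lemma null_family:
  fixes \<psi> :: "'y \<Rightarrow> 'k \<Rightarrow> (vec3 \<times> vec3 \<Rightarrow> complex) \<Rightarrow> complex" and \<eta> :: "'c \<Rightarrow> 'y \<Rightarrow> real"
  assumes V: "cfun.subspace V" "V \<subseteq> cfun.span T" "finite T"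
    and bdd: "\<And>s. s \<in> V \<Longrightarrow> bounded_section s"
    and pos: "\<And>s. s \<in> V \<Longrightarrow> s \<noteq> 0 \<Longrightarrow> section_norm s > 0"
    and P: "finite P" "\<And>j. j \<in> P \<Longrightarrow> v j \<in> V"
    and lin: "\<And>y i s t. y \<in> U \<Longrightarrow> i \<in> P \<Longrightarrow> s \<in> V \<Longrightarrow> t \<in> V \<Longrightarrow> \<psi> y i (s + t) = \<psi> y i s + \<psi> y i t"
      "\<And>y i s c. y \<in> U \<Longrightarrow> i \<in> P \<Longrightarrow> s \<in> V \<Longrightarrow> \<psi> y i (cfun_scale c s) = c * \<psi> y i s"
    and near: "\<And>y i j. y \<in> U \<Longrightarrow> i \<in> P \<Longrightarrow> j \<in> P \<Longrightarrow>
      cmod (\<psi> y i (v j) - (if i = j then 1 else 0)) \<le> 1 / (2 * real (card P))"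
    and lip: "\<And>i s. i \<in> P \<Longrightarrow> s \<in> V \<Longrightarrow> \<exists>C. \<forall>y\<in>U. cmod (\<psi> y i s) \<le> C \<and>
      (\<forall>y'\<in>U. cmod (\<psi> y i s - \<psi> y' i s) \<le> C * (\<Sum>c\<in>J. \<bar>\<eta> c y - \<eta> c y'\<bar>))"
    and J: "finite J" "\<And>y c. y \<in> U \<Longrightarrow> c \<in> J \<Longrightarrow> \<bar>\<eta> c y\<bar> \<le> R"
    and \<sigma>: "real (card J) + 2 * (real (cfun.dim V) - 1 - real (card P)) < \<sigma>"
  shows "hausdorff_measure divisor_dist \<sigma>
    {divisor_of s | s. s \<in> V \<and> s \<noteq> 0 \<and> (\<exists>y\<in>U. \<forall>i\<in>P. \<psi> y i s = 0)} = 0"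
proof (cases "U = {}")
  case True
  then show ?thesis by (simp add: hausdorff_null_empty)
next
  case False
  then obtain y0 where y0: "y0 \<in> U" by blast
  have V0: "0 \<in> V" using V(1) by (rule cfun.subspace_0)
  have v_indep: "x j = 0" if "(\<Sum>j\<in>P. cfun_scale (x j) (v j)) = 0" "j \<in> P" for x j
  proof -
    have "(\<Sum>j\<in>P. \<psi> y0 i (v j) * x j) = 0" if i: "i \<in> P" for i
    proof -
      have "\<psi> y0 i (cfun_scale 0 0) = 0" using lin(2)[OF y0 i V0, of 0] by simp
      then have "\<psi> y0 i 0 = 0" unfolding cfun.scale_zero_left .
      moreover have "\<psi> y0 i (\<Sum>j\<in>P. cfun_scale (x j) (v j)) = (\<Sum>j\<in>P. x j * \<psi> y0 i (v j))"
        by (rule functional_sum[OF V(1) lin(1)[OF y0 i] lin(2)[OF y0 i] P])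
      ultimately show ?thesis unfolding \<open>(\<Sum>j\<in>P. cfun_scale (x j) (v j)) = 0\<close> by (simp add: mult.commute)
    qed
    then have "(\<Sum>i\<in>P. cmod (x i)) \<le> 0"
      using near_identity_bound[of P "\<lambda>i j. \<psi> y0 i (v j)" x, OF P(1) near[OF y0]] by simp
    then have "(\<Sum>i\<in>P. cmod (x i)) = 0" using sum_nonneg[of P "\<lambda>i. cmod (x i)"] by simp
    then show ?thesis using that(2) P(1) by (simp add: sum_nonneg_eq_0_iff)
  qed
  have inj: "inj_on v P"
  proof (rule inj_onI, rule ccontr)
    fix i j assume ij: "i \<in> P" "j \<in> P" "v i = v j" "i \<noteq> j"
    define x where "x k = (if k = i then 1 else if k = j then -1 else (0::complex))" for k
    have "(\<Sum>k\<in>P. cfun_scale (x k) (v k)) = (\<Sum>k\<in>{i, j}. cfun_scale (x k) (v k))"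
      using ij P(1) by (intro sum.mono_neutral_right) (auto simp: x_def cfun_scale_def)
    also have "\<dots> = cfun_scale 1 (v j) + cfun_scale (-1) (v j)" using ij by (simp add: x_def)
    also have "\<dots> = 0" by (simp add: cfun_scale_def fun_eq_iff)
    finally have "x i = 0" using v_indep ij(1) by blast
    then show False by (simp add: x_def)
  qed
  have "cfun.independent (v ` P)"
  proof (rule cfun.independent_if_scalars_zero)
    show "finite (v ` P)" using P(1) by blast
    fix g x assume g: "(\<Sum>x\<in>v ` P. cfun_scale (g x) x) = 0" and x: "x \<in> v ` P"
    then have "(\<Sum>j\<in>P. cfun_scale (g (v j)) (v j)) = 0" by (simp add: sum.reindex[OF inj])
    then show "g x = 0" using v_indep[of "\<lambda>j. g (v j)"] x by blast
  qed
  moreover have "v ` P \<subseteq> V" using P(2) by blast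
  ultimately obtain Bs where Bs: "v ` P \<subseteq> Bs" "Bs \<subseteq> V" "cfun.independent Bs" "V \<subseteq> cfun.span Bs"
    using cfun.maximal_independent_subset_extend by metis
  have finBs: "finite Bs"
    using cfun.independent_span_bound[OF V(3) Bs(3)] Bs(2) V(2) by blast
  have cardBs: "card Bs = cfun.dim V" using cfun.basis_card_eq_dim[OF Bs(2,4,3)] .
  define Rest where "Rest = Bs - v ` P"
  have finR: "finite Rest" using finBs by (simp add: Rest_def)
  have cardR: "real (card Rest) = real (cfun.dim V) - real (card P)"
  proof -
    have "card (v ` P) = card P" by (rule card_image[OF inj])
    moreover have "card (v ` P) \<le> card Bs" using Bs(1) finBs by (rule card_mono[rotated])
    ultimately show ?thesis using Bs(1) P(1) cardBs by (simp add: Rest_def card_Diff_subset of_nat_diff)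
  qed
  define x where "x = cfun.representation Bs"
  have x: "s = (\<Sum>b\<in>Bs. cfun_scale (x s b) b)" if "s \<in> V" for s
    using cfun.sum_representation_eq[OF Bs(3) _ finBs order_refl, of s] that Bs(4) by (auto simp: x_def)
  have x_diff: "x (s - t) b = x s b - x t b" if "s \<in> V" "t \<in> V" for s t b
    unfolding x_def using fun_cong[OF cfun.representation_diff[OF Bs(3) subsetD[OF Bs(4) that(2)] subsetD[OF Bs(4) that(1)]]] .
  have x_scale: "x (cfun_scale c s) b = c * x s b" if "s \<in> V" for s c b
    unfolding x_def using fun_cong[OF cfun.representation_scale[OF Bs(3) subsetD[OF Bs(4) that]]] .
  have split: "(\<Sum>b\<in>Bs. g b) = (\<Sum>j\<in>P. g (v j)) + (\<Sum>b\<in>Rest. g b)" for g :: "_ \<Rightarrow> 'z::comm_monoid_add"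
    using Bs(1) finBs sum.subset_diff[OF Bs(1) finBs, of g] by (simp add: Rest_def sum.reindex[OF inj] add.commute)
  have \<psi>_x: "\<psi> y i s = (\<Sum>b\<in>Bs. x s b * \<psi> y i b)" if "s \<in> V" "y \<in> U" "i \<in> P" for s y i
  proof -
    have "\<psi> y i (\<Sum>b\<in>Bs. cfun_scale (x s b) b) = (\<Sum>b\<in>Bs. x s b * \<psi> y i b)"
      by (rule functional_sum[OF V(1) lin(1)[OF that(2,3)] lin(2)[OF that(2,3)] finBs subsetD[OF Bs(2)]])
    then show ?thesis using x[OF that(1)] by simp
  qed
  obtain C where C: "\<And>i b. i \<in> P \<Longrightarrow> b \<in> V \<Longrightarrow> \<forall>y\<in>U. cmod (\<psi> y i b) \<le> C i b \<and>
      (\<forall>y'\<in>U. cmod (\<psi> y i b - \<psi> y' i b) \<le> C i b * (\<Sum>c\<in>J. \<bar>\<eta> c y - \<eta> c y'\<bar>))"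
  proof -
    define C where "C i b = (SOME C. \<forall>y\<in>U. cmod (\<psi> y i b) \<le> C \<and>
      (\<forall>y'\<in>U. cmod (\<psi> y i b - \<psi> y' i b) \<le> C * (\<Sum>c\<in>J. \<bar>\<eta> c y - \<eta> c y'\<bar>)))" for i b
    have "\<forall>y\<in>U. cmod (\<psi> y i b) \<le> C i b \<and>
      (\<forall>y'\<in>U. cmod (\<psi> y i b - \<psi> y' i b) \<le> C i b * (\<Sum>c\<in>J. \<bar>\<eta> c y - \<eta> c y'\<bar>))" if "i \<in> P" "b \<in> V" for i b
      unfolding C_def using lip[OF that] by (rule someI_ex)
    then show ?thesis using that by blast
  qed
  define K where "K = (\<Sum>i\<in>P. \<Sum>b\<in>Bs. \<bar>C i b\<bar>)"
  have K0: "K \<ge> 0" by (auto simp: K_def intro!: sum_nonneg)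
  have CK: "C i b \<le> K" if "i \<in> P" "b \<in> Bs" for i b
  proof -
    have "\<bar>C i b\<bar> \<le> (\<Sum>b\<in>Bs. \<bar>C i b\<bar>)" using that finBs by (intro member_le_sum) auto
    also have "\<dots> \<le> K" unfolding K_def using that P(1)
      by (intro member_le_sum[of i P "\<lambda>i. \<Sum>b\<in>Bs. \<bar>C i b\<bar>"]) (auto intro: sum_nonneg)
    finally show ?thesis by linarith
  qed
  have K: "cmod (\<psi> y i b) \<le> K" if "i \<in> P" "b \<in> Bs" "y \<in> U" for i b y
    using C[of i b] CK[of i b] that Bs(2) by force
  have K_lip: "cmod (\<psi> y i b - \<psi> y' i b) \<le> K * (\<Sum>c\<in>J. \<bar>\<eta> c y - \<eta> c y'\<bar>)"
    if "i \<in> P" "b \<in> Bs" "y \<in> U" "y' \<in> U" for i b y y'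
  proof -
    have "cmod (\<psi> y i b - \<psi> y' i b) \<le> C i b * (\<Sum>c\<in>J. \<bar>\<eta> c y - \<eta> c y'\<bar>)" using C[of i b] that Bs(2) by blast
    also have "\<dots> \<le> K * (\<Sum>c\<in>J. \<bar>\<eta> c y - \<eta> c y'\<bar>)"
      using CK that by (intro mult_right_mono) (auto intro: sum_nonneg)
    finally show ?thesis .
  qed
  \<comment> \<open>The coordinates along \<open>v\<close> are controlled by the values of the conditions and by the other
    coordinates.\<close>
  have pivots: "(\<Sum>j\<in>P. cmod (x s (v j))) \<le> 2 * (\<Sum>i\<in>P. cmod (\<psi> y i s)) + 2 * card P * K * (\<Sum>b\<in>Rest. cmod (x s b))"
    if s: "s \<in> V" and y: "y \<in> U" for s y
  proof -
    have "cmod (\<Sum>j\<in>P. \<psi> y i (v j) * x s (v j)) \<le> cmod (\<psi> y i s) + K * (\<Sum>b\<in>Rest. cmod (x s b))" if i: "i \<in> P" for i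
    proof -
      have "(\<Sum>j\<in>P. \<psi> y i (v j) * x s (v j)) = \<psi> y i s - (\<Sum>b\<in>Rest. \<psi> y i b * x s b)"
        unfolding \<psi>_x[OF s y i] split by (simp add: mult.commute)
      also have "cmod \<dots> \<le> cmod (\<psi> y i s) + cmod (\<Sum>b\<in>Rest. \<psi> y i b * x s b)" by (rule norm_triangle_ineq4)
      also have "cmod (\<Sum>b\<in>Rest. \<psi> y i b * x s b) \<le> (\<Sum>b\<in>Rest. K * cmod (x s b))"
        using K[OF i _ y] by (intro order_trans[OF norm_sum] sum_mono) (auto simp: norm_mult Rest_def intro!: mult_right_mono)
      finally show ?thesis by (simp add: sum_distrib_left)
    qed
    then have "(\<Sum>i\<in>P. cmod (\<Sum>j\<in>P. \<psi> y i (v j) * x s (v j))) \<le> (\<Sum>i\<in>P. cmod (\<psi> y i s) + K * (\<Sum>b\<in>Rest. cmod (x s b)))"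
      by (intro sum_mono)
    also have "\<dots> = (\<Sum>i\<in>P. cmod (\<psi> y i s)) + card P * K * (\<Sum>b\<in>Rest. cmod (x s b))"
      by (simp add: sum.distrib)
    finally have "2 * (\<Sum>i\<in>P. cmod (\<Sum>j\<in>P. \<psi> y i (v j) * x s (v j))) \<le>
      2 * (\<Sum>i\<in>P. cmod (\<psi> y i s)) + 2 * card P * K * (\<Sum>b\<in>Rest. cmod (x s b))" by (simp add: algebra_simps)
    then show ?thesis
      using near_identity_bound[of P "\<lambda>i j. \<psi> y i (v j)" "\<lambda>j. x s (v j)", OF P(1) near[OF y]] by linarith
  qed
  \<comment> \<open>Every divisor has an equation whose largest coordinate off \<open>v\<close> is 1. The bound \<open>m\<close> on its norm from
    below makes the passage from equations to divisors Lipschitz.\<close>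
  define piece where "piece b0 m = {s. s \<in> V \<and> (\<exists>y\<in>U. \<forall>i\<in>P. \<psi> y i s = 0) \<and> x s b0 = 1 \<and>
    (\<forall>b\<in>Rest. cmod (x s b) \<le> 1) \<and> 1 / real (Suc m) \<le> section_norm s}" for b0 m
  have piece_null: "hausdorff_measure divisor_dist \<sigma> (divisor_of ` piece b0 m) = 0" if b0: "b0 \<in> Rest" for b0 m
  proof -
    have "\<exists>s y. s \<in> piece b0 m \<and> S = divisor_of s \<and> y \<in> U \<and> (\<forall>i\<in>P. \<psi> y i s = 0)" if "S \<in> divisor_of ` piece b0 m" for S
      using that unfolding piece_def by blast
    then have "\<exists>z. S \<in> divisor_of ` piece b0 m \<longrightarrow> fst z \<in> piece b0 m \<and> S = divisor_of (fst z) \<and> snd z \<in> U \<and>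
        (\<forall>i\<in>P. \<psi> (snd z) i (fst z) = 0)" for S
      by (metis fst_conv snd_conv)
    from choice[OF allI[OF this]] obtain z where z_all:
      "\<forall>S. S \<in> divisor_of ` piece b0 m \<longrightarrow> fst (z S) \<in> piece b0 m \<and> S = divisor_of (fst (z S)) \<and> snd (z S) \<in> U \<and>
        (\<forall>i\<in>P. \<psi> (snd (z S)) i (fst (z S)) = 0)" by (rule exE)
    note z = z_all[rule_format]
    \<comment> \<open>The real coordinates are the parameters and the real and imaginary parts of the coordinates off
      \<open>v\<close>, except for the coordinate along \<open>b0\<close>, which is 1.\<close>
    define J' :: "('c + _ \<times> bool) set" where "J' = J <+> ((Rest - {b0}) \<times> UNIV)"
    define \<Phi> where "\<Phi> S k = (case k of Inl c \<Rightarrow> \<eta> c (snd (z S)) | Inr (b, t) \<Rightarrow>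
      if t then Re (x (fst (z S)) b) else Im (x (fst (z S)) b))" for S k
    define X where "X = real (card Rest) + 2 * card P * K * card Rest"
    define N where "N = (\<Sum>b\<in>Bs. section_norm b)"
    define D where "D = 2 * card P * K * (X + 1) + 1"
    have N0: "N \<ge> 0" unfolding N_def using bdd Bs(2) by (intro sum_nonneg section_norm_nonneg) blast
    have X0: "X \<ge> 0" using K0 by (simp add: X_def)
    have D0: "D \<ge> 0" using K0 X0 by (simp add: D_def)
    show ?thesis
    proof (rule hausdorff_null_by_coordinates[where J = J' and \<Phi> = \<Phi> and R = "max \<bar>R\<bar> 1" and C = "2 * real (Suc m) * N * D"])
      show "finite J'" using J(1) finR by (auto simp: J'_def)
      have "card J' = card J + 2 * (card Rest - 1)"
        using J(1) finR b0 by (simp add: J'_def card_Plus card_cartesian_product card_Diff_singleton)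
      moreover have "card Rest \<ge> 1" using b0 finR by (metis One_nat_def Suc_leI card_gt_0_iff empty_iff)
      ultimately show "real (card J') < \<sigma>" using \<sigma> cardR by (simp add: of_nat_diff)
      show "0 \<le> max \<bar>R\<bar> 1" by simp
      show "0 \<le> 2 * real (Suc m) * N * D" using N0 D0 by simp
      fix S assume S: "S \<in> divisor_of ` piece b0 m"
      show "\<bar>\<Phi> S k\<bar> \<le> max \<bar>R\<bar> 1" if k: "k \<in> J'" for k
      proof (cases k)
        case (Inl c)
        then have "c \<in> J" using k by (auto simp: J'_def)
        then have "\<bar>\<eta> c (snd (z S))\<bar> \<le> R" using J(2) z[OF S] by blast
        then show ?thesis using Inl by (simp add: \<Phi>_def)
      next
        case (Inr p)
        obtain b t where p: "p = (b, t)" by (cases p)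
        then have "b \<in> Rest" using k Inr by (auto simp: J'_def)
        then have "cmod (x (fst (z S)) b) \<le> 1" using z[OF S] by (auto simp: piece_def)
        then show ?thesis using abs_Re_le_cmod[of "x (fst (z S)) b"] abs_Im_le_cmod[of "x (fst (z S)) b"]
          by (auto simp: \<Phi>_def Inr p intro!: max.coboundedI2)
      qed
      fix S' assume S': "S' \<in> divisor_of ` piece b0 m"
      define s where "s = fst (z S)"
      define y where "y = snd (z S)"
      define s' where "s' = fst (z S')"
      define y' where "y' = snd (z S')"
      have s: "s \<in> piece b0 m" "S = divisor_of s" "y \<in> U" "\<And>i. i \<in> P \<Longrightarrow> \<psi> y i s = 0"
        using z[OF S] by (auto simp: s_def y_def)
      have s': "s' \<in> piece b0 m" "S' = divisor_of s'" "y' \<in> U" "\<And>i. i \<in> P \<Longrightarrow> \<psi> y' i s' = 0"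
        using z[OF S'] by (auto simp: s'_def y'_def)
      have sV: "s \<in> V" "s' \<in> V" using s s' by (auto simp: piece_def)
      then have dV: "s - s' \<in> V" using V(1) by (rule cfun.subspace_diff[rotated])
      define \<Delta> where "\<Delta> = (\<Sum>k\<in>J'. \<bar>\<Phi> S k - \<Phi> S' k\<bar>)"
      define \<Delta>1 where "\<Delta>1 = (\<Sum>c\<in>J. \<bar>\<eta> c y - \<eta> c y'\<bar>)"
      define \<Delta>2 where "\<Delta>2 = (\<Sum>b\<in>Rest. cmod (x (s - s') b))"
      have "\<Delta> = \<Delta>1 + (\<Sum>p\<in>(Rest - {b0}) \<times> UNIV. \<bar>\<Phi> S (Inr p) - \<Phi> S' (Inr p)\<bar>)"
        unfolding \<Delta>_def J'_def \<Delta>1_def using J(1) finR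
        by (simp add: sum.Plus \<Phi>_def y_def y'_def)
      also have "(\<Sum>p\<in>(Rest - {b0}) \<times> UNIV. \<bar>\<Phi> S (Inr p) - \<Phi> S' (Inr p)\<bar>) =
          (\<Sum>b\<in>Rest - {b0}. \<Sum>t\<in>UNIV. \<bar>\<Phi> S (Inr (b, t)) - \<Phi> S' (Inr (b, t))\<bar>)"
        by (simp add: sum.cartesian_product)
      also have "\<dots> = (\<Sum>b\<in>Rest - {b0}. \<bar>Im (x (s - s') b)\<bar> + \<bar>Re (x (s - s') b)\<bar>)"
        by (simp add: UNIV_bool \<Phi>_def s_def[symmetric] s'_def[symmetric] x_diff[OF sV])
      also have "\<dots> \<ge> (\<Sum>b\<in>Rest - {b0}. cmod (x (s - s') b))"
        by (intro sum_mono) (metis add.commute cmod_le)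
      moreover have "(\<Sum>b\<in>Rest - {b0}. cmod (x (s - s') b)) = \<Delta>2"
        using b0 finR s(1) s'(1) by (simp add: \<Delta>2_def sum.remove[of Rest b0] x_diff[OF sV] piece_def)
      ultimately have \<Delta>: "\<Delta>1 + \<Delta>2 \<le> \<Delta>" by linarith
      have \<Delta>pos: "\<Delta>1 \<ge> 0" "\<Delta>2 \<ge> 0" by (auto simp: \<Delta>1_def \<Delta>2_def intro: sum_nonneg)
      have sumX: "(\<Sum>b\<in>Bs. cmod (x s' b)) \<le> X"
      proof -
        have "(\<Sum>b\<in>Rest. cmod (x s' b)) \<le> (\<Sum>b\<in>Rest. 1)" using s'(1) by (intro sum_mono) (auto simp: piece_def)
        then have 1: "(\<Sum>b\<in>Rest. cmod (x s' b)) \<le> card Rest" by simp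
        have "(\<Sum>j\<in>P. cmod (x s' (v j))) \<le> 2 * card P * K * (\<Sum>b\<in>Rest. cmod (x s' b))"
          using pivots[OF sV(2) s'(3)] s'(4) by simp
        also have "\<dots> \<le> 2 * card P * K * card Rest" using 1 K0 by (intro mult_left_mono) auto
        finally show ?thesis using 1 unfolding split X_def by linarith
      qed
      have "cmod (\<psi> y i (s - s')) \<le> X * K * \<Delta>1" if i: "i \<in> P" for i
      proof -
        have "\<psi> y i (s - s') = \<psi> y i s - \<psi> y i s'"
          using lin(1)[OF s(3) i dV sV(2)] by simp
        also have "\<dots> = - (\<psi> y i s' - \<psi> y' i s')" using s(4)[OF i] s'(4)[OF i] by simp
        also have "\<psi> y i s' - \<psi> y' i s' = (\<Sum>b\<in>Bs. x s' b * (\<psi> y i b - \<psi> y' i b))"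
          unfolding \<psi>_x[OF sV(2) s(3) i] \<psi>_x[OF sV(2) s'(3) i] by (simp add: sum_subtractf algebra_simps)
        finally have "cmod (\<psi> y i (s - s')) = cmod (\<Sum>b\<in>Bs. x s' b * (\<psi> y i b - \<psi> y' i b))"
          by (rule arg_cong[where f = cmod, THEN trans, OF _ norm_minus_cancel])
        also have "\<dots> \<le> (\<Sum>b\<in>Bs. cmod (x s' b) * (K * \<Delta>1))"
          using K_lip[OF i _ s(3) s'(3)]
          by (intro order_trans[OF norm_sum] sum_mono) (auto simp: norm_mult \<Delta>1_def intro!: mult_left_mono)
        also have "\<dots> = (\<Sum>b\<in>Bs. cmod (x s' b)) * (K * \<Delta>1)" by (simp add: sum_distrib_right)
        also have "\<dots> \<le> X * (K * \<Delta>1)" using sumX K0 \<Delta>pos by (intro mult_right_mono) auto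
        finally show ?thesis by (simp add: mult.assoc)
      qed
      then have "(\<Sum>i\<in>P. cmod (\<psi> y i (s - s'))) \<le> (\<Sum>i\<in>P. X * K * \<Delta>1)" by (intro sum_mono)
      then have "(\<Sum>j\<in>P. cmod (x (s - s') (v j))) \<le> 2 * (card P * (X * K * \<Delta>1)) + 2 * card P * K * \<Delta>2"
        using pivots[OF dV s(3)] by (simp add: \<Delta>2_def)
      then have "(\<Sum>b\<in>Bs. cmod (x (s - s') b)) \<le> 2 * (card P * (X * K * \<Delta>1)) + 2 * card P * K * \<Delta>2 + \<Delta>2"
        unfolding split \<Delta>2_def by linarith
      also have "\<dots> \<le> D * (\<Delta>1 + \<Delta>2)"
      proof -
        have "D * (\<Delta>1 + \<Delta>2) - (2 * (card P * (X * K * \<Delta>1)) + 2 * card P * K * \<Delta>2 + \<Delta>2)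
          = 2 * card P * K * \<Delta>1 + \<Delta>1 + 2 * card P * K * X * \<Delta>2" by (simp add: D_def algebra_simps)
        also have "\<dots> \<ge> 0" using K0 X0 \<Delta>pos by simp
        finally show ?thesis by linarith
      qed
      also have "\<dots> \<le> D * \<Delta>" using \<Delta> D0 by (rule mult_left_mono)
      finally have sumD: "(\<Sum>b\<in>Bs. cmod (x (s - s') b)) \<le> D * \<Delta>" .
      have "section_norm (s - s') \<le> (\<Sum>b\<in>Bs. cmod (x (s - s') b) * section_norm b)"
        using section_norm_sum[OF finBs, of "x (s - s')"] bdd Bs(2) x[OF dV] by (metis subsetD)
      also have "\<dots> \<le> (\<Sum>b\<in>Bs. cmod (x (s - s') b) * N)"
      proof (intro sum_mono mult_left_mono)
        fix b assume "b \<in> Bs"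
        then show "section_norm b \<le> N" unfolding N_def
          using finBs bdd Bs(2) by (intro member_le_sum section_norm_nonneg) auto
      qed auto
      also have "\<dots> \<le> N * (D * \<Delta>)"
        unfolding mult.commute[of _ N] sum_distrib_left[symmetric] using sumD N0 by (rule mult_left_mono)
      finally have norm_le: "section_norm (s - s') \<le> N * (D * \<Delta>)" .
      have large: "1 / real (Suc m) \<le> section_norm s" using s(1) by (simp add: piece_def)
      have "0 < 1 / real (Suc m)" by simp
      then have pos_s: "section_norm s > 0" using large by linarith
      have "1 / real (Suc m) \<le> section_norm s'" using s'(1) by (simp add: piece_def)
      then have pos_s': "section_norm s' > 0" using \<open>0 < 1 / real (Suc m)\<close> by linarith
      have "divisor_dist S S' \<le> 2 * section_norm (s - s') / section_norm s"
        unfolding s(2) s'(2) by (rule divisor_dist_le[OF bdd[OF sV(1)] pos_s bdd[OF sV(2)] pos_s'])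
      also have "\<dots> \<le> 2 * section_norm (s - s') / (1 / real (Suc m))"
        using large section_norm_nonneg[OF bdd[OF dV]] pos_s by (intro divide_left_mono mult_pos_pos) auto
      also have "\<dots> = 2 * real (Suc m) * section_norm (s - s')" by simp
      also have "\<dots> \<le> 2 * real (Suc m) * (N * (D * \<Delta>))" using norm_le by (intro mult_left_mono) auto
      finally show "divisor_dist S S' \<le> 2 * real (Suc m) * N * D * (\<Sum>k\<in>J'. \<bar>\<Phi> S k - \<Phi> S' k\<bar>)"
        by (simp add: \<Delta>_def mult.assoc)
    qed
  qed
  have "hausdorff_measure divisor_dist \<sigma> (\<Union>(b0, m)\<in>Rest \<times> UNIV. divisor_of ` piece b0 m) = 0"
    using piece_null finR by (intro hausdorff_null_UN) (auto intro: countable_finite)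
  moreover have "{divisor_of s | s. s \<in> V \<and> s \<noteq> 0 \<and> (\<exists>y\<in>U. \<forall>i\<in>P. \<psi> y i s = 0)} \<subseteq>
    (\<Union>(b0, m)\<in>Rest \<times> UNIV. divisor_of ` piece b0 m)"
  proof clarify
    fix s y assume s: "s \<in> V" "s \<noteq> 0" and y: "y \<in> U" "\<forall>i\<in>P. \<psi> y i s = 0"
    have ne: "\<exists>b\<in>Rest. x s b \<noteq> 0"
    proof (rule ccontr)
      assume none: "\<not> ?thesis"
      then have "(\<Sum>j\<in>P. cmod (x s (v j))) \<le> 0" using pivots[OF s(1) y(1)] y(2) by simp
      then have "(\<Sum>j\<in>P. cmod (x s (v j))) = 0" by (simp add: sum_nonneg antisym)
      then have "\<forall>j\<in>P. x s (v j) = 0" using P(1) by (simp add: sum_nonneg_eq_0_iff)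
      then have "x s b = 0" if "b \<in> Bs" for b using that none by (auto simp: Rest_def)
      then have "(\<Sum>b\<in>Bs. cfun_scale (x s b) b) = 0" by (intro sum.neutral) (auto simp: cfun_scale_def)
      then show False using x[OF s(1)] s(2) by simp
    qed
    then have "Rest \<noteq> {}" by blast
    then obtain b0 where b0: "b0 \<in> Rest" "\<And>b. b \<in> Rest \<Longrightarrow> cmod (x s b) \<le> cmod (x s b0)"
      using finR Max_in[of "(\<lambda>b. cmod (x s b)) ` Rest"] Max_ge[of "(\<lambda>b. cmod (x s b)) ` Rest"] by fastforce
    define c where "c = x s b0"
    have c: "c \<noteq> 0"
    proof
      assume "c = 0"
      moreover obtain b where "b \<in> Rest" "x s b \<noteq> 0" using ne by blast
      ultimately show False using b0(2)[of b] by (simp add: c_def)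
    qed
    define s' where "s' = cfun_scale (1/c) s"
    have s': "s' \<in> V" using s(1) V(1) by (simp add: s'_def cfun.subspace_scale)
    have xs': "x s' b = x s b / c" for b using x_scale[OF s(1)] by (simp add: s'_def)
    have "s' \<noteq> 0"
    proof
      assume "s' = 0"
      then have "cfun_scale c s' = 0" by (auto simp: cfun_scale_def)
      then have "s = 0" using c by (simp add: s'_def cfun_scale_def)
      then show False using s by simp
    qed
    then have "section_norm s' > 0" using pos s' by blast
    then obtain m where "1 / real (Suc m) < section_norm s'" using nat_approx_posE by blast
    moreover have "\<forall>i\<in>P. \<psi> y i s' = 0" using lin(2)[OF y(1) _ s(1)] y(2) by (simp add: s'_def)
    moreover have "cmod (x s' b) \<le> 1" if "b \<in> Rest" for b
      using b0(2)[OF that] c by (simp add: xs' norm_divide c_def divide_le_eq)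
    moreover have "x s' b0 = 1" using c by (simp add: xs' c_def)
    ultimately have "s' \<in> piece b0 m" using s' y(1) unfolding piece_def by auto
    moreover have "divisor_of s = divisor_of s'" using c by (simp add: s'_def divisor_of_scale)
    ultimately show "divisor_of s \<in> (\<Union>(b0, m)\<in>Rest \<times> UNIV. divisor_of ` piece b0 m)" using b0(1) by auto
  qed
  ultimately show ?thesis by (rule hausdorff_null_subset)
qed

section \<open>Sections through a union of twistor fibers\<close>

definition vanishes_on_tw :: "(vec3 \<times> vec3 \<Rightarrow> complex) \<Rightarrow> vec3 \<Rightarrow> bool" where
  "vanishes_on_tw f q \<longleftrightarrow> (\<forall>w. pairing q w = 0 \<longrightarrow> f (cross (cnj_vec q) w, w) = 0)"

definition sections_through :: "vec3 set \<Rightarrow> nat \<Rightarrow> (vec3 \<times> vec3 \<Rightarrow> complex) set" where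
  "sections_through Q d = {sec f | f. f \<in> bihom 1 d \<and> (\<forall>q\<in>Q. vanishes_on_tw f q)}"

lemma sec_cross [simp]: "sec f (cross n w, w) = f (cross n w, w)"
  by (simp add: sec_def)

lemma vanishes_on_tw_sec: "vanishes_on_tw (sec f) q \<longleftrightarrow> vanishes_on_tw f q"
  by (simp add: vanishes_on_tw_def)

lemma sec_add: "sec f + sec g = sec (\<lambda>x. f x + g x)"
  by (auto simp: sec_def fun_eq_iff)

lemma sec_scale: "cfun_scale c (sec f) = sec (\<lambda>x. c * f x)"
  by (auto simp: sec_def cfun_scale_def fun_eq_iff)

lemma sections_throughI:
  "f \<in> bihom 1 d \<Longrightarrow> (\<And>q. q \<in> Q \<Longrightarrow> vanishes_on_tw f q) \<Longrightarrow> sec f \<in> sections_through Q d"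
  unfolding sections_through_def by blast

lemma sections_throughE:
  assumes "s \<in> sections_through Q d"
  obtains f where "s = sec f" "f \<in> bihom 1 d" "\<And>q. q \<in> Q \<Longrightarrow> vanishes_on_tw f q"
  using assms unfolding sections_through_def by blast

lemma sections_through_mono: "Q \<subseteq> Q' \<Longrightarrow> s \<in> sections_through Q' d \<Longrightarrow> s \<in> sections_through Q d"
  unfolding sections_through_def by blast

lemma subspace_sections_through: "cfun.subspace (sections_through Q d)"
  unfolding cfun.subspace_def
proof (intro conjI ballI allI)
  have "sec (\<lambda>_. 0) \<in> sections_through Q d"
    by (intro sections_throughI bihom_zero) (simp add: vanishes_on_tw_def)
  moreover have "sec (\<lambda>_. 0) = 0" by (auto simp: sec_def fun_eq_iff)
  ultimately show "0 \<in> sections_through Q d" by metis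
next
  fix s t assume "s \<in> sections_through Q d" "t \<in> sections_through Q d"
  then show "s + t \<in> sections_through Q d"
    by (elim sections_throughE) (auto simp: sec_add vanishes_on_tw_def intro!: sections_throughI bihom_add)
next
  fix c s assume "s \<in> sections_through Q d"
  then show "cfun_scale c s \<in> sections_through Q d"
    by (elim sections_throughE) (auto simp: sec_scale vanishes_on_tw_def intro!: sections_throughI bihom_cmult)
qed

lemma sum_fun_apply:
  fixes g :: "'i \<Rightarrow> 'a \<Rightarrow> complex"
  shows "(\<Sum>i\<in>I. g i) x = (\<Sum>i\<in>I. g i x)"
  by (induction I rule: infinite_finite_induct) auto

lemma sections_finite_dimensional:
  obtains T where "finite T" "\<And>Q. sections_through Q d \<subseteq> cfun.span T"
proof
  define m where "m z = sec (\<lambda>(v, w). monomial3 (fst z) v * monomial3 (snd z) w)" for z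
  let ?I = "exponents 1 \<times> exponents d"
  show "finite (m ` ?I)" by (intro finite_imageI finite_cartesian_product finite_exponents)
  show "sections_through Q d \<subseteq> cfun.span (m ` ?I)" for Q
  proof
    fix s assume "s \<in> sections_through Q d"
    then obtain f where f: "s = sec f" "f \<in> bihom 1 d" by (elim sections_throughE)
    then obtain c where c: "f = (\<lambda>(v, w). \<Sum>\<alpha>\<in>exponents 1. \<Sum>\<beta>\<in>exponents d. c \<alpha> \<beta> * monomial3 \<alpha> v * monomial3 \<beta> w)"
      unfolding bihom_def by blast
    have "s = (\<Sum>z\<in>?I. cfun_scale (c (fst z) (snd z)) (m z))"
    proof (rule ext)
      fix x :: "vec3 \<times> vec3"
      obtain v w where x: "x = (v, w)" by (cases x)
      have "(\<Sum>z\<in>?I. cfun_scale (c (fst z) (snd z)) (m z)) x = (\<Sum>z\<in>?I. cfun_scale (c (fst z) (snd z)) (m z) x)"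
        by (rule sum_fun_apply)
      also have "\<dots> = s x"
        by (simp add: x f(1) c sec_def m_def cfun_scale_def sum.cartesian_product mult.assoc case_prod_unfold)
      finally show "s x = (\<Sum>z\<in>?I. cfun_scale (c (fst z) (snd z)) (m z)) x" by simp
    qed
    then show "s \<in> cfun.span (m ` ?I)"
      by (rule ssubst) (intro cfun.span_sum cfun.span_scale cfun.span_base imageI)
  qed
qed

lemma bounded_sections_through: "s \<in> sections_through Q d \<Longrightarrow> bounded_section s"
  by (elim sections_throughE) (simp add: bounded_section_sec)

lemma section_norm_pos:
  assumes "d \<ge> 1" "s \<in> sections_through Q d" "s \<noteq> 0"
  shows "section_norm s > 0"
proof -
  obtain f where f: "s = sec f" "f \<in> bihom 1 d" using assms(2) by (elim sections_throughE)
  have "\<exists>x. s x \<noteq> 0" using assms(3) by (auto simp: fun_eq_iff)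
  then obtain v w where "s (v, w) \<noteq> 0" by auto
  then have vw: "pairing v w = 0" "f (v, w) \<noteq> 0" by (auto simp: f(1) sec_def split: if_splits)
  have w0: "w \<noteq> 0" using vw bihom_at_zero[OF f(2)] assms(1) by auto
  have "f (0 *s v, 1 *s w) = 0" unfolding bihom_scale[OF f(2)] by simp
  then have v0: "v \<noteq> 0" using vw by auto
  define v' where "v' = of_real (1 / norm v) *s v"
  define w' where "w' = of_real (1 / norm w) *s w"
  have "norm v' = 1" "norm w' = 1" "pairing v' w' = 0"
    using v0 w0 vw by (simp_all add: v'_def w'_def norm_scale_vec norm_divide)
  moreover have "f (v', w') \<noteq> 0"
    unfolding v'_def w'_def bihom_scale[OF f(2)] using v0 w0 vw by simp
  ultimately have "(v', w') \<in> unit_cone" "s (v', w') \<noteq> 0" by (auto simp: unit_cone_def f(1) sec_def)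
  then have "0 < cmod (s (v', w'))" "cmod (s (v', w')) \<le> section_norm s"
    using section_norm_upper[OF bounded_sections_through[OF assms(2)]] by auto
  then show ?thesis by linarith
qed

lemma linear_system_through_eq:
  assumes "d \<ge> 1" "0 \<notin> Q"
  shows "linear_system_through (\<Union>q\<in>Q. tw q) 1 d = {divisor_of s | s. s \<in> sections_through Q d \<and> s \<noteq> 0}"
proof -
  have "(\<Union>q\<in>Q. tw q) \<subseteq> supp (divisor_of (sec f)) \<longleftrightarrow> (\<forall>q\<in>Q. vanishes_on_tw f q)" if f: "f \<in> bihom 1 d" for f
  proof -
    have "(\<Union>q\<in>Q. tw q) \<subseteq> supp (divisor_of (sec f)) \<longleftrightarrow> (\<forall>q\<in>Q. tw q \<subseteq> supp (divisor_of (sec f)))" by blast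
    also have "\<dots> \<longleftrightarrow> (\<forall>q\<in>Q. vanishes_on_tw f q)"
    proof (rule ball_cong[OF refl])
      fix q assume "q \<in> Q"
      then have "q \<noteq> 0" using assms(2) by auto
      then show "tw q \<subseteq> supp (divisor_of (sec f)) \<longleftrightarrow> vanishes_on_tw f q"
        unfolding vanishes_on_tw_def using tw_subset_supp[OF f, of q] assms(1) by simp
    qed
    finally show ?thesis .
  qed
  then have iff: "(\<Union>q\<in>Q. tw q) \<subseteq> supp (divisor_of (sec f)) \<longleftrightarrow> (\<forall>q\<in>Q. vanishes_on_tw f q)" if "f \<in> bihom 1 d" for f
    using that .
  show ?thesis
  proof (intro equalityI subsetI)
    fix S assume "S \<in> linear_system_through (\<Union>q\<in>Q. tw q) 1 d"
    then obtain f where f: "f \<in> bihom 1 d" "S = divisor_of (sec f)" "sec f \<noteq> 0" "(\<Union>q\<in>Q. tw q) \<subseteq> supp S"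
      by (auto simp: linear_system_through_def linear_system_def flag_sections_eq)
    then have "sec f \<in> sections_through Q d" using iff[OF f(1)] by (intro sections_throughI) auto
    then show "S \<in> {divisor_of s | s. s \<in> sections_through Q d \<and> s \<noteq> 0}" using f by blast
  next
    fix S assume "S \<in> {divisor_of s | s. s \<in> sections_through Q d \<and> s \<noteq> 0}"
    then obtain s where s: "S = divisor_of s" "s \<in> sections_through Q d" "s \<noteq> 0" by blast
    obtain f where f: "s = sec f" "f \<in> bihom 1 d" "\<forall>q\<in>Q. vanishes_on_tw f q"
      using s(2) unfolding sections_through_def by blast
    have "S \<in> linear_system 1 d"
      unfolding linear_system_def flag_sections_eq using s(1,3) f(1,2) by blast
    then show "S \<in> linear_system_through (\<Union>q\<in>Q. tw q) 1 d"
      unfolding linear_system_through_def using iff[OF f(2)] f(1,3) s(1) by simp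
  qed
qed

lemma dim_linear_system_through:
  assumes "d \<ge> 1" "0 \<notin> Q"
  shows "cfun.dim (\<Union>(linear_system_through (\<Union>q\<in>Q. tw q) 1 d)) = cfun.dim (sections_through Q d)"
proof -
  have "\<Union>(linear_system_through (\<Union>q\<in>Q. tw q) 1 d) = sections_through Q d - {0}"
  proof (intro equalityI subsetI)
    fix t assume "t \<in> \<Union>(linear_system_through (\<Union>q\<in>Q. tw q) 1 d)"
    then obtain s where s: "s \<in> sections_through Q d" "s \<noteq> 0" "t \<in> divisor_of s"
      unfolding linear_system_through_eq[OF assms] by blast
    then obtain c where c: "c \<noteq> 0" "t = cfun_scale c s" unfolding proj_point_def by blast
    have "t \<in> sections_through Q d"
      using c s subspace_sections_through cfun.subspace_scale by blast
    moreover have "t \<noteq> 0"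
    proof
      assume "t = 0"
      then have "cfun_scale c s = 0" unfolding c(2) .
      then show False using c(1) s(2) cfun.scale_eq_0_iff by blast
    qed
    ultimately show "t \<in> sections_through Q d - {0}" by blast
  next
    fix t assume "t \<in> sections_through Q d - {0}"
    then show "t \<in> \<Union>(linear_system_through (\<Union>q\<in>Q. tw q) 1 d)"
      unfolding linear_system_through_eq[OF assms] using self_mem_divisor_of by blast
  qed
  then show ?thesis by (metis cfun.dim_span cfun.span_delete_0)
qed

lemma fiber_form_in_sections_through:
  assumes "finite Q'" "card Q' = d + 1" "a \<in> Q'" "Q \<subseteq> Q'"
  shows "sec (fiber_form a (Q' - {a})) \<in> sections_through Q d"
proof (rule sections_throughI)
  show "fiber_form a (Q' - {a}) \<in> bihom 1 d" using fiber_form_bihom[of "Q' - {a}" a] assms by simp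
  show "vanishes_on_tw (fiber_form a (Q' - {a})) q" if "q \<in> Q" for q
    unfolding vanishes_on_tw_def using that assms by (auto intro!: fiber_form_vanishes)
qed

text \<open>Hausdorff dimensions are not negative, so a set of smaller dimension can only exist if the linear
  system has positive dimension. After enlarging \<open>Q\<close> to \<open>d + 1\<close> points there is one form
  \<open>fiber_form\<close> for each of them, and only that of \<open>a\<close> does not vanish at \<open>(a, w)\<close> for general \<open>w\<close> on
  the line of \<open>a\<close>.\<close>

lemma dim_sections_through_ge_2:
  assumes Q: "general_position Q" "card Q \<le> d + 1" and d: "d \<ge> 1"
  shows "2 \<le> cfun.dim (sections_through Q d)"
proof -
  obtain Q' where Q': "general_position Q'" "Q \<subseteq> Q'" "card Q' = d + 1"
    using general_position_extend[OF Q] by blast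
  note fin = general_positionD(1)[OF Q'(1)]
  obtain a b where ab: "a \<in> Q'" "b \<in> Q'" "a \<noteq> b"
    using exists_two_elements[OF fin] Q'(3) d by auto
  define s where "s c = sec (fiber_form c (Q' - {c}))" for c
  have s: "s c \<in> sections_through Q d" if "c \<in> Q'" for c
    unfolding s_def by (rule fiber_form_in_sections_through[OF fin Q'(3) that Q'(2)])
  have wit: "\<exists>z. s c z \<noteq> 0 \<and> (\<forall>c'\<in>Q' - {c}. s c' z = 0)" if c: "c \<in> Q'" for c
  proof -
    obtain w where w: "w \<noteq> 0" "pairing c w = 0" "\<And>b. b \<in> Q' - {c} \<Longrightarrow> pairing b w \<noteq> 0"
      using exists_generic_on_line[OF Q'(1) c] by blast
    have "s c (c, w) \<noteq> 0"
      using w fin general_positionD(2)[OF Q'(1) c] by (simp add: s_def sec_def fiber_form_def)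
    moreover have "s c' (c, w) = 0" if "c' \<in> Q' - {c}" for c'
    proof -
      have "(\<Prod>b\<in>Q' - {c'}. pairing b w) = 0" using that c fin w(2) by (intro prod_zero) auto
      then show ?thesis by (simp add: s_def sec_def fiber_form_def)
    qed
    ultimately show ?thesis by blast
  qed
  have ne: "s a \<noteq> s b" using wit[OF ab(1)] ab by (metis DiffI singletonD)
  have indep: "cfun.independent {s a, s b}"
  proof (rule cfun.independent_if_scalars_zero)
    fix g x assume g: "(\<Sum>x\<in>{s a, s b}. cfun_scale (g x) x) = 0" and x: "x \<in> {s a, s b}"
    have g': "g (s a) * s a z + g (s b) * s b z = 0" for z
    proof -
      have "(cfun_scale (g (s a)) (s a) + cfun_scale (g (s b)) (s b)) z = 0" using g ne by simp
      then show ?thesis by (simp add: cfun_scale_def)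
    qed
    obtain z where z: "s a z \<noteq> 0" "s b z = 0" using wit[OF ab(1)] ab by auto
    obtain z' where z': "s b z' \<noteq> 0" "s a z' = 0" using wit[OF ab(2)] ab by auto
    have "g (s a) = 0" "g (s b) = 0" using g'[of z] g'[of z'] z z' by auto
    then show "g x = 0" using x by blast
  qed simp
  obtain T where T: "finite T" "\<And>Q. sections_through Q d \<subseteq> cfun.span T" using sections_finite_dimensional by blast
  have "{s a, s b} \<subseteq> sections_through Q d" using s ab by blast
  then obtain Bs where Bs: "{s a, s b} \<subseteq> Bs" "Bs \<subseteq> sections_through Q d" "cfun.independent Bs" "sections_through Q d \<subseteq> cfun.span Bs"
    using cfun.maximal_independent_subset_extend[OF _ indep] by metis
  have "finite Bs" using cfun.independent_span_bound[OF T(1) Bs(3)] Bs(2) T(2) by (meson order_trans)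
  then have "card {s a, s b} \<le> card Bs" using Bs(1) by (rule card_mono)
  moreover have "card Bs = cfun.dim (sections_through Q d)" using cfun.basis_card_eq_dim[OF Bs(2,4,3)] .
  ultimately show ?thesis using ne by simp
qed

section \<open>No surface contains too many fibers\<close>

lemma poly_zero_of_many_roots:
  fixes P :: "complex poly"
  assumes "degree P \<le> k" "inj_on t R" "finite R" "card R > k" "\<And>b. b \<in> R \<Longrightarrow> poly P (t b) = 0"
  shows "P = 0"
proof (rule ccontr)
  assume "P \<noteq> 0"
  then have "card (t ` R) \<le> degree P"
    using card_mono[OF poly_roots_finite[of P], of "t ` R"] card_poly_roots_bound[of P] assms(5) by fastforce
  then show False using assms card_image[OF assms(2)] by simp
qed

lemma spans_line:
  assumes "w \<noteq> 0" "cross a b = c *s w" "c \<noteq> 0" "pairing v w = 0"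
  obtains x y where "v = x *s a + y *s b"
  using orthogonal_to_cross_imp_combination[of a b v] assms by auto

text \<open>Over the line of \<open>q\<close> a section through the fiber of \<open>q\<close> is a form of degree \<open>d\<close> on that line
  times the equation of the fiber. Where the line meets the line of another \<open>b\<close>, the section vanishes
  at two points of the same bidegree (1,0) curve, so that the form has a zero. This gives \<open>d + 1\<close>
  zeros. Hence the section vanishes over \<open>d + 2\<close> lines, which exceeds the degree \<open>d + 1\<close> of
  \<open>f (n \<times> w, w)\<close> in \<open>w\<close>.\<close>

lemma no_section_through_many_fibers:
  assumes Q: "general_position Q" "card Q = d + 2" and d: "d \<ge> 1"
    and f: "f \<in> bihom 1 d" and van: "\<And>q. q \<in> Q \<Longrightarrow> vanishes_on_tw f q"
  shows "sec f = 0"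
proof -
  note gp = general_positionD[OF Q(1)]
  note fin = gp(1)
  note zero_snd = bihom_at_zero[OF f, unfolded One_nat_def]
  have lin0: "f (x *s a + y *s b, w) = 0" if "f (a, w) = 0" "f (b, w) = 0" for x y a b w
    using bihom_1_linear[OF f] that by simp
  have at_vertex: "f (q, w) = 0" if q: "q \<in> Q" and qw: "pairing q w = 0" for q w
  proof (cases "w = 0")
    case True then show ?thesis using zero_snd d by simp
  next
    case w: False
    define R where "R = Q - {q}"
    have R: "finite R" "card R = d + 1" using fin Q(2) q by (auto simp: R_def)
    have node: "f (q, u) = 0" if b: "b \<in> R" and u: "pairing q u = 0" "pairing b u = 0" "u \<noteq> 0" for b u
    proof -
      have qb: "cross q b \<noteq> 0" using gp(3) q b by (auto simp: R_def)
      obtain k where k: "u = k *s cross q b"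
        using orthogonal_imp_multiple_cross[OF qb, of u] u by (metis pairing_commute)
      have k0: "k \<noteq> 0" using k u by auto
      have "cross (cross (cnj_vec q) u) (cross (cnj_vec b) u) = det3 (cnj_vec q) (cnj_vec b) u *s u"
        by (simp add: vec3_eq_iff det3_def pairing_expand algebra_simps)
      moreover have "det3 (cnj_vec q) (cnj_vec b) u \<noteq> 0"
        using qb k0 by (simp add: det3_def k cnj_vec_cross[symmetric])
      ultimately obtain x y where "q = x *s cross (cnj_vec q) u + y *s cross (cnj_vec b) u"
        using spans_line[OF u(3)] u(1) by metis
      moreover have "f (cross (cnj_vec q) u, u) = 0" "f (cross (cnj_vec b) u, u) = 0"
        using van[OF q] van[of b] b u by (auto simp: vanishes_on_tw_def R_def)
      ultimately show ?thesis using lin0 by metis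
    qed
    define X where "X = insert w ((\<lambda>b. cross b q) ` R)"
    have "cross b q \<noteq> 0" if "b \<in> R" for b using gp(3) q that by (auto simp: R_def)
    then have "0 \<notin> X" unfolding X_def using w by (metis image_iff insert_iff)
    moreover have "finite X" using R by (simp add: X_def)
    ultimately obtain c where c: "\<And>x. x \<in> X \<Longrightarrow> pairing x c \<noteq> 0" using exists_off_planes by blast
    define e where "e = cross q c"
    have be: "pairing b e \<noteq> 0" if "b \<in> R" for b
      using c[of "cross b q"] that by (auto simp: X_def e_def pairing_cross_cycle)
    have qe: "pairing q e = 0" by (simp add: e_def)
    have we: "cross w e \<noteq> 0"
    proof -
      have "cross w e = pairing w c *s q" by (simp add: e_def cross_cross pairing_commute[of w q] qw)
      then show ?thesis using c[of w] gp(2)[OF q] by (simp add: X_def)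
    qed
    define t where "t b = - pairing b w / pairing b e" for b
    have on: "pairing b (w + t b *s e) = 0" "w + t b *s e \<noteq> 0" if "b \<in> R" for b
    proof -
      show "pairing b (w + t b *s e) = 0" using be[OF that] by (simp add: t_def)
      show "w + t b *s e \<noteq> 0"
      proof
        assume "w + t b *s e = 0"
        then have "cross (w + t b *s e) e = 0" by simp
        then show False using we by simp
      qed
    qed
    have "inj_on t R"
    proof (rule inj_onI, rule ccontr)
      fix b b' assume b: "b \<in> R" "b' \<in> R" "t b = t b'" "b \<noteq> b'"
      have "det3 q b b' \<noteq> 0" using gp(4)[OF q, of b b'] b by (auto simp: R_def)
      moreover have "pairing (w + t b *s e) b' = 0" using on(1)[OF b(2)] b(3) by (simp add: pairing_commute)
      moreover have "pairing (w + t b *s e) b = 0" "pairing (w + t b *s e) q = 0"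
        using on(1)[OF b(1)] qw qe by (simp_all add: pairing_commute)
      ultimately have "w + t b *s e = 0" using zero_if_pairings_zero by blast
      then show False using on(2)[OF b(1)] by blast
    qed
    moreover obtain P where P: "degree P \<le> d" "\<And>t. f (q, w + t *s e) = poly P t"
      using bihom_line_snd[OF f] by metis
    moreover have "poly P (t b) = 0" if "b \<in> R" for b
      unfolding P(2)[symmetric] using node[OF that _ on[OF that]] qw qe by simp
    ultimately have "P = 0" using poly_zero_of_many_roots[of P d t R] R by simp
    then show ?thesis using P(2)[of 0] by simp
  qed
  have over_lines: "f (cross n w, w) = 0" if q: "q \<in> Q" and qw: "pairing q w = 0" for n q w
  proof (cases "w = 0")
    case True then show ?thesis using zero_snd d by simp
  next
    case w: False
    have "cross q (cross (cnj_vec q) w) = (- pairing q (cnj_vec q)) *s w"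
      by (simp add: cross_cross qw vec3_eq_iff)
    moreover have "- pairing q (cnj_vec q) \<noteq> 0" using gp(2)[OF q] by simp
    moreover have "pairing (cross n w) w = 0" by simp
    ultimately obtain x y where "cross n w = x *s q + y *s cross (cnj_vec q) w"
      using spans_line[OF w] by metis
    then show ?thesis using lin0 at_vertex[OF q qw] van[OF q] qw by (simp add: vanishes_on_tw_def)
  qed
  have all: "f (cross n w, w) = 0" for n w
  proof (cases "\<exists>q\<in>Q. pairing q w = 0")
    case True then show ?thesis using over_lines by blast
  next
    case off: False
    \<comment> \<open>The direction \<open>e\<close> is such that the line through \<open>w\<close> meets the lines of \<open>Q\<close> in different points.\<close>
    define X where "X = Q \<union> (\<lambda>(q, q'). pairing q w *s q' - pairing q' w *s q) ` (Q \<times> Q - Id)"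
    have "pairing q w *s q' - pairing q' w *s q \<noteq> 0" if "q \<in> Q" "q' \<in> Q" "q \<noteq> q'" for q q'
    proof
      assume "pairing q w *s q' - pairing q' w *s q = 0"
      then have "cross q (pairing q w *s q' - pairing q' w *s q) = 0" by (metis cross_simps(8))
      then show False using gp(3)[OF that] off that(1) by simp
    qed
    then have "0 \<notin> (\<lambda>(q, q'). pairing q w *s q' - pairing q' w *s q) ` (Q \<times> Q - Id)" by fastforce
    then have "0 \<notin> X" using gp(2) unfolding X_def by blast
    moreover have "finite X" using fin by (auto simp: X_def)
    ultimately obtain e where e: "\<And>x. x \<in> X \<Longrightarrow> pairing x e \<noteq> 0" using exists_off_planes by blast
    have qe: "pairing q e \<noteq> 0" if "q \<in> Q" for q using e that by (simp add: X_def)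
    define t where "t q = - pairing q w / pairing q e" for q
    have "inj_on t Q"
    proof (rule inj_onI, rule ccontr)
      fix q q' assume q: "q \<in> Q" "q' \<in> Q" "t q = t q'" "q \<noteq> q'"
      have "pairing q w *s q' - pairing q' w *s q \<in> X" using q unfolding X_def by force
      from e[OF this] have "pairing q w * pairing q' e \<noteq> pairing q' w * pairing q e" by simp
      then show False using q(3) qe q(1,2) by (simp add: t_def field_simps)
    qed
    moreover obtain P where P: "degree P \<le> 1 + d" "\<And>t. f (cross n w + t *s cross n e, w + t *s e) = poly P t"
      using bihom_line[OF f] by metis
    moreover have "poly P (t q) = 0" if "q \<in> Q" for q
    proof -
      have "pairing q (w + t q *s e) = 0" using qe[OF that] by (simp add: t_def)
      then have "f (cross n (w + t q *s e), w + t q *s e) = 0" using over_lines that by blast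
      then show ?thesis by (simp add: P(2)[symmetric])
    qed
    ultimately have "P = 0" using poly_zero_of_many_roots[of P "1 + d" t Q] fin Q(2) by simp
    then show ?thesis using P(2)[of 0] by simp
  qed
  have "f (v, w) = 0" if vw: "pairing v w = 0" for v w
  proof (cases "w = 0")
    case True then show ?thesis using zero_snd d by simp
  next
    case w: False
    have "cross (cross (cnj_vec w) v) w = pairing w (cnj_vec w) *s v"
      using cross_cross[of w "cnj_vec w" v] cross_anticommute[of "cross (cnj_vec w) v" w] vw
      by (simp add: pairing_commute)
    then have "cross ((1 / pairing w (cnj_vec w)) *s cross (cnj_vec w) v) w = v"
      using w by (simp add: vec3_eq_iff)
    then show ?thesis using all by metis
  qed
  then show ?thesis by (auto simp: sec_def fun_eq_iff)
qed

section \<open>Surfaces that contain a further fiber\<close>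

subsection \<open>Fibers of points on a line through two of the given ones\<close>

text \<open>The derivative of a section at the fiber over \<open>l\<close>. Here \<open>n \<times> w\<close> is a lift of the curve
  \<open>w = l + t e\<close> to the flag threefold; for the curve in the fiber of \<open>q\<close> one has \<open>n = cnj_vec q\<close>.\<close>

definition slope :: "vec3 \<Rightarrow> (vec3 \<times> vec3 \<Rightarrow> complex) \<Rightarrow> vec3 \<Rightarrow> vec3 \<Rightarrow> complex" where
  "slope l s n e = deriv (\<lambda>t. s (cross n (l + t *s e), l + t *s e)) 0"

lemma slope_gradient:
  assumes "f \<in> bihom 1 d"
  shows "\<exists>D. \<forall>e. ((\<lambda>t. sec f (cross n (l + t *s e), l + t *s e)) has_field_derivative pairing D e) (at 0) \<and>
    slope l (sec f) n e = pairing D e"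
proof -
  have "(\<lambda>w. f (cross n w, w)) \<in> polyalg coords"
    by (intro bihom_polyalg[OF assms] polyvec_cross polyvec_const polyvec_coords)
  then obtain D where D: "\<And>e. ((\<lambda>t. f (cross n (l + t *s e), l + t *s e)) has_field_derivative pairing D e) (at 0)"
    by (rule polyalg_gradient[where u = l]) blast
  have "((\<lambda>t. sec f (cross n (l + t *s e), l + t *s e)) has_field_derivative pairing D e) (at 0)" for e
    unfolding sec_cross by (rule D)
  then show ?thesis unfolding slope_def using DERIV_imp_deriv by blast
qed

lemma slope_has_derivative:
  assumes "f \<in> bihom 1 d"
  shows "((\<lambda>t. sec f (cross n (l + t *s e), l + t *s e)) has_field_derivative slope l (sec f) n e) (at 0)"
  using slope_gradient[OF assms, of n l] by auto

lemma slope_linear_direction: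
  assumes "f \<in> bihom 1 d"
  shows "slope l (sec f) n (x *s e + y *s e') = x * slope l (sec f) n e + y * slope l (sec f) n e'"
  using slope_gradient[OF assms, of n l] by auto

lemma slope_linear_lift:
  assumes "f \<in> bihom 1 d"
  shows "slope l (sec f) (x *s n + y *s n') e = x * slope l (sec f) n e + y * slope l (sec f) n' e"
proof -
  note D = slope_has_derivative[OF assms, of _ l e]
  have "((\<lambda>t. x * sec f (cross n (l + t *s e), l + t *s e) + y * sec f (cross n' (l + t *s e), l + t *s e))
      has_field_derivative x * slope l (sec f) n e + y * slope l (sec f) n' e) (at 0)"
    by (intro DERIV_add DERIV_cmult D)
  moreover have "x * sec f (cross n w, w) + y * sec f (cross n' w, w) = sec f (cross (x *s n + y *s n') w, w)" for w
    unfolding sec_cross using bihom_1_linear[OF assms, of x "cross n w" y "cross n' w" w] by simp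
  ultimately have "((\<lambda>t. sec f (cross (x *s n + y *s n') (l + t *s e), l + t *s e))
      has_field_derivative x * slope l (sec f) n e + y * slope l (sec f) n' e) (at 0)" by (simp only:)
  from DERIV_imp_deriv[OF this] show ?thesis by (simp only: slope_def)
qed

lemma slope_linear_section:
  assumes "f \<in> bihom 1 d" "g \<in> bihom 1 d"
  shows "slope l (sec f + sec g) n e = slope l (sec f) n e + slope l (sec g) n e"
    and "slope l (cfun_scale c (sec f)) n e = c * slope l (sec f) n e"
proof -
  note F = slope_has_derivative[OF assms(1), of n l e]
  note G = slope_has_derivative[OF assms(2), of n l e]
  show "slope l (sec f + sec g) n e = slope l (sec f) n e + slope l (sec g) n e"
    using DERIV_imp_deriv[OF DERIV_add[OF F G]] by (simp only: slope_def plus_fun_apply)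
  show "slope l (cfun_scale c (sec f)) n e = c * slope l (sec f) n e"
    using DERIV_imp_deriv[OF DERIV_cmult[OF F, of c]] by (simp only: slope_def cfun_scale_def)
qed

lemma slope_vanishes:
  assumes "vanishes_on_tw s q" "pairing q l = 0" "pairing q e = 0"
  shows "slope l s (cnj_vec q) e = 0"
proof -
  have "s (cross (cnj_vec q) (l + t *s e), l + t *s e) = 0" for t
    using assms(1)[unfolded vanishes_on_tw_def, rule_format, of "l + t *s e"] assms(2,3) by simp
  then have "(\<lambda>t. s (cross (cnj_vec q) (l + t *s e), l + t *s e)) = (\<lambda>_. 0)" by blast
  then show ?thesis by (simp only: slope_def deriv_const)
qed

lemma cis_lipschitz: "cmod (cis x - cis y) \<le> \<bar>x - y\<bar>"
proof -
  have "cis x - cis y = cis y * (cis (x - y) - 1)" by (simp add: cis_mult algebra_simps)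
  then have "cmod (cis x - cis y) = cmod (cis (x - y) - 1)" by (simp add: norm_mult)
  also have "\<dots> = 2 * \<bar>sin ((x - y) / 2)\<bar>" using dist_exp_i_1[of "x - y"] by (simp add: cis_conv_exp)
  also have "\<dots> \<le> \<bar>x - y\<bar>" using abs_sin_x_le_abs_x[of "(x - y) / 2"] by simp
  finally show ?thesis .
qed

text \<open>Let \<open>q = \<alpha> a + \<beta> b\<close>. The fibers of \<open>a\<close>, \<open>b\<close> and \<open>q\<close> meet the same bidegree (1,0) curve.
  The derivative of a section there is bilinear in the lift and the direction, and its
  vanishing along the three fibers forces the two remaining coefficients to have a ratio of absolute
  value 1, whatever \<open>\<alpha>\<close> and \<open>\<beta>\<close> are: they enter through the quotient of a number by its conjugate.
  For each of the possible ratios \<open>cis \<theta>\<close> this is one complex linear condition on the section, and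
  \<open>\<theta>\<close> is one real parameter, so that the real dimension drops by one.\<close>

lemma null_collinear:
  assumes Q: "general_position Q" "card Q \<le> d + 1" and d: "d \<ge> 1"
    and ab: "a \<in> Q" "b \<in> Q" "a \<noteq> b"
    and \<sigma>: "2 * (real (cfun.dim (sections_through Q d)) - 1) - 1 < \<sigma>"
  shows "hausdorff_measure divisor_dist \<sigma> {divisor_of s | s. s \<in> sections_through Q d \<and> s \<noteq> 0 \<and>
    (\<exists>\<alpha> \<beta>. \<alpha> \<noteq> 0 \<and> \<beta> \<noteq> 0 \<and> vanishes_on_tw s (\<alpha> *s a + \<beta> *s b))} = 0"
proof -
  obtain Q' where Q': "general_position Q'" "Q \<subseteq> Q'" "card Q' = d + 1"
    using general_position_extend[OF Q] by blast
  note fin = general_positionD(1)[OF Q'(1)]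
  have ab': "a \<in> Q'" "b \<in> Q'" using ab Q'(2) by auto
  define l where "l = cross a b"
  define c where "c = cnj_vec l"
  define \<kappa> where "\<kappa> = pairing l c"
  have l0: "l \<noteq> 0" using general_positionD(3)[OF Q(1) ab] by (simp add: l_def)
  then have \<kappa>: "\<kappa> \<noteq> 0" by (simp add: \<kappa>_def c_def)
  \<comment> \<open>The directions of the lines of \<open>a\<close> and \<open>b\<close> at their intersection \<open>l\<close>, scaled such that the line of
    \<open>\<alpha> a + \<beta> b\<close> has direction \<open>\<alpha> ea - \<beta> eb\<close>.\<close>
  define ea where "ea = cross c a"
  define eb where "eb = cross b c"
  have e: "pairing a ea = 0" "pairing b eb = 0" "pairing b ea = \<kappa>" "pairing a eb = \<kappa>"
    by (simp_all add: ea_def eb_def \<kappa>_def l_def pairing_expand algebra_simps)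
  have al: "pairing a l = 0" "pairing b l = 0" by (simp_all add: l_def)
  define A where "A s = slope l s (cnj_vec a) eb" for s
  define B where "B s = slope l s (cnj_vec b) ea" for s
  define v where "v = sec (fiber_form a (Q' - {a}))"
  have v: "v \<in> sections_through Q d"
    unfolding v_def by (rule fiber_form_in_sections_through[OF fin Q'(3) ab'(1) Q'(2)])
  have "v (cross (cnj_vec a) w, w) = 0" for w by (simp add: v_def fiber_form_def)
  then have Av: "A v = 0" by (simp only: A_def slope_def deriv_const)
  have Bv: "B v \<noteq> 0"
  proof -
    \<comment> \<open>Along the line of \<open>a\<close> the factor \<open>b\<close> of \<open>v\<close> has a simple zero at \<open>l\<close>, and \<open>g\<close> collects the rest.\<close>
    define g where "g w = \<kappa> * (pairing (cross (cnj_vec b) w) (cnj_vec a) * (\<Prod>c\<in>Q' - {a} - {b}. pairing c w))" for w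
    have g: "g \<in> polyalg coords"
      unfolding g_def by (intro polyalg.mult polyalg.const polyalg_pairing polyvec_cross polyalg_prod polyvec_const polyvec_coords)
    obtain D where D: "((\<lambda>t. g (l + t *s ea)) has_field_derivative pairing D ea) (at 0)"
      using polyalg_gradient[OF g] by metis
    have "v (cross (cnj_vec b) (l + t *s ea), l + t *s ea) = t * g (l + t *s ea)" for t
    proof -
      have "(\<Prod>c\<in>Q' - {a}. pairing c (l + t *s ea)) =
          pairing b (l + t *s ea) * (\<Prod>c\<in>Q' - {a} - {b}. pairing c (l + t *s ea))"
        using fin ab' ab(3) by (intro prod.remove) auto
      moreover have "pairing b (l + t *s ea) = t * \<kappa>" by (simp add: al e)
      ultimately show ?thesis by (simp only: v_def sec_cross fiber_form_def case_prod_conv g_def mult_ac)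
    qed
    moreover have "((\<lambda>t. t * g (l + t *s ea)) has_field_derivative g l) (at 0)"
      using DERIV_mult[OF DERIV_ident D] by simp
    ultimately have "B v = g l" unfolding B_def slope_def by (simp add: DERIV_imp_deriv)
    moreover have "pairing (cross (cnj_vec b) l) (cnj_vec a) = \<kappa>"
      unfolding \<kappa>_def c_def l_def cnj_vec_cross by (simp add: pairing_expand algebra_simps)
    moreover have "pairing c l \<noteq> 0" if "c \<in> Q' - {a} - {b}" for c
      using general_positionD(4)[OF Q'(1) ab', of c] that ab(3) by (auto simp: l_def det3_def pairing_commute)
    then have "(\<Prod>c\<in>Q' - {a} - {b}. pairing c l) \<noteq> 0" using fin by simp
    ultimately show ?thesis using \<kappa> by (simp add: g_def)
  qed
  define \<psi> where "\<psi> \<theta> (u::unit) s = (B s - cis \<theta> * A s) / B v" for \<theta> u s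
  have lin_AB: "A (s + t) = A s + A t" "B (s + t) = B s + B t" "A (cfun_scale k s) = k * A s" "B (cfun_scale k s) = k * B s"
    if st: "s \<in> sections_through Q d" "t \<in> sections_through Q d" for s t k
  proof -
    obtain f where f: "s = sec f" "f \<in> bihom 1 d" using st(1) by (elim sections_throughE)
    obtain g where g: "t = sec g" "g \<in> bihom 1 d" using st(2) by (elim sections_throughE)
    show "A (s + t) = A s + A t" "B (s + t) = B s + B t" "A (cfun_scale k s) = k * A s" "B (cfun_scale k s) = k * B s"
      unfolding A_def B_def f(1) g(1) by (rule slope_linear_section[OF f(2) g(2)])+
  qed
  obtain T where T: "finite T" "\<And>Q. sections_through Q d \<subseteq> cfun.span T"
    using sections_finite_dimensional by blast
  have null: "hausdorff_measure divisor_dist \<sigma> {divisor_of s | s. s \<in> sections_through Q d \<and> s \<noteq> 0 \<and>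
    (\<exists>\<theta>\<in>{-pi..pi}. \<forall>i\<in>{()}. \<psi> \<theta> i s = 0)} = 0"
  proof (rule null_family[where v = "\<lambda>_. v" and J = "{()}" and \<eta> = "\<lambda>_ \<theta>. \<theta>" and R = pi,
        OF subspace_sections_through T(2,1) bounded_sections_through section_norm_pos[OF d]])
    fix \<theta> :: real and i j :: unit and s t k
    show "finite {()}" "finite {()}" "v \<in> sections_through Q d" using v by auto
    show "\<psi> \<theta> i (s + t) = \<psi> \<theta> i s + \<psi> \<theta> i t" if "s \<in> sections_through Q d" "t \<in> sections_through Q d"
      using lin_AB[OF that] by (simp add: \<psi>_def add_divide_distrib diff_divide_distrib algebra_simps)
    show "\<psi> \<theta> i (cfun_scale k s) = k * \<psi> \<theta> i s" if "s \<in> sections_through Q d"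
      using lin_AB[OF that that] by (simp add: \<psi>_def algebra_simps diff_divide_distrib)
    show "cmod (\<psi> \<theta> i v - (if i = j then 1 else 0)) \<le> 1 / (2 * real (card {()}))"
      using Bv by (simp add: \<psi>_def Av)
    show "\<bar>\<theta>\<bar> \<le> pi" if "\<theta> \<in> {-pi..pi}" using that by auto
    show "real (card {()}) + 2 * (real (cfun.dim (sections_through Q d)) - 1 - real (card {()})) < \<sigma>" using \<sigma> by simp
    show "\<exists>C. \<forall>y\<in>{-pi..pi}. cmod (\<psi> y i s) \<le> C \<and> (\<forall>y'\<in>{-pi..pi}. cmod (\<psi> y i s - \<psi> y' i s) \<le> C * (\<Sum>c\<in>{()}. \<bar>y - y'\<bar>))"
    proof (intro exI[of _ "(cmod (A s) + cmod (B s)) / cmod (B v)"] ballI conjI)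
      fix y y' :: real
      have "cmod (B s - cis y * A s) \<le> cmod (A s) + cmod (B s)"
        using norm_triangle_ineq4[of "B s" "cis y * A s"] by (simp add: norm_mult)
      then show "cmod (\<psi> y i s) \<le> (cmod (A s) + cmod (B s)) / cmod (B v)"
        by (simp add: \<psi>_def norm_divide divide_right_mono)
      have "\<psi> y i s - \<psi> y' i s = (cis y' - cis y) * A s / B v"
        by (simp add: \<psi>_def diff_divide_distrib[symmetric] algebra_simps)
      then have "cmod (\<psi> y i s - \<psi> y' i s) = cmod (cis y' - cis y) * cmod (A s) / cmod (B v)"
        by (simp add: norm_mult norm_divide)
      also have "\<dots> \<le> \<bar>y' - y\<bar> * (cmod (A s) + cmod (B s)) / cmod (B v)"
        using cis_lipschitz[of y' y] by (intro divide_right_mono mult_mono) auto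
      finally show "cmod (\<psi> y i s - \<psi> y' i s) \<le> (cmod (A s) + cmod (B s)) / cmod (B v) * (\<Sum>c\<in>{()}. \<bar>y - y'\<bar>)"
        by (simp add: abs_minus_commute mult.commute)
    qed
  qed
  have cond: "\<exists>\<theta>\<in>{-pi..pi}. \<forall>i\<in>{()}. \<psi> \<theta> i s = 0"
    if s: "s \<in> sections_through Q d" and \<alpha>\<beta>: "\<alpha> \<noteq> 0" "\<beta> \<noteq> 0" and van: "vanishes_on_tw s (\<alpha> *s a + \<beta> *s b)" for s \<alpha> \<beta>
  proof -
    obtain f where f: "s = sec f" "f \<in> bihom 1 d" "\<forall>q\<in>Q. vanishes_on_tw f q"
      using s unfolding sections_through_def by blast
    have va: "slope l s (cnj_vec a) ea = 0" "slope l s (cnj_vec b) eb = 0"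
      unfolding f(1) by (rule slope_vanishes; simp add: vanishes_on_tw_sec f(3) ab al e)+
    have "slope l s (cnj_vec (\<alpha> *s a + \<beta> *s b)) (\<alpha> *s ea + (- \<beta>) *s eb) = 0"
      by (rule slope_vanishes[OF van]) (simp_all add: al e)
    then have "slope l s (cnj \<alpha> *s cnj_vec a + cnj \<beta> *s cnj_vec b) (\<alpha> *s ea + (- \<beta>) *s eb) = 0" by simp
    then have "cnj \<beta> * \<alpha> * B s = cnj \<alpha> * \<beta> * A s"
      unfolding f(1) slope_linear_lift[OF f(2)] slope_linear_direction[OF f(2)]
      unfolding f(1)[symmetric] va A_def B_def by (simp add: algebra_simps)
    then have B: "B s = (cnj \<alpha> * \<beta> / (cnj \<beta> * \<alpha>)) * A s" using \<alpha>\<beta> by (simp add: field_simps)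
    define z where "z = cnj \<alpha> * \<beta> / (cnj \<beta> * \<alpha>)"
    have "cmod z = 1" using \<alpha>\<beta> by (simp add: z_def norm_mult norm_divide)
    then have "cis (Arg z) = z" using cis_Arg[of z] by (cases "z = 0") (auto simp: sgn_div_norm)
    then have "\<psi> (Arg z) () s = 0" using B by (simp add: \<psi>_def z_def)
    moreover have "Arg z \<in> {-pi..pi}" using Arg_bounded[of z] by auto
    ultimately show ?thesis by auto
  qed
  show ?thesis
  proof (rule hausdorff_null_subset[OF null], rule subsetI)
    fix S assume "S \<in> {divisor_of s | s. s \<in> sections_through Q d \<and> s \<noteq> 0 \<and>
      (\<exists>\<alpha> \<beta>. \<alpha> \<noteq> 0 \<and> \<beta> \<noteq> 0 \<and> vanishes_on_tw s (\<alpha> *s a + \<beta> *s b))}"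
    then obtain s \<alpha> \<beta> where s: "S = divisor_of s" "s \<in> sections_through Q d" "s \<noteq> 0"
      and \<alpha>\<beta>: "\<alpha> \<noteq> 0" "\<beta> \<noteq> 0" "vanishes_on_tw s (\<alpha> *s a + \<beta> *s b)" by blast
    from cond[OF s(2) \<alpha>\<beta>] show "S \<in> {divisor_of s | s. s \<in> sections_through Q d \<and> s \<noteq> 0 \<and>
      (\<exists>\<theta>\<in>{-pi..pi}. \<forall>i\<in>{()}. \<psi> \<theta> i s = 0)}" using s by blast
  qed
qed

subsection \<open>Fibers of points off these lines\<close>

text \<open>The values of the sections at three suitable points of the fiber of \<open>q\<close> can be prescribed if \<open>q\<close>
  is in general position with respect to the given points. The points are taken over \<open>cross q (c i)\<close>,
  so that they move with \<open>q\<close>, and \<open>c 0\<close> is one of the given points.\<close>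

lemma dual_sections:
  assumes Q: "general_position (insert q Q)" "q \<notin> Q" "card Q \<le> d" and ne: "Q \<noteq> {}"
  obtains c v where "\<And>j. j \<in> {0,1,2::nat} \<Longrightarrow> v j \<in> sections_through Q d"
    "\<And>i j. i \<in> {0,1,2} \<Longrightarrow> j \<in> {0,1,2} \<Longrightarrow>
      v j (cross (cnj_vec q) (cross q (c i)), cross q (c i)) = (if i = j then 1 else 0)"
proof -
  note gp = general_positionD[OF Q(1)]
  have fin: "finite Q" using gp(1) by simp
  have q0: "q \<noteq> 0" using gp(2) by simp
  obtain a where a: "a \<in> Q" using ne by blast
  have aq: "cross b q \<noteq> 0" if "b \<in> Q" for b using gp(3)[of b q] that Q(2) by auto
  have "0 \<notin> (\<lambda>b. cross b q) ` Q" using aq by auto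
  then obtain c1 where c1: "\<And>b. b \<in> Q \<Longrightarrow> pairing (cross b q) c1 \<noteq> 0"
    using exists_off_planes[of "(\<lambda>b. cross b q) ` Q"] fin by (metis finite_imageI imageI)
  define l1 where "l1 = cross q c1"
  have bl1: "pairing b l1 \<noteq> 0" if "b \<in> Q" for b using c1[OF that] by (simp add: l1_def pairing_cross_cycle)
  then have "l1 \<noteq> 0" using a by auto
  then have "0 \<notin> insert l1 ((\<lambda>b. cross b q) ` Q)" using aq by auto
  then obtain c2 where c2: "\<And>x. x \<in> insert l1 ((\<lambda>b. cross b q) ` Q) \<Longrightarrow> pairing x c2 \<noteq> 0"
    using exists_off_planes[of "insert l1 ((\<lambda>b. cross b q) ` Q)"] fin by (metis finite_imageI finite_insert)
  define l2 where "l2 = cross q c2"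
  have bl2: "pairing b l2 \<noteq> 0" if "b \<in> Q" for b using c2[of "cross b q"] that by (simp add: l2_def pairing_cross_cycle)
  define l0 where "l0 = cross q a"
  have l0: "l0 \<noteq> 0" using aq[OF a] cross_anticommute[of a q] by (auto simp: l0_def)
  have al0: "pairing a l0 = 0" by (simp add: l0_def)
  have bl0: "pairing b l0 \<noteq> 0" if "b \<in> Q - {a}" for b
  proof -
    have "det3 q a b \<noteq> 0" using gp(4)[of q a b] a that Q(2) by auto
    then show ?thesis by (simp add: l0_def det3_def pairing_commute)
  qed
  \<comment> \<open>The matrix of the values of \<open>g0\<close>, \<open>g l2\<close>, \<open>g l1\<close> over \<open>l0\<close>, \<open>l1\<close>, \<open>l2\<close> is triangular: \<open>g m\<close> contains the
    equation of \<open>a\<close>, which vanishes at \<open>l0\<close>, and the first coordinate of the point over \<open>m\<close> is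
    orthogonal to \<open>m\<close>. The powers make up for the missing degree.\<close>
  define k where "k = d - card Q"
  have k: "card Q + k = d" using Q(3) by (simp add: k_def)
  define h where "h = cnj_vec l0"
  define g0 where "g0 = (\<lambda>x. fiber_form a (Q - {a}) x * (\<lambda>(v, w). pairing h w ^ (k + 1)) x)"
  define g where "g m = (\<lambda>x. (\<lambda>(v, w). pairing v m) x * ((\<lambda>(v, w). \<Prod>b\<in>Q. pairing b w) x * (\<lambda>(v, w). pairing a w ^ k) x))" for m
  have g0: "g0 \<in> bihom 1 d"
  proof -
    have "card Q \<ge> 1" using fin ne by (simp add: Suc_le_eq card_gt_0_iff)
    then have "1 + 0 = (1::nat)" "card (Q - {a}) + (k + 1) = d" using fin a k by (simp_all add: card_Diff_singleton)
    then show ?thesis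
      using bihom_mult[OF fiber_form_bihom[of "Q - {a}" a] bihom_power_pairing_snd[of h "k + 1"]] fin
      unfolding g0_def by simp
  qed
  have g: "g m \<in> bihom 1 d" for m
    using bihom_mult[OF bihom_pairing_fst[of m] bihom_mult[OF bihom_prod_pairing_snd[OF fin] bihom_power_pairing_snd[of a k]]] k
    unfolding g_def by simp
  have van0: "vanishes_on_tw g0 b" if "b \<in> Q" for b
    unfolding vanishes_on_tw_def g0_def using fiber_form_vanishes[of "Q - {a}" b a] fin that by auto
  have van: "vanishes_on_tw (g m) b" if "b \<in> Q" for b m
    unfolding vanishes_on_tw_def g_def using fin that by auto
  define E where "E f w = f (cross (cnj_vec q) w, w)" for f :: "vec3 \<times> vec3 \<Rightarrow> complex" and w
  have E0: "E (g m) l0 = 0" for m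
  proof -
    have "(\<Prod>b\<in>Q. pairing b l0) = 0" using fin a al0 by auto
    then show ?thesis by (simp add: E_def g_def)
  qed
  have E00: "E g0 l0 \<noteq> 0"
  proof -
    have "pairing (cross (cnj_vec q) l0) (cnj_vec a) = - pairing l0 (cnj_vec l0)"
      by (simp add: l0_def pairing_expand algebra_simps)
    then have "pairing (cross (cnj_vec q) l0) (cnj_vec a) \<noteq> 0" using l0 by simp
    moreover have "pairing h l0 \<noteq> 0" using l0 by (simp add: h_def)
    moreover have "(\<Prod>b\<in>Q - {a}. pairing b l0) \<noteq> 0" using bl0 fin by simp
    ultimately show ?thesis by (simp add: E_def g0_def fiber_form_def)
  qed
  have det: "pairing (cross (cnj_vec q) l1) l2 \<noteq> 0"
  proof -
    have "pairing (cross (cnj_vec q) l1) l2 = pairing q (cnj_vec q) * pairing l1 c2"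
      by (simp add: l1_def l2_def pairing_expand algebra_simps)
    then show ?thesis using q0 c2[of l1] by simp
  qed
  have det': "pairing (cross (cnj_vec q) l2) l1 \<noteq> 0"
  proof -
    have "pairing (cross (cnj_vec q) l2) l1 = - pairing (cross (cnj_vec q) l1) l2"
      by (simp add: pairing_expand algebra_simps)
    then show ?thesis using det by simp
  qed
  have prods: "(\<Prod>b\<in>Q. pairing b l1) \<noteq> 0" "(\<Prod>b\<in>Q. pairing b l2) \<noteq> 0" using bl1 bl2 fin by auto
  have E1: "E (g l2) l1 \<noteq> 0" "E (g l1) l1 = 0" and E2: "E (g l1) l2 \<noteq> 0" "E (g l2) l2 = 0"
    using det det' prods bl1[OF a] bl2[OF a] by (auto simp: E_def g_def)
  define v1 where "v1 x = (1 / E (g l2) l1) * g l2 x" for x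
  define v2 where "v2 x = (1 / E (g l1) l2) * g l1 x" for x
  define v0 where "v0 x = (1 / E g0 l0) * (g0 x + ((- E g0 l1) * v1 x + (- E g0 l2) * v2 x))" for x
  have bi: "v1 \<in> bihom 1 d" "v2 \<in> bihom 1 d" unfolding v1_def[abs_def] v2_def[abs_def] by (intro bihom_cmult g)+
  have bi0: "v0 \<in> bihom 1 d" unfolding v0_def[abs_def] by (intro bihom_cmult bihom_add g0 bi)
  have vv: "vanishes_on_tw v1 b" "vanishes_on_tw v2 b" if "b \<in> Q" for b
    using van[OF that] by (auto simp: vanishes_on_tw_def v1_def v2_def)
  have vv0: "vanishes_on_tw v0 b" if "b \<in> Q" for b
    using van0[OF that] vv[OF that] by (auto simp: vanishes_on_tw_def v0_def)
  have Ev1: "E v1 l0 = 0" "E v1 l1 = 1" "E v1 l2 = 0" using E0 E1 E2 by (simp_all add: E_def v1_def)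
  have Ev2: "E v2 l0 = 0" "E v2 l1 = 0" "E v2 l2 = 1" using E0 E1 E2 by (simp_all add: E_def v2_def)
  have Ev0_eq: "E v0 w = (1 / E g0 l0) * (E g0 w + ((- E g0 l1) * E v1 w + (- E g0 l2) * E v2 w))" for w
    by (simp add: E_def v0_def)
  have Ev0: "E v0 l0 = 1" "E v0 l1 = 0" "E v0 l2 = 0" using E00 by (simp_all add: Ev0_eq Ev1 Ev2)
  define c where "c i = (if i = 0 then a else if i = 1 then c1 else c2)" for i :: nat
  define v where "v j = sec (if j = 0 then v0 else if j = 1 then v1 else v2)" for j :: nat
  show ?thesis
  proof
    fix j :: nat assume "j \<in> {0,1,2}"
    show "v j \<in> sections_through Q d"
      unfolding v_def using bi bi0 vv vv0 by (intro sections_throughI) auto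
    fix i :: nat assume "i \<in> {0,1,2}"
    have "v j (cross (cnj_vec q) w, w) = E (if j = 0 then v0 else if j = 1 then v1 else v2) w" for w
      by (simp add: v_def E_def)
    moreover have "cross q (c i) = (if i = 0 then l0 else if i = 1 then l1 else l2)"
      by (simp add: c_def l0_def l1_def l2_def)
    ultimately show "v j (cross (cnj_vec q) (cross q (c i)), cross q (c i)) = (if i = j then 1 else 0)"
      using \<open>i \<in> {0,1,2}\<close> \<open>j \<in> {0,1,2}\<close> Ev0 Ev1 Ev2 by auto
  qed
qed

text \<open>Near a point \<open>q0\<close> in general position, the surfaces that contain the fiber of some \<open>q\<close> satisfy
  three complex conditions depending on the four real coordinates of \<open>q\<close>.\<close>

lemma null_general:
  assumes Q: "general_position (insert q0 Q)" "q0 \<notin> Q" "card Q \<le> d" and d: "d \<ge> 1"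
    and i: "q0 $ (i::3) = 1"
    and \<sigma>: "2 * (real (cfun.dim (sections_through Q d)) - 1) - 2 < \<sigma>"
  obtains W where "open W" "q0 \<in> W"
    "hausdorff_measure divisor_dist \<sigma> {divisor_of s | s. s \<in> sections_through Q d \<and> s \<noteq> 0 \<and>
      (\<exists>q\<in>W. q $ i = 1 \<and> vanishes_on_tw s q)} = 0"
proof -
  obtain Q1 where Q1: "general_position (insert q0 Q1)" "q0 \<notin> Q1" "card Q1 \<le> d" "Q1 \<noteq> {}" "Q \<subseteq> Q1"
  proof (cases "Q = {}")
    case True
    then obtain a where "a \<notin> {q0}" "general_position (insert a {q0})" using general_position_extend_one Q(1) by metis
    then show ?thesis using that[of "{a}"] True d by (auto simp: insert_commute)
  next
    case False then show ?thesis using that Q by blast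
  qed
  obtain c v where v: "\<And>j. j \<in> {0,1,2::nat} \<Longrightarrow> v j \<in> sections_through Q1 d"
    and dual: "\<And>i j. i \<in> {0,1,2} \<Longrightarrow> j \<in> {0,1,2} \<Longrightarrow>
      v j (cross (cnj_vec q0) (cross q0 (c i)), cross q0 (c i)) = (if i = j then 1 else 0)"
    by (rule dual_sections[OF Q1(1-4)]) blast
  define \<psi> where "\<psi> q k s = s (cross (cnj_vec q) (cross q (c k)), cross q (c k))" for q and k :: nat and s :: "vec3 \<times> vec3 \<Rightarrow> complex"
  define X :: "(vec3 \<Rightarrow> complex) set" where "X = range (\<lambda>j q. q $ j) \<union> range (\<lambda>j q. cnj (q $ j))"
  have \<psi>_poly: "(\<lambda>q. \<psi> q k s) \<in> polyalg X" if s: "s \<in> sections_through Q d" for k s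
  proof -
    obtain f where f: "s = sec f" "f \<in> bihom 1 d" using s by (elim sections_throughE)
    have "polyvec X (\<lambda>q. q)" "polyvec X cnj_vec" by (auto simp: polyvec_def X_def intro: polyalg.gen)
    then have "(\<lambda>q. f (cross (cnj_vec q) (cross q (c k)), cross q (c k))) \<in> polyalg X"
      by (intro bihom_polyalg[OF f(2)] polyvec_cross polyvec_const)
    then show ?thesis by (simp add: \<psi>_def f(1))
  qed
  have vQ: "v j \<in> sections_through Q d" if "j \<in> {0,1,2}" for j
    using sections_through_mono[OF Q1(5) v[OF that]] .
  \<comment> \<open>\<open>1 / 6\<close> is the bound \<open>1 / (2 n)\<close> for \<open>n = 3\<close> conditions.\<close>
  define W where "W = (\<Inter>k\<in>{0,1,2}. \<Inter>j\<in>{0,1,2}. {q. cmod (\<psi> q k (v j) - (if k = j then 1 else 0)) < 1 / 6}) \<inter> ball q0 1"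
  have W: "open W" "q0 \<in> W"
  proof -
    have cont: "continuous_on UNIV (\<lambda>q. \<psi> q k (v j))" if "j \<in> {0,1,2}" for k j
      by (rule polyalg_continuous[OF \<psi>_poly[OF vQ[OF that]]]) (auto simp: X_def intro!: continuous_intros)
    have "open {q. cmod (\<psi> q k (v j) - (if k = j then 1 else 0)) < 1 / 6}" if "j \<in> {0,1,2}" for k j
      by (intro open_Collect_less continuous_intros cont that)
    then show "open W" unfolding W_def by (intro open_Int open_INT ballI open_ball) auto
    show "q0 \<in> W" using dual by (simp add: W_def \<psi>_def)
  qed
  define U where "U = {q \<in> W. q $ i = 1}"
  define J where "J = (UNIV - {i}) \<times> (UNIV :: bool set)"
  define \<eta> where "\<eta> z q = (if snd z then Re (q $ fst z) else Im (q $ fst z))" for z :: "3 \<times> bool" and q :: vec3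
  define N where "N q q' = (\<Sum>z\<in>J. \<bar>\<eta> z q - \<eta> z q'\<bar>)" for q q'
  have N_nonneg: "0 \<le> N q q'" for q q' by (simp add: N_def sum_nonneg)
  have diff_le: "cmod (q $ j - q' $ j) \<le> N q q'" if "q \<in> U" "q' \<in> U" for q q' j
  proof (cases "j = i")
    case True then show ?thesis using that N_nonneg by (simp add: U_def)
  next
    case False
    have "cmod (q $ j - q' $ j) \<le> \<bar>Re (q $ j - q' $ j)\<bar> + \<bar>Im (q $ j - q' $ j)\<bar>" by (rule cmod_le)
    also have "\<dots> = (\<Sum>z\<in>{(j, True), (j, False)}. \<bar>\<eta> z q - \<eta> z q'\<bar>)" by (simp add: \<eta>_def)
    also have "\<dots> \<le> N q q'" unfolding N_def using False by (intro sum_mono2) (auto simp: J_def)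
    finally show ?thesis .
  qed
  have coord_le: "cmod (q $ j) \<le> norm q0 + 1" if "q \<in> U" for q j
  proof -
    have "norm q \<le> norm q0 + norm (q - q0)" using norm_triangle_ineq[of q0 "q - q0"] by simp
    moreover have "norm (q - q0) < 1" using that by (simp add: U_def W_def dist_norm norm_minus_commute)
    ultimately show ?thesis using Finite_Cartesian_Product.norm_nth_le[of q j] by linarith
  qed
  obtain T where T: "finite T" "\<And>Q. sections_through Q d \<subseteq> cfun.span T"
    using sections_finite_dimensional by blast
  have "hausdorff_measure divisor_dist \<sigma> {divisor_of s | s. s \<in> sections_through Q d \<and> s \<noteq> 0 \<and>
      (\<exists>q\<in>U. \<forall>k\<in>{0,1,2::nat}. \<psi> q k s = 0)} = 0"
  proof (rule null_family[where v = v and J = J and \<eta> = \<eta> and R = "norm q0 + 1",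
        OF subspace_sections_through T(2,1) bounded_sections_through section_norm_pos[OF d]])
    show "finite {0,1,2::nat}" "finite J" by (auto simp: J_def)
    show "v j \<in> sections_through Q d" if "j \<in> {0,1,2}" for j using vQ that .
    show "\<psi> q k (s + t) = \<psi> q k s + \<psi> q k t" for q k s t by (simp add: \<psi>_def)
    show "\<psi> q k (cfun_scale x s) = x * \<psi> q k s" for q k s x by (simp add: \<psi>_def cfun_scale_def)
    show "cmod (\<psi> q k (v j) - (if k = j then 1 else 0)) \<le> 1 / (2 * real (card {0,1,2::nat}))"
      if "q \<in> U" "k \<in> {0,1,2}" "j \<in> {0,1,2}" for q k j
    proof -
      have "cmod (\<psi> q k (v j) - (if k = j then 1 else 0)) < 1 / 6" using that unfolding U_def W_def by blast
      then show ?thesis by simp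
    qed
    show "\<exists>C. \<forall>y\<in>U. cmod (\<psi> y k s) \<le> C \<and> (\<forall>y'\<in>U. cmod (\<psi> y k s - \<psi> y' k s) \<le> C * (\<Sum>c\<in>J. \<bar>\<eta> c y - \<eta> c y'\<bar>))"
      if "s \<in> sections_through Q d" for k s
      unfolding N_def[symmetric]
    proof (rule polyalg_lipschitz[OF \<psi>_poly[OF that] N_nonneg])
      fix x assume "x \<in> X"
      then obtain j where "x = (\<lambda>q. q $ j) \<or> x = (\<lambda>q. cnj (q $ j))" by (auto simp: X_def)
      then have x: "cmod (x y) = cmod (y $ j)" "cmod (x y - x y') = cmod (y $ j - y' $ j)" for y y'
        by (auto simp: complex_mod_cnj simp flip: complex_cnj_diff)
      show "\<exists>C. \<forall>y\<in>U. cmod (x y) \<le> C \<and> (\<forall>y'\<in>U. cmod (x y - x y') \<le> C * N y y')"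
      proof (intro exI[of _ "norm q0 + 1"] ballI conjI)
        fix y y' assume y: "y \<in> U"
        show "cmod (x y) \<le> norm q0 + 1" unfolding x using coord_le[OF y] .
        assume y': "y' \<in> U"
        have "cmod (x y - x y') \<le> 1 * N y y'" unfolding x using diff_le[OF y y'] by simp
        also have "\<dots> \<le> (norm q0 + 1) * N y y'" using N_nonneg by (intro mult_right_mono) auto
        finally show "cmod (x y - x y') \<le> (norm q0 + 1) * N y y'" .
      qed
    qed
    show "\<bar>\<eta> z q\<bar> \<le> norm q0 + 1" if "q \<in> U" for q z
      using coord_le[OF that, of "fst z"] abs_Re_le_cmod[of "q $ fst z"] abs_Im_le_cmod[of "q $ fst z"]
      by (simp add: \<eta>_def)
    have "card J = 4" by (simp add: J_def card_cartesian_product card_Diff_singleton)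
    then show "real (card J) + 2 * (real (cfun.dim (sections_through Q d)) - 1 - real (card {0,1,2::nat})) < \<sigma>"
      using \<sigma> by simp
  qed
  moreover have "{divisor_of s | s. s \<in> sections_through Q d \<and> s \<noteq> 0 \<and> (\<exists>q\<in>W. q $ i = 1 \<and> vanishes_on_tw s q)} \<subseteq>
    {divisor_of s | s. s \<in> sections_through Q d \<and> s \<noteq> 0 \<and> (\<exists>q\<in>U. \<forall>k\<in>{0,1,2::nat}. \<psi> q k s = 0)}"
  proof
    fix S assume "S \<in> {divisor_of s | s. s \<in> sections_through Q d \<and> s \<noteq> 0 \<and> (\<exists>q\<in>W. q $ i = 1 \<and> vanishes_on_tw s q)}"
    then obtain s q where s: "S = divisor_of s" "s \<in> sections_through Q d" "s \<noteq> 0"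
      and q: "q \<in> W" "q $ i = 1" "vanishes_on_tw s q" by blast
    have "\<forall>k\<in>{0,1,2}. \<psi> q k s = 0" using q(3) by (simp add: \<psi>_def vanishes_on_tw_def)
    moreover have "q \<in> U" using q(1,2) by (simp add: U_def)
    ultimately show "S \<in> {divisor_of s | s. s \<in> sections_through Q d \<and> s \<noteq> 0 \<and> (\<exists>q\<in>U. \<forall>k\<in>{0,1,2::nat}. \<psi> q k s = 0)}"
      using s by blast
  qed
  ultimately have "hausdorff_measure divisor_dist \<sigma> {divisor_of s | s. s \<in> sections_through Q d \<and> s \<noteq> 0 \<and>
      (\<exists>q\<in>W. q $ i = 1 \<and> vanishes_on_tw s q)} = 0" by (rule hausdorff_null_subset)
  then show ?thesis by (rule that[OF W])
qed

section \<open>Irreducible members and general members\<close>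

text \<open>If \<open>card Q = d + 1\<close>, a further fiber can only come from a point on a line through two points
  of \<open>Q\<close>, as \<open>d + 2\<close> fibers in general position lie on no surface. Otherwise the points off these lines
  are covered by countably many neighbourhoods in which the dimension is known to drop.\<close>

lemma null_further_fiber:
  assumes Q: "general_position Q" "card Q \<le> d + 1" and d: "d \<ge> 1"
    and \<sigma>: "2 * (real (cfun.dim (sections_through Q d)) - 1) - 1 < \<sigma>"
  shows "hausdorff_measure divisor_dist \<sigma> {divisor_of s | s. s \<in> sections_through Q d \<and> s \<noteq> 0 \<and>
    (\<exists>q. q \<noteq> 0 \<and> (\<forall>a\<in>Q. cross a q \<noteq> 0) \<and> vanishes_on_tw s q)} = 0"
proof -
  define collinear where "collinear a b = {divisor_of s | s. s \<in> sections_through Q d \<and> s \<noteq> 0 \<and>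
    (\<exists>\<alpha> \<beta>. \<alpha> \<noteq> 0 \<and> \<beta> \<noteq> 0 \<and> vanishes_on_tw s (\<alpha> *s a + \<beta> *s b))}" for a b
  define near where "near i W = {divisor_of s | s. s \<in> sections_through Q d \<and> s \<noteq> 0 \<and>
      (\<exists>q\<in>W. q $ i = 1 \<and> vanishes_on_tw s q)}" for i :: 3 and W
  define \<F> where "\<F> i = {W. open W \<and> hausdorff_measure divisor_dist \<sigma> (near i W) = 0}" for i
  have "\<exists>\<F>'. \<F>' \<subseteq> \<F> i \<and> countable \<F>' \<and> \<Union>\<F>' = \<Union>(\<F> i)" for i
  proof -
    have "open W" if "W \<in> \<F> i" for W using that by (simp add: \<F>_def)
    then obtain \<F>' where "\<F>' \<subseteq> \<F> i" "countable \<F>'" "\<Union>\<F>' = \<Union>(\<F> i)" by (rule Lindelof)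
    then show ?thesis by blast
  qed
  then obtain \<G> where \<G>: "\<And>i. \<G> i \<subseteq> \<F> i" "\<And>i. countable (\<G> i)" "\<And>i. \<Union>(\<G> i) = \<Union>(\<F> i)" by metis
  have "hausdorff_measure divisor_dist \<sigma> (\<Union>p\<in>Q \<times> Q - Id. collinear (fst p) (snd p)) = 0"
  proof (rule hausdorff_null_UN)
    show "countable (Q \<times> Q - Id)" using general_positionD(1)[OF Q(1)] by (intro countable_finite) auto
    show "hausdorff_measure divisor_dist \<sigma> (collinear (fst p) (snd p)) = 0" if "p \<in> Q \<times> Q - Id" for p
      unfolding collinear_def by (rule null_collinear[OF Q d _ _ _ \<sigma>]) (use that in auto)
  qed
  moreover have "hausdorff_measure divisor_dist \<sigma> (\<Union>i\<in>UNIV. \<Union>W\<in>\<G> i. near i W) = 0"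
    using \<G>(1) by (intro hausdorff_null_UN \<G>(2)) (auto simp: \<F>_def intro: countable_finite)
  ultimately have null: "hausdorff_measure divisor_dist \<sigma>
      (\<Union>t::bool. if t then \<Union>p\<in>Q \<times> Q - Id. collinear (fst p) (snd p) else \<Union>i\<in>UNIV. \<Union>W\<in>\<G> i. near i W) = 0"
    by (intro hausdorff_null_UN) (auto intro: countable_finite)
  show ?thesis
  proof (rule hausdorff_null_subset[OF null], rule subsetI)
    fix S assume "S \<in> {divisor_of s | s. s \<in> sections_through Q d \<and> s \<noteq> 0 \<and>
      (\<exists>q. q \<noteq> 0 \<and> (\<forall>a\<in>Q. cross a q \<noteq> 0) \<and> vanishes_on_tw s q)}"
    then obtain s q where S: "S = divisor_of s" and s: "s \<in> sections_through Q d" "s \<noteq> 0"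
      and q: "q \<noteq> 0" "\<And>a. a \<in> Q \<Longrightarrow> cross a q \<noteq> 0" "vanishes_on_tw s q" by blast
    have "(\<exists>p\<in>Q \<times> Q - Id. S \<in> collinear (fst p) (snd p)) \<or> (\<exists>i. \<exists>W\<in>\<G> i. S \<in> near i W)"
    proof (cases "\<exists>a\<in>Q. \<exists>b\<in>Q. a \<noteq> b \<and> det3 a b q = 0")
      case True
      then obtain a b where ab: "a \<in> Q" "b \<in> Q" "a \<noteq> b" "det3 a b q = 0" by blast
      have "pairing q (cross a b) = 0" using ab(4) by (simp add: det3_def pairing_commute)
      then obtain \<alpha> \<beta> where \<alpha>\<beta>: "q = \<alpha> *s a + \<beta> *s b"
        using orthogonal_to_cross_imp_combination general_positionD(3)[OF Q(1) ab(1-3)] by metis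
      have "\<alpha> \<noteq> 0" using q(2)[OF ab(2)] \<alpha>\<beta> by auto
      moreover have "\<beta> \<noteq> 0" using q(2)[OF ab(1)] \<alpha>\<beta> by auto
      ultimately have "S \<in> collinear a b" unfolding collinear_def using S s q(3) \<alpha>\<beta> by blast
      then show ?thesis using ab by force
    next
      case False
      obtain i where i: "q $ i \<noteq> 0" using q(1) by (auto simp: vec_eq_iff)
      define q' where "q' = (1 / q $ i) *s q"
      have q': "q' \<noteq> 0" "q' $ i = 1" using i by (auto simp: q'_def vec_eq_iff intro!: exI[of _ i])
      have crq': "cross a q' \<noteq> 0" if "a \<in> Q" for a using q(2)[OF that] i by (simp add: q'_def)
      have van: "vanishes_on_tw s q'"
      proof -
        obtain f where f: "s = sec f" "f \<in> bihom 1 d" using s(1) by (elim sections_throughE)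
        have "f (cross (cnj_vec q') w, w) = 0" if w: "pairing q' w = 0" for w
        proof -
          have "pairing q w = 0" using w i by (simp add: q'_def)
          then have "f (cross (cnj_vec q) w, w) = 0" using q(3) by (simp add: f(1) vanishes_on_tw_sec vanishes_on_tw_def)
          then have "f (cnj (1 / q $ i) *s cross (cnj_vec q) w, 1 *s w) = 0" unfolding bihom_scale[OF f(2)] by simp
          then show ?thesis by (simp add: q'_def)
        qed
        then show ?thesis by (simp add: f(1) vanishes_on_tw_sec vanishes_on_tw_def)
      qed
      have gp: "general_position (insert q' Q)"
      proof (rule general_position_insert[OF Q(1) q'(1) crq'])
        fix a b assume "a \<in> Q" "b \<in> Q" "a \<noteq> b"
        then have "det3 a b q \<noteq> 0" using False by blast
        then show "det3 a b q' \<noteq> 0" using i by (simp add: det3_def q'_def)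
      qed
      have q'Q: "q' \<notin> Q" using crq'[of q'] by auto
      have "card Q \<le> d"
      proof (rule ccontr)
        assume "\<not> card Q \<le> d"
        then have card: "card (insert q' Q) = d + 2" using Q(2) q'Q general_positionD(1)[OF Q(1)] by simp
        obtain f where f: "s = sec f" "f \<in> bihom 1 d" "\<forall>q\<in>Q. vanishes_on_tw f q"
          using s(1) unfolding sections_through_def by blast
        have "sec f = 0"
        proof (rule no_section_through_many_fibers[OF gp card d f(2)])
          fix b assume "b \<in> insert q' Q"
          then show "vanishes_on_tw f b" using f(1,3) van by (auto simp: vanishes_on_tw_sec)
        qed
        then show False using f(1) s(2) by blast
      qed
      moreover have "2 * (real (cfun.dim (sections_through Q d)) - 1) - 2 < \<sigma>" using \<sigma> by linarith
      ultimately obtain W where W: "open W" "q' \<in> W" "hausdorff_measure divisor_dist \<sigma> (near i W) = 0"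
        unfolding near_def by (rule null_general[OF gp q'Q _ d q'(2)])
      then have "q' \<in> \<Union>(\<F> i)" unfolding \<F>_def by blast
      then obtain W' where "W' \<in> \<G> i" "q' \<in> W'" unfolding \<G>(3)[symmetric] by blast
      moreover from this have "S \<in> near i W'" unfolding near_def using S s q'(2) van by blast
      ultimately show ?thesis by blast
    qed
    then show "S \<in> (\<Union>t::bool. if t then \<Union>p\<in>Q \<times> Q - Id. collinear (fst p) (snd p) else \<Union>i\<in>UNIV. \<Union>W\<in>\<G> i. near i W)"
    proof
      assume "\<exists>p\<in>Q \<times> Q - Id. S \<in> collinear (fst p) (snd p)"
      then show ?thesis by (intro UN_I[of True]) auto
    next
      assume "\<exists>i. \<exists>W\<in>\<G> i. S \<in> near i W"
      then show ?thesis by (intro UN_I[of False]) auto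
    qed
  qed
qed

theorem theorem3p4:
  fixes d n :: nat and A :: "point set"
  assumes "d \<ge> 1" and "n \<le> d + 1" and "A \<in> twistor_unions_star n"
  shows "(\<exists>S\<in>linear_system 1 d. irreducible_divisor S \<and> A \<subseteq> supp S) \<and>
    (\<exists>B. B \<subseteq> linear_system_through A 1 d \<and>
      real_dim B < linear_system_real_dim (linear_system_through A 1 d) \<and>
      (\<forall>S\<in>linear_system_through A 1 d - B. \<forall>C\<in>twistor_fibers.
        C \<subseteq> supp S \<longrightarrow> C \<in> connected_components_of (subtopology flag_zariski A)))"
proof -
  obtain Q where Q: "general_position Q" "card Q = n" "A = (\<Union>q\<in>Q. tw q)"
    using twistor_unions_star_cases[OF assms(3)] by blast
  have card: "card Q \<le> d + 1" using Q(2) assms(2) by simp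
  have Q0: "0 \<notin> Q" using general_positionD(2)[OF Q(1)] by blast
  obtain Q' where Q': "general_position Q'" "Q \<subseteq> Q'" "card Q' = d + 1"
    using general_position_extend[OF Q(1) card] by blast
  have irred: "\<exists>S\<in>linear_system 1 d. irreducible_divisor S \<and> A \<subseteq> supp S"
  proof (intro bexI conjI)
    show "A \<subseteq> supp (divisor_of (sec (fiber_sum Q')))"
      using irreducible_fiber_sum(3)[OF Q'(1,3) assms(1)] Q'(2) unfolding Q(3) by blast
  qed (use irreducible_fiber_sum(1,2)[OF Q'(1,3) assms(1)] in blast)+
  define N where "N = real (cfun.dim (sections_through Q d))"
  have N: "N \<ge> 2" unfolding N_def using dim_sections_through_ge_2[OF Q(1) card assms(1)] by simp
  define B where "B = {divisor_of s | s. s \<in> sections_through Q d \<and> s \<noteq> 0 \<and>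
    (\<exists>q. q \<noteq> 0 \<and> (\<forall>a\<in>Q. cross a q \<noteq> 0) \<and> vanishes_on_tw s q)}"
  define \<sigma> where "\<sigma> = 2 * (N - 1) - 1 / 2"
  have lin: "linear_system_through A 1 d = {divisor_of s | s. s \<in> sections_through Q d \<and> s \<noteq> 0}"
    unfolding Q(3) by (rule linear_system_through_eq[OF assms(1) Q0])
  have "B \<subseteq> linear_system_through A 1 d" unfolding lin B_def by blast
  moreover have "real_dim B < linear_system_real_dim (linear_system_through A 1 d)"
  proof -
    have "hausdorff_measure divisor_dist \<sigma> B = 0"
      unfolding B_def by (rule null_further_fiber[OF Q(1) card assms(1)]) (simp add: \<sigma>_def N_def)
    moreover have "0 < \<sigma>" using N by (simp add: \<sigma>_def)
    ultimately have "real_dim B \<le> ereal \<sigma>"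
      unfolding real_dim_def hausdorff_dim_def by (intro Inf_lower) blast
    also have "ereal \<sigma> < ereal (2 * (N - 1))" by (simp add: \<sigma>_def)
    also have "\<dots> = linear_system_real_dim (linear_system_through A 1 d)"
      unfolding linear_system_real_dim_def Q(3) dim_linear_system_through[OF assms(1) Q0] N_def ..
    finally show ?thesis .
  qed
  moreover have "C \<in> connected_components_of (subtopology flag_zariski A)"
    if S: "S \<in> linear_system_through A 1 d - B" and C: "C \<in> twistor_fibers" "C \<subseteq> supp S" for S C
  proof -
    obtain s where s: "S = divisor_of s" "s \<in> sections_through Q d" "s \<noteq> 0" using S unfolding lin by blast
    obtain q where q: "q \<noteq> 0" "C = tw q" using C(1) by (auto simp: twistor_fibers_def P2_def)
    obtain f where f: "s = sec f" "f \<in> bihom 1 d" using s(2) by (elim sections_throughE)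
    have "vanishes_on_tw s q"
      using tw_subset_supp[OF f(2) q(1)] C(2) assms(1) unfolding q(2) s(1) f(1)
      by (simp add: vanishes_on_tw_sec vanishes_on_tw_def)
    then have "\<exists>a\<in>Q. cross a q = 0" using S s q(1) unfolding B_def by blast
    then obtain a where a: "a \<in> Q" "cross a q = 0" by blast
    obtain c where c: "a = c *s q" using cross_eq_0_imp_multiple a(2) q(1) by blast
    moreover have "c \<noteq> 0" using c Q0 a(1) by auto
    ultimately have "tw a = C" using tw_scale q(2) by simp
    then show ?thesis using tw_is_component[OF Q(1) a(1)] Q(3) by simp
  qed
  ultimately show ?thesis using irred by blast
qed

end
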